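(* Let $\Phi_1,\Phi_2$ be quasi-Young functions of order $r_0\in(0,1]$, let $\omega,v\in\mathscr P_E(\mathbf R^{2d})$ with $v$ submultiplicative be such that $\omega$ is $v$-moderate, let $\phi\in\Sigma_1(\mathbf R^d)\setminus\{0\}$ and let $\phi_0(x)=\pi^{-d/4}e^{-\frac12|x|^2}$. Let $\psi$ and $\psi_0$ be canonical dual windows for $\phi$ and $\phi_0$, respectively, with respect to some lattice $\varepsilon\mathbf Z^{2d}$, $\varepsilon>0$. Then, for all $f\in\Sigma_1'(\mathbf R^d)$ and with implied constants independent of $f$, $$\|V_{\phi_0}f\|_{L^{\Phi_1,\Phi_2}_{(\omega)}}\lesssim\|V_{\phi_0}\psi\|_{L^{r_0}_{(v)}}\|V_\phi f\|_{L^{\Phi_1,\Phi_2}_{(\omega)}}$$ and $$\|V_{\phi}f\|_{L^{\Phi_1,\Phi_2}_{(\omega)}}\lesssim\|V_{\phi}\psi_0\|_{L^{r_0}_{(v)}}\|V_{\phi_0} f\|_{L^{\Phi_1,\Phi_2}_{(\omega)}}.$$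
   Context: Weights: a weight on $\mathbf R^n$ is a positive $\omega\in L^\infty_{loc}$ with $1/\omega\in L^\infty_{loc}$. It is $v$-moderate, for a positive weight $v$, if $\omega(x+y)\lesssim\omega(x)v(y)$ for all $x,y$; $\mathscr P_E(\mathbf R^n)$ is the set of weights that are $v$-moderate for some $v$. A weight $v$ is submultiplicative if it is even and $v(x+y)\lesssim v(x)v(y)$. $A\lesssim B$ means $A\le cB$ for a constant $c>0$. Young functions: a Young function is a convex $\Phi_0:[0,\infty)\to[0,\infty]$ with $\Phi_0(0)=0$, $\lim_{t\to\infty}\Phi_0(t)=\infty$; a quasi-Young function of order $r_0\in(0,1]$ is $\Phi(t)=\Phi_0(t^{r_0})$ with $\Phi_0$ Young. Orlicz quasi-norms: $\|f\|_{L^\Phi(\mathbf R^d)}=\inf\{\lambda>0:\int\Phi(|f|/\lambda)\,dx\le1\}$; $\|F\|_{L^{\Phi_1,\Phi_2}_{(\omega)}(\mathbf R^{2d})}=\big\|\,\xi\mapsto\|F(\cdot,\xi)\omega(\cdot,\xi)\|_{L^{\Phi_1}(\mathbf R^d)}\big\|_{L^{\Phi_2}(\mathbf R^d)}$; $\|F\|_{L^{r_0}_{(v)}}=\|Fv\|_{L^{r_0}(\mathbf R^{2d})}$. These are set to $\infty$ when not finite. Gelfand–Shilov space: $\Sigma_1(\mathbf R^d)$ is the set of $f\in C^\infty(\mathbf R^d)$ such that $\sup_{\alpha,\beta,x}|x^\beta\partial^\alpha f(x)|/(h^{|\alpha+\beta|}\alpha!\beta!)<\infty$ for every $h>0$;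 $\Sigma_1'(\mathbf R^d)$ is its dual. Short-time Fourier transform: $V_\phi f(x,\xi)=\mathscr F(f\,\overline{\phi(\cdot-x)})(\xi)$, where $\mathscr Fg(\xi)=(2\pi)^{-d/2}\int g(y)e^{-i\langle y,\xi\rangle}dy$ (extended to distributions). Gabor frames: for a window $\phi$ and $\varepsilon>0$, $S^\varepsilon_{\phi,\phi}f=\sum_{j,\iota\in\varepsilon\mathbf Z^d}V_\phi f(j,\iota)\,e^{i\langle\cdot,\iota\rangle}\phi(\cdot-j)$. When $\{e^{i\langle\cdot,\iota\rangle}\phi(\cdot-j)\}_{j,\iota\in\varepsilon\mathbf Z^d}$ is a frame for $L^2(\mathbf R^d)$, the canonical dual window of $\phi$ with respect to the lattice $\varepsilon\mathbf Z^{2d}$ is $\psi=(S^\varepsilon_{\phi,\phi})^{-1}\phi$. *)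

theory Defs
  imports "HOL-Analysis.Analysis"
begin

section \<open>Weights\<close>

definition Linf_loc :: "('a::euclidean_space \<Rightarrow> real) \<Rightarrow> bool" where
  "Linf_loc w \<longleftrightarrow> w \<in> borel_measurable lebesgue \<and>
     (\<forall>K. compact K \<longrightarrow> (\<exists>C. AE x in lebesgue. x \<in> K \<longrightarrow> \<bar>w x\<bar> \<le> C))"

definition weight :: "('a::euclidean_space \<Rightarrow> real) \<Rightarrow> bool" where
  "weight w \<longleftrightarrow> (\<forall>x. w x > 0) \<and> Linf_loc w \<and> Linf_loc (\<lambda>x. 1 / w x)"

definition moderate :: "('a::euclidean_space \<Rightarrow> real) \<Rightarrow> ('a \<Rightarrow> real) \<Rightarrow> bool" where
  "moderate v w \<longleftrightarrow> (\<exists>c>0. \<forall>x y. w (x + y) \<le> c * (w x * v y))"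

definition P_E :: "('a::euclidean_space \<Rightarrow> real) set" where
  "P_E = {w. weight w \<and> (\<exists>v. weight v \<and> moderate v w)}"

definition submultiplicative :: "('a::euclidean_space \<Rightarrow> real) \<Rightarrow> bool" where
  "submultiplicative v \<longleftrightarrow>
     (\<forall>x. v (- x) = v x) \<and> (\<exists>c>0. \<forall>x y. v (x + y) \<le> c * (v x * v y))"


section \<open>Young functions and Orlicz quasi-norms\<close>

text \<open>A function \<open>[0,\<infinity>) \<rightarrow> [0,\<infinity>]\<close> is represented by a map from the reals to
  \<^typ>\<open>ennreal\<close>; its values at negative arguments are never used. Convexity is
  written out because \<^const>\<open>convex_on\<close> does not cover extended real values.\<close>

definition young :: "(real \<Rightarrow> ennreal) \<Rightarrow> bool" where
  "young \<Phi> \<longleftrightarrow>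
     (\<forall>s\<ge>0. \<forall>t\<ge>0. \<forall>u\<in>{0..1}.
        \<Phi> (u * s + (1 - u) * t) \<le> ennreal u * \<Phi> s + ennreal (1 - u) * \<Phi> t) \<and>
     \<Phi> 0 = 0 \<and> (\<Phi> \<longlongrightarrow> top) at_top"

definition quasi_young :: "real \<Rightarrow> (real \<Rightarrow> ennreal) \<Rightarrow> bool" where
  "quasi_young r \<Phi> \<longleftrightarrow> 0 < r \<and> r \<le> 1 \<and>
     (\<exists>\<Phi>\<^sub>0. young \<Phi>\<^sub>0 \<and> (\<forall>t\<ge>0. \<Phi> t = \<Phi>\<^sub>0 (t powr r)))"

text \<open>The extension by \<open>\<Phi> \<infinity> = \<infinity>\<close> is needed for the outer quasi-norm of a mixed one,
  where the inner quasi-norm may be infinite.\<close>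

definition young_ext :: "(real \<Rightarrow> ennreal) \<Rightarrow> ennreal \<Rightarrow> ennreal" where
  "young_ext \<Phi> t = (if t = top then top else \<Phi> (enn2real t))"

text \<open>The argument \<open>g\<close> stands for the modulus of the function whose quasi-norm is taken.
  If no \<open>\<lambda>\<close> is admissible, the infimum is that of the empty set, that is, \<open>\<infinity>\<close>.\<close>

definition orlicz_norm :: "(real \<Rightarrow> ennreal) \<Rightarrow> ('a::euclidean_space \<Rightarrow> ennreal) \<Rightarrow> ennreal" where
  "orlicz_norm \<Phi> g =
     Inf {ennreal l | l. l > 0 \<and> (\<integral>\<^sup>+ x. young_ext \<Phi> (g x / ennreal l) \<partial>lebesgue) \<le> 1}"

definition mixed_orlicz_norm ::
  "(real \<Rightarrow> ennreal) \<Rightarrow> (real \<Rightarrow> ennreal) \<Rightarrow> ('a::euclidean_space \<times> 'a \<Rightarrow> real)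
    \<Rightarrow> ('a \<times> 'a \<Rightarrow> complex) \<Rightarrow> ennreal" where
  "mixed_orlicz_norm \<Phi>\<^sub>1 \<Phi>\<^sub>2 w F =
     orlicz_norm \<Phi>\<^sub>2 (\<lambda>\<xi>. orlicz_norm \<Phi>\<^sub>1 (\<lambda>x. ennreal (cmod (F (x, \<xi>) * of_real (w (x, \<xi>))))))"

definition weighted_Lr_norm ::
  "real \<Rightarrow> ('a::euclidean_space \<Rightarrow> real) \<Rightarrow> ('a \<Rightarrow> complex) \<Rightarrow> ennreal" where
  "weighted_Lr_norm r v F =
     (let I = (\<integral>\<^sup>+ X. ennreal (cmod (F X * of_real (v X)) powr r) \<partial>lebesgue)
      in if I = top then top else ennreal (enn2real I powr (1 / r)))"


section \<open>The Gelfand--Shilov space and its dual\<close>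

definition partial :: "'n::finite \<Rightarrow> (real^'n \<Rightarrow> complex) \<Rightarrow> (real^'n \<Rightarrow> complex)" where
  "partial i f = (\<lambda>x. vector_derivative (\<lambda>t. f (x + t *\<^sub>R axis i 1)) (at 0))"

definition iter_partial :: "'n::finite list \<Rightarrow> (real^'n \<Rightarrow> complex) \<Rightarrow> (real^'n \<Rightarrow> complex)" where
  "iter_partial is f = foldr partial is f"

definition smooth :: "(real^'n::finite \<Rightarrow> complex) \<Rightarrow> bool" where
  "smooth f \<longleftrightarrow> (\<forall>is. iter_partial is f differentiable_on UNIV)"

text \<open>Multi-indices are functions \<^typ>\<open>'n \<Rightarrow> nat\<close>. The index type carries no order, so
  the order in which the partial derivatives making up \<open>\<partial>\<^sup>\<alpha> f\<close> are taken is chosen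
  arbitrarily; for smooth \<open>f\<close> it does not matter.\<close>

definition mi_partial ::
  "('n::finite \<Rightarrow> nat) \<Rightarrow> (real^'n \<Rightarrow> complex) \<Rightarrow> (real^'n \<Rightarrow> complex)" where
  "mi_partial \<alpha> f = iter_partial (SOME is. \<forall>i. count_list is i = \<alpha> i) f"

lemma mi_partial_list_exists: "\<exists>is. \<forall>i. count_list is i = (\<alpha> :: 'n::finite \<Rightarrow> nat) i"
proof -
  obtain ns :: "'n list" where ns: "set ns = UNIV" "distinct ns"
    using finite_distinct_list[of "UNIV :: 'n set"] by auto
  have rep: "count_list (replicate k j) i = (if j = i then k else 0)" for k and i j :: 'n
    by (induction k) auto
  have cnt: "count_list (concat (map (\<lambda>j. replicate (\<alpha> j) j) xs)) i =
      (if i \<in> set xs then \<alpha> i else 0)" if "distinct xs" for xs :: "'n list" and i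
    using that by (induction xs) (auto simp: rep)
  show ?thesis using cnt[OF ns(2)] ns(1) by (metis UNIV_I)
qed

definition mi_fact :: "('n::finite \<Rightarrow> nat) \<Rightarrow> real" where
  "mi_fact \<alpha> = (\<Prod>i\<in>UNIV. fact (\<alpha> i))"

definition mi_monomial :: "('n::finite \<Rightarrow> nat) \<Rightarrow> real^'n \<Rightarrow> real" where
  "mi_monomial \<beta> x = (\<Prod>i\<in>UNIV. (x $ i) ^ \<beta> i)"

definition gs_seminorm :: "real \<Rightarrow> (real^'n::finite \<Rightarrow> complex) \<Rightarrow> ennreal" where
  "gs_seminorm h f = (SUP \<alpha>. SUP \<beta>. SUP x.
     ennreal (cmod (of_real (mi_monomial \<beta> x) * mi_partial \<alpha> f x) /
              (h ^ (\<Sum>i\<in>UNIV. \<alpha> i + \<beta> i) * mi_fact \<alpha> * mi_fact \<beta>)))"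

definition gs_space :: "(real^'n::finite \<Rightarrow> complex) set" where
  "gs_space = {f. smooth f \<and> (\<forall>h>0. gs_seminorm h f < top)}"

text \<open>The topology of \<open>\<Sigma>\<^sub>1\<close> is the projective limit one, given by all the seminorms with
  \<open>h > 0\<close>. They increase as \<open>h\<close> decreases, so that a linear functional is continuous iff it
  is bounded by a multiple of one of them. Only the values on \<open>\<Sigma>\<^sub>1\<close> matter.\<close>

definition gs_dual :: "((real^'n::finite \<Rightarrow> complex) \<Rightarrow> complex) set" where
  "gs_dual = {u.
     (\<forall>f\<in>gs_space. \<forall>g\<in>gs_space. u (\<lambda>x. f x + g x) = u f + u g) \<and>
     (\<forall>c. \<forall>f\<in>gs_space. u (\<lambda>x. c * f x) = c * u f) \<and>
     (\<exists>h>0. \<exists>C::real. \<forall>f\<in>gs_space. ennreal (cmod (u f)) \<le> ennreal C * gs_seminorm h f)}"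


section \<open>The short-time Fourier transform\<close>

definition fourier :: "(real^'n::finite \<Rightarrow> complex) \<Rightarrow> real^'n \<Rightarrow> complex" where
  "fourier g \<xi> = of_real ((2 * pi) powr (- (real CARD('n) / 2))) *
     (LINT y|lebesgue. g y * cis (- (y \<bullet> \<xi>)))"

definition stft ::
  "(real^'n::finite \<Rightarrow> complex) \<Rightarrow> (real^'n \<Rightarrow> complex) \<Rightarrow> (real^'n) \<times> (real^'n) \<Rightarrow> complex" where
  "stft \<phi> f = (\<lambda>(x, \<xi>). fourier (\<lambda>y. f y * cnj (\<phi> (y - x))) \<xi>)"

text \<open>For \<open>u \<in> \<Sigma>\<^sub>1'\<close> the integral against \<open>u\<close> becomes the (bilinear) dual pairing.\<close>

definition stft_dual ::
  "(real^'n::finite \<Rightarrow> complex) \<Rightarrow> ((real^'n \<Rightarrow> complex) \<Rightarrow> complex)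
    \<Rightarrow> (real^'n) \<times> (real^'n) \<Rightarrow> complex" where
  "stft_dual \<phi> u = (\<lambda>(x, \<xi>). of_real ((2 * pi) powr (- (real CARD('n) / 2))) *
     u (\<lambda>y. cnj (\<phi> (y - x)) * cis (- (y \<bullet> \<xi>))))"

lemma stft_dual_of_function:
  "stft_dual \<phi> (\<lambda>g. LINT y|lebesgue. f y * g y) = stft \<phi> f"
  by (simp add: stft_dual_def stft_def fourier_def mult.assoc)


section \<open>Gabor frames\<close>

text \<open>Elements of \<open>L\<^sup>2\<close> are represented by functions, with equality almost everywhere.\<close>

definition L2 :: "(real^'n::finite \<Rightarrow> complex) set" where
  "L2 = {f. f \<in> borel_measurable lebesgue \<and> integrable lebesgue (\<lambda>x. (cmod (f x))\<^sup>2)}"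

definition L2_norm :: "(real^'n::finite \<Rightarrow> complex) \<Rightarrow> real" where
  "L2_norm f = sqrt (LINT x|lebesgue. (cmod (f x))\<^sup>2)"

definition L2_inner :: "(real^'n::finite \<Rightarrow> complex) \<Rightarrow> (real^'n \<Rightarrow> complex) \<Rightarrow> complex" where
  "L2_inner f g = (LINT x|lebesgue. f x * cnj (g x))"

definition L2_frame :: "('i \<Rightarrow> real^'n::finite \<Rightarrow> complex) \<Rightarrow> 'i set \<Rightarrow> bool" where
  "L2_frame e I \<longleftrightarrow> (\<forall>k\<in>I. e k \<in> L2) \<and>
     (\<exists>A>0. \<exists>B>0. \<forall>f\<in>L2.
        ennreal (A * (L2_norm f)\<^sup>2) \<le> (\<Sum>\<^sub>\<infinity>k\<in>I. ennreal ((cmod (L2_inner f (e k)))\<^sup>2)) \<and>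
        (\<Sum>\<^sub>\<infinity>k\<in>I. ennreal ((cmod (L2_inner f (e k)))\<^sup>2)) \<le> ennreal (B * (L2_norm f)\<^sup>2))"

definition L2_has_sum ::
  "('i \<Rightarrow> real^'n::finite \<Rightarrow> complex) \<Rightarrow> 'i set \<Rightarrow> (real^'n \<Rightarrow> complex) \<Rightarrow> bool" where
  "L2_has_sum e I g \<longleftrightarrow> (\<forall>k\<in>I. e k \<in> L2) \<and> g \<in> L2 \<and>
     ((\<lambda>F. L2_norm (\<lambda>x. (\<Sum>k\<in>F. e k x) - g x)) \<longlongrightarrow> 0) (finite_subsets_at_top I)"

definition lattice_points :: "real \<Rightarrow> (real^'n::finite) set" where
  "lattice_points \<epsilon> = {x. \<forall>i. \<exists>m::int. x $ i = \<epsilon> * of_int m}"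

definition gabor_atom ::
  "(real^'n::finite \<Rightarrow> complex) \<Rightarrow> (real^'n) \<times> (real^'n) \<Rightarrow> real^'n \<Rightarrow> complex" where
  "gabor_atom \<phi> = (\<lambda>(j, \<iota>) y. cis (y \<bullet> \<iota>) * \<phi> (y - j))"

definition gabor_frame :: "real \<Rightarrow> (real^'n::finite \<Rightarrow> complex) \<Rightarrow> bool" where
  "gabor_frame \<epsilon> \<phi> \<longleftrightarrow> L2_frame (gabor_atom \<phi>) (lattice_points \<epsilon> \<times> lattice_points \<epsilon>)"

text \<open>The graph of the operator \<open>S\<close>: the function \<open>g\<close> represents \<open>S f\<close>.\<close>

definition gabor_operator ::
  "real \<Rightarrow> (real^'n::finite \<Rightarrow> complex) \<Rightarrow> (real^'n \<Rightarrow> complex) \<Rightarrow> (real^'n \<Rightarrow> complex) \<Rightarrow> bool" where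
  "gabor_operator \<epsilon> \<phi> f g \<longleftrightarrow> f \<in> L2 \<and>
     L2_has_sum (\<lambda>p y. stft \<phi> f p * gabor_atom \<phi> p y)
       (lattice_points \<epsilon> \<times> lattice_points \<epsilon>) g"

text \<open>The frame property makes \<open>S\<close> a bijection of \<open>L\<^sup>2\<close>, so that the last conjunct says
  \<open>\<psi> = S\<^sup>-\<^sup>1 \<phi>\<close>.\<close>

definition canonical_dual_window ::
  "real \<Rightarrow> (real^'n::finite \<Rightarrow> complex) \<Rightarrow> (real^'n \<Rightarrow> complex) \<Rightarrow> bool" where
  "canonical_dual_window \<epsilon> \<phi> \<psi> \<longleftrightarrow>
     \<epsilon> > 0 \<and> gabor_frame \<epsilon> \<phi> \<and> gabor_operator \<epsilon> \<phi> \<psi> \<phi>"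

definition gaussian :: "real^'n::finite \<Rightarrow> complex" where
  "gaussian x = of_real (pi powr (- (real CARD('n) / 4)) * exp (- ((norm x)\<^sup>2 / 2)))"

end

theory Submission
  imports
    Defs
    "HOL-Probability.Characteristic_Functions"
    "HOL-Complex_Analysis.Cauchy_Integral_Formula"
begin

text \<open>
  Since the implied constant may depend on the dual windows, it suffices to compare the quasi-norms
  of \<open>V\<^sub>\<phi>\<^sub>1 f\<close> and \<open>V\<^sub>\<phi>\<^sub>2 f\<close> for two nonzero windows and to know that
  \<open>V\<^sub>\<phi>\<^sub>1 \<psi>\<close> does not vanish almost everywhere; neither requires decay of \<open>\<psi>\<close>.

  Fourier inversion writes \<open>\<phi>\<^sub>1\<close> as an absolutely convergent superposition of time-frequency shifts
  of \<open>\<phi>\<^sub>2\<close>, whose coefficients decay faster than any exponential. Continuous functionals on \<open>\<Sigma>\<^sub>1\<close>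
  commute with this superposition, so that
  \<open>|V\<^sub>\<phi>\<^sub>1 f| \<le> C\<^sub>A |V\<^sub>\<phi>\<^sub>2 f| * exp (- A |\<cdot>|)\<close> for every \<open>A\<close>. The same bound with \<open>\<phi>\<^sub>1 = \<phi>\<^sub>2\<close>
  lets the power \<open>r\<close> pass inside the convolution, also for \<open>r < 1\<close>, and in terms of \<open>r\<close>-th powers
  the Orlicz quasi-norms become norms for which Minkowski's inequality holds up to a constant.

  If \<open>V\<^sub>\<phi>\<^sub>1 \<psi>\<close> vanished almost everywhere, then so would \<open>V\<^sub>\<phi>\<^sub>2 \<psi>\<close>, hence also
  \<open>\<phi>\<^sub>2 = S \<psi>\<close>, the sum of the multiples \<open>V\<^sub>\<phi>\<^sub>2 \<psi> p\<close> of the Gabor atoms.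
\<close>

section \<open>Iterated partial derivatives\<close>

text \<open>Decay beyond every exponential matters because a submultiplicative v grows at most
  exponentially: moving \<omega> from one point to another then only lowers the rate of the kernel.
  Up to conjugation, the coefficients of the superposition arise by inverting the Fourier transform
  of the product of \<open>\<phi>\<^sub>1\<close> with a translate of \<open>\<phi>\<^sub>2\<close>,
  multiplying by the conjugate translate and integrating over all translations, which leaves
  \<open>\<phi>\<^sub>1\<close> times the squared L2 norm of \<open>\<phi>\<^sub>2\<close>. For r <
  1 the triangle inequality fails, so an integral cannot be estimated inside the quasi-norm; the
  power has to be taken pointwise, which hinges on the finiteness of a supremum. Two degenerate
  situations shape the end of the argument. The weighted norm of the dual window may be infinite,
  and its product with a vanishing norm is then 0 instead of \<infinity>. The lattice has measure
  zero, so that vanishing almost everywhere says something about the Gabor expansion only through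
  the continuity of the transform.\<close>

lemma partial_has_vector_derivative:
  fixes f :: "real^'n::finite \<Rightarrow> complex"
  assumes "f differentiable_on UNIV"
  shows "((\<lambda>t. f (x + t *\<^sub>R axis i 1)) has_vector_derivative partial i f (x + t *\<^sub>R axis i 1)) (at t)"
proof -
  have "f differentiable (at (x + t *\<^sub>R axis i 1))"
    using assms by (simp add: differentiable_on_def)
  then obtain D where D: "(f has_derivative D) (at (x + t *\<^sub>R axis i 1))"
    by (auto simp: differentiable_def)
  interpret D: bounded_linear D using D by (rule has_derivative_bounded_linear)
  have *: "((\<lambda>s. f (y + s *\<^sub>R axis i 1)) has_vector_derivative D (axis i 1)) (at u)"
    if "y + u *\<^sub>R axis i 1 = x + t *\<^sub>R axis i 1" for y u
  proof -
    have "((\<lambda>s. y + s *\<^sub>R axis i 1) has_derivative (\<lambda>s. s *\<^sub>R axis i 1)) (at u)"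
      by (auto intro!: derivative_eq_intros)
    from has_derivative_compose[OF this, of f D] D that
    show ?thesis by (simp add: has_vector_derivative_def D.scaleR)
  qed
  have "partial i f (x + t *\<^sub>R axis i 1) = D (axis i 1)"
    unfolding partial_def by (rule vector_derivative_at, rule *) simp
  then show ?thesis using *[of x t] by simp
qed

lemma partial_eqI:
  assumes "((\<lambda>t. f (x + t *\<^sub>R axis i 1)) has_vector_derivative D) (at 0)"
  shows "partial i f x = D"
  unfolding partial_def by (rule vector_derivative_at[OF assms])

lemma has_derivative_partials:
  fixes f :: "real^'n::finite \<Rightarrow> complex"
  assumes "f differentiable_on UNIV"
  shows "(f has_derivative (\<lambda>v. \<Sum>i\<in>UNIV. (v $ i) *\<^sub>R partial i f x)) (at x)"
proof -
  obtain D where D: "(f has_derivative D) (at x)"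
    using assms by (auto simp: differentiable_def differentiable_on_def)
  interpret D: bounded_linear D using D by (rule has_derivative_bounded_linear)
  have p: "partial i f x = D (axis i 1)" for i
  proof (rule partial_eqI)
    have "((\<lambda>s. x + s *\<^sub>R axis i 1) has_derivative (\<lambda>s. s *\<^sub>R axis i 1)) (at 0)"
      by (auto intro!: derivative_eq_intros)
    from has_derivative_compose[OF this, of f D] D
    show "((\<lambda>t. f (x + t *\<^sub>R axis i 1)) has_vector_derivative D (axis i 1)) (at 0)"
      by (simp add: has_vector_derivative_def D.scaleR)
  qed
  have "D v = (\<Sum>i\<in>UNIV. (v $ i) *\<^sub>R partial i f x)" for v
  proof -
    have "D v = D (\<Sum>i\<in>UNIV. (v $ i) *\<^sub>R axis i 1)"
      using basis_expansion[of v] by (simp add: scalar_mult_eq_scaleR)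
    also have "\<dots> = (\<Sum>i\<in>UNIV. (v $ i) *\<^sub>R partial i f x)"
      by (simp add: D.sum D.scaleR p)
    finally show ?thesis .
  qed
  then have "D = (\<lambda>v. \<Sum>i\<in>UNIV. (v $ i) *\<^sub>R partial i f x)" by auto
  with D show ?thesis by simp
qed

lemma iter_partial_Nil [simp]: "iter_partial [] f = f"
  and iter_partial_Cons [simp]: "iter_partial (i # is) f = partial i (iter_partial is f)"
  and iter_partial_append: "iter_partial (xs @ ys) f = iter_partial xs (iter_partial ys f)"
  by (simp_all add: iter_partial_def)

lemma smoothD: "smooth f \<Longrightarrow> iter_partial is f differentiable_on UNIV"
  by (simp add: smooth_def)

lemma smooth_differentiable: "smooth f \<Longrightarrow> f differentiable_on UNIV"
  using smoothD[of f "[]"] by simp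

lemma smooth_iter_partial: "smooth f \<Longrightarrow> smooth (iter_partial is f)"
  by (auto simp: smooth_def iter_partial_append[symmetric])

lemma smooth_partial: "smooth f \<Longrightarrow> smooth (partial i f)"
  using smooth_iter_partial[of f "[i]"] by simp

lemma smooth_continuous: "smooth f \<Longrightarrow> continuous_on UNIV f"
  by (rule differentiable_imp_continuous_on[OF smooth_differentiable])

text \<open>Smooth functions form the largest class of differentiable functions closed under partial
  derivatives. Smoothness can thus be shown by exhibiting any class with these two properties,
  without a formula for the iterated derivatives.\<close>

lemma smooth_coinduct:
  assumes "f \<in> S" and "\<And>f. f \<in> S \<Longrightarrow> f differentiable_on UNIV"
    and "\<And>f i. f \<in> S \<Longrightarrow> partial i f \<in> S"
  shows "smooth f"
proof -
  have "iter_partial is f \<in> S" for "is"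
    by (induction "is") (use assms in auto)
  then show ?thesis using assms(2) by (auto simp: smooth_def)
qed

section \<open>Derivative rules and closure properties of smooth functions\<close>

lemma partial_add:
  assumes "f differentiable_on UNIV" "g differentiable_on UNIV"
  shows "partial i (\<lambda>x. f x + g x) = (\<lambda>x. partial i f x + partial i g x)"
  using partial_has_vector_derivative[OF assms(1), of _ i 0]
    partial_has_vector_derivative[OF assms(2), of _ i 0]
  by (intro ext partial_eqI) (auto intro!: derivative_eq_intros)

lemma partial_mult:
  assumes "f differentiable_on UNIV" "g differentiable_on UNIV"
  shows "partial i (\<lambda>x. f x * g x) = (\<lambda>x. partial i f x * g x + f x * partial i g x)"
  using partial_has_vector_derivative[OF assms(1), of _ i 0]
    partial_has_vector_derivative[OF assms(2), of _ i 0]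
  by (intro ext partial_eqI) (auto intro!: derivative_eq_intros)

lemma partial_cmult:
  assumes "f differentiable_on UNIV"
  shows "partial i (\<lambda>x. c * f x) = (\<lambda>x. c * partial i f x)"
  using partial_has_vector_derivative[OF assms, of _ i 0]
  by (intro ext partial_eqI) (auto intro!: derivative_eq_intros)

lemma partial_cnj:
  assumes "f differentiable_on UNIV"
  shows "partial i (\<lambda>x. cnj (f x)) = (\<lambda>x. cnj (partial i f x))"
proof (intro ext partial_eqI)
  fix x
  show "((\<lambda>t. cnj (f (x + t *\<^sub>R axis i 1))) has_vector_derivative cnj (partial i f x)) (at 0)"
    using bounded_linear.has_vector_derivative[OF bounded_linear_cnj
        partial_has_vector_derivative[OF assms, of x i 0]] by simp
qed

lemma partial_shift: "partial i (\<lambda>y. f (y - x)) = (\<lambda>y. partial i f (y - x))"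
  by (simp add: partial_def algebra_simps)

lemma iter_partial_add:
  assumes "smooth f" "smooth g"
  shows "iter_partial is (\<lambda>x. f x + g x) = (\<lambda>x. iter_partial is f x + iter_partial is g x)"
  by (induction "is") (auto simp: partial_add smoothD assms)

lemma smooth_add:
  assumes "smooth f" "smooth g" shows "smooth (\<lambda>x. f x + g x)"
  unfolding smooth_def iter_partial_add[OF assms] by (auto intro!: differentiable_on_add smoothD assms)

lemma iter_partial_cmult:
  assumes "smooth f"
  shows "iter_partial is (\<lambda>x. c * f x) = (\<lambda>x. c * iter_partial is f x)"
  by (induction "is") (auto simp: partial_cmult smoothD assms)

lemma smooth_cmult:
  assumes "smooth f" shows "smooth (\<lambda>x. c * f x)"
  unfolding smooth_def iter_partial_cmult[OF assms]
  by (auto intro!: differentiable_on_mult smoothD assms simp: differentiable_on_const)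

lemma iter_partial_cnj:
  assumes "smooth f"
  shows "iter_partial is (\<lambda>x. cnj (f x)) = (\<lambda>x. cnj (iter_partial is f x))"
  by (induction "is") (auto simp: partial_cnj smoothD assms)

lemma smooth_cnj:
  assumes "smooth f" shows "smooth (\<lambda>x. cnj (f x))"
proof -
  have "(\<lambda>x. cnj (iter_partial is f x)) differentiable_on UNIV" for "is"
    using smoothD[OF assms, of "is"] unfolding differentiable_on_def differentiable_def
    using has_derivative_compose bounded_linear.has_derivative[OF bounded_linear_cnj] by blast
  then show ?thesis unfolding smooth_def iter_partial_cnj[OF assms] by auto
qed

lemma iter_partial_shift: "iter_partial is (\<lambda>y. f (y - x)) = (\<lambda>y. iter_partial is f (y - x))"
  by (induction "is") (auto simp: partial_shift)

lemma smooth_shift: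
  assumes "smooth f" shows "smooth (\<lambda>y. f (y - x))"
  unfolding smooth_def iter_partial_shift
proof (intro allI)
  fix "is"
  have "(\<lambda>y. y - x) differentiable (at y)" for y
    by (simp add: differentiable_diff)
  with smoothD[OF assms, of "is"]
  show "(\<lambda>y. iter_partial is f (y - x)) differentiable_on UNIV"
    unfolding differentiable_on_def by (metis UNIV_I differentiable_compose)
qed

text \<open>Leibniz' rule leads out of the products of two smooth functions but not out of their
  finite sums; this is the invariant class behind \<open>smooth_mult\<close>.\<close>

inductive smooth_products :: "(real^'n::finite \<Rightarrow> complex) \<Rightarrow> bool" where
  prod: "smooth f \<Longrightarrow> smooth g \<Longrightarrow> smooth_products (\<lambda>x. f x * g x)"
| add: "smooth_products F \<Longrightarrow> smooth_products G \<Longrightarrow> smooth_products (\<lambda>x. F x + G x)"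

lemma smooth_products_closed:
  "smooth_products F \<Longrightarrow> F differentiable_on UNIV \<and> (\<forall>i. smooth_products (partial i F))"
proof (induction rule: smooth_products.induct)
  case (prod f g)
  then show ?case
    by (auto simp: partial_mult smooth_differentiable intro!: differentiable_on_mult
        smooth_products.intros smooth_partial)
next
  case (add F G)
  then show ?case
    by (auto simp: partial_add intro!: differentiable_on_add smooth_products.intros)
qed

lemma smooth_mult:
  assumes "smooth f" "smooth g" shows "smooth (\<lambda>x. f x * g x)"
  by (rule smooth_coinduct[where S = "Collect smooth_products"])
    (use smooth_products_closed smooth_products.prod[OF assms] in auto)

text \<open>Pascal's rule: differentiating one of the two factors once more shifts one of the two
  sequences. It carries the induction step of the Leibniz estimate.\<close>

lemma binomial_convolution_Suc:
  fixes A B :: "nat \<Rightarrow> real"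
  shows "(\<Sum>k\<le>n. real (n choose k) * A (Suc k) * B (n - k)) +
    (\<Sum>k\<le>n. real (n choose k) * A k * B (Suc n - k)) =
    (\<Sum>k\<le>Suc n. real (Suc n choose k) * A k * B (Suc n - k))"
proof -
  have "(\<Sum>k\<le>Suc n. real (Suc n choose k) * A k * B (Suc n - k)) =
      A 0 * B (Suc n) + (\<Sum>k\<le>n. real (Suc n choose Suc k) * A (Suc k) * B (n - k))"
    by (subst sum.atMost_Suc_shift) simp
  also have "(\<Sum>k\<le>n. real (Suc n choose Suc k) * A (Suc k) * B (n - k)) =
      (\<Sum>k\<le>n. real (n choose k) * A (Suc k) * B (n - k)) +
      (\<Sum>k\<le>n. real (n choose Suc k) * A (Suc k) * B (n - k))"
    by (simp add: sum.distrib[symmetric] algebra_simps)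
  also have "A 0 * B (Suc n) + \<dots> = (\<Sum>k\<le>n. real (n choose k) * A (Suc k) * B (n - k)) +
      (\<Sum>k\<le>Suc n. real (n choose k) * A k * B (Suc n - k))"
    using sum.atMost_Suc_shift[of "\<lambda>k. real (n choose k) * A k * B (Suc n - k)" n] by simp
  finally show ?thesis by simp
qed

text \<open>Bounds that depend only on the order of differentiation collapse the Leibniz sum over
  sublists to a binomial sum. The induction peels off the innermost derivative, so that the product
  rule meets the product itself; the bound sequence of the differentiated factor is then shifted by
  one, hence the generalization over A and B.\<close>

lemma iter_partial_mult_bound:
  assumes "smooth f" "smooth g"
    and "\<And>is. cmod (iter_partial is f x) \<le> A (length is)"
    and "\<And>is. cmod (iter_partial is g x) \<le> B (length is)"
  shows "cmod (iter_partial is (\<lambda>x. f x * g x) x) \<le>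
    (\<Sum>k\<le>length is. real (length is choose k) * A k * B (length is - k))"
  using assms
proof (induction "is" arbitrary: f g A B rule: rev_induct)
  case Nil
  then have "cmod (f x) \<le> A 0" "cmod (g x) \<le> B 0"
    using Nil(3)[of "[]"] Nil(4)[of "[]"] by simp_all
  then show ?case by (simp add: norm_mult mult_mono')
next
  case (snoc i "is")
  note sm = smooth_partial[OF snoc.prems(1), of i] smooth_partial[OF snoc.prems(2), of i]
  let ?n = "length is"
  have 1: "cmod (iter_partial is (\<lambda>x. partial i f x * g x) x) \<le>
      (\<Sum>k\<le>?n. real (?n choose k) * A (Suc k) * B (?n - k))"
    using snoc.prems(3)[of "_ @ [i]"]
    by (intro snoc.IH[where A = "\<lambda>k. A (Suc k)"]) (auto intro!: sm snoc.prems simp: iter_partial_append)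
  have 2: "cmod (iter_partial is (\<lambda>x. f x * partial i g x) x) \<le>
      (\<Sum>k\<le>?n. real (?n choose k) * A k * B (Suc (?n - k)))"
    using snoc.prems(4)[of "_ @ [i]"]
    by (intro snoc.IH[where B = "\<lambda>k. B (Suc k)"]) (auto intro!: sm snoc.prems simp: iter_partial_append)
  have "iter_partial (is @ [i]) (\<lambda>x. f x * g x) x =
      iter_partial is (\<lambda>x. partial i f x * g x) x + iter_partial is (\<lambda>x. f x * partial i g x) x"
    by (simp add: iter_partial_append partial_mult smooth_differentiable snoc.prems
        iter_partial_add smooth_mult sm)
  then have "cmod (iter_partial (is @ [i]) (\<lambda>x. f x * g x) x) \<le>
      (\<Sum>k\<le>?n. real (?n choose k) * A (Suc k) * B (?n - k)) +
      (\<Sum>k\<le>?n. real (?n choose k) * A k * B (Suc (?n - k)))"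
    by (simp only:) (rule order_trans[OF norm_triangle_ineq add_mono[OF 1 2]])
  also have "(\<Sum>k\<le>?n. real (?n choose k) * A k * B (Suc (?n - k))) =
      (\<Sum>k\<le>?n. real (?n choose k) * A k * B (Suc ?n - k))"
    by (intro sum.cong) (auto simp: Suc_diff_le)
  finally show ?case by (simp only: binomial_convolution_Suc length_append_singleton)
qed

section \<open>Symmetry of iterated derivatives\<close>

text \<open>The second difference over a square of side h is h^2 times a value of either mixed
  derivative inside the square, by applying the mean value theorem to the two variables in either
  order. Shrinking the square and continuity at the corner give equality.\<close>

lemma mixed_derivatives_eq:
  fixes f :: "real \<Rightarrow> real \<Rightarrow> real"
  assumes f1: "\<And>s t. ((\<lambda>s. f s t) has_real_derivative f1 s t) (at s)"
    and f12: "\<And>s t. ((\<lambda>t. f1 s t) has_real_derivative f12 s t) (at t)"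
    and f2: "\<And>s t. ((\<lambda>t. f s t) has_real_derivative f2 s t) (at t)"
    and f21: "\<And>s t. ((\<lambda>s. f2 s t) has_real_derivative f21 s t) (at s)"
    and c12: "isCont (\<lambda>(s, t). f12 s t) (0, 0)" and c21: "isCont (\<lambda>(s, t). f21 s t) (0, 0)"
  shows "f12 0 0 = f21 0 0"
proof -
  have ex: "\<exists>s t s' t'. 0 < s \<and> s < h \<and> 0 < t \<and> t < h \<and> 0 < s' \<and> s' < h \<and> 0 < t' \<and> t' < h \<and>
      f12 s t = f21 s' t'" if h: "h > 0" for h
  proof -
    have "\<exists>s. s > 0 \<and> s < h \<and> (f h h - f h 0) - (f 0 h - f 0 0) = (h - 0) * (f1 s h - f1 s 0)"
      by (rule MVT2[OF h, of "\<lambda>s. f s h - f s 0"]) (auto intro!: derivative_intros f1)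
    then obtain s where s: "0 < s" "s < h"
      "(f h h - f h 0) - (f 0 h - f 0 0) = h * (f1 s h - f1 s 0)" by auto
    have "\<exists>t. t > 0 \<and> t < h \<and> f1 s h - f1 s 0 = (h - 0) * f12 s t"
      by (rule MVT2[OF h]) (auto intro!: f12)
    then obtain t where t: "0 < t" "t < h" "f1 s h - f1 s 0 = h * f12 s t" by auto
    have "\<exists>t'. t' > 0 \<and> t' < h \<and> (f h h - f 0 h) - (f h 0 - f 0 0) = (h - 0) * (f2 h t' - f2 0 t')"
      by (rule MVT2[OF h, of "\<lambda>t. f h t - f 0 t"]) (auto intro!: derivative_intros f2)
    then obtain t' where t': "0 < t'" "t' < h"
      "(f h h - f 0 h) - (f h 0 - f 0 0) = h * (f2 h t' - f2 0 t')" by auto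
    have "\<exists>s'. s' > 0 \<and> s' < h \<and> f2 h t' - f2 0 t' = (h - 0) * f21 s' t'"
      by (rule MVT2[OF h]) (auto intro!: f21)
    then obtain s' where s': "0 < s'" "s' < h" "f2 h t' - f2 0 t' = h * f21 s' t'" by auto
    have "h * (h * f12 s t) = h * (h * f21 s' t')"
      using s(3)[unfolded t(3)] t'(3)[unfolded s'(3)] by argo
    then have "f12 s t = f21 s' t'" using h by (metis mult_left_cancel less_irrefl)
    then show ?thesis using s t s' t' by blast
  qed
  have "\<forall>n. \<exists>s t s' t'. 0 < s \<and> s < inverse (real (Suc n)) \<and> 0 < t \<and> t < inverse (real (Suc n)) \<and>
      0 < s' \<and> s' < inverse (real (Suc n)) \<and> 0 < t' \<and> t' < inverse (real (Suc n)) \<and> f12 s t = f21 s' t'"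
    using ex by simp
  then obtain s t s' t' where st: "\<And>n. 0 < s n" "\<And>n. s n < inverse (real (Suc n))"
    "\<And>n. 0 < t n" "\<And>n. t n < inverse (real (Suc n))"
    "\<And>n. 0 < s' n" "\<And>n. s' n < inverse (real (Suc n))"
    "\<And>n. 0 < t' n" "\<And>n. t' n < inverse (real (Suc n))" "\<And>n. f12 (s n) (t n) = f21 (s' n) (t' n)"
    by metis
  have lim0: "X \<longlonglongrightarrow> 0" if "\<And>n. 0 < X n" "\<And>n. X n < inverse (real (Suc n))" for X :: "nat \<Rightarrow> real"
    by (rule tendsto_sandwich[OF _ _ tendsto_const LIMSEQ_inverse_real_of_nat])
      (use that in \<open>auto intro!: always_eventually less_imp_le\<close>)
  have "(\<lambda>n. (s n, t n)) \<longlonglongrightarrow> (0, 0)" "(\<lambda>n. (s' n, t' n)) \<longlonglongrightarrow> (0, 0)"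
    by (intro tendsto_Pair lim0 st)+
  from isCont_tendsto_compose[OF c12 this(1)] isCont_tendsto_compose[OF c21 this(2)]
  have "(\<lambda>n. f12 (s n) (t n)) \<longlonglongrightarrow> f12 0 0" "(\<lambda>n. f21 (s' n) (t' n)) \<longlonglongrightarrow> f21 0 0" by auto
  then show ?thesis unfolding st(9) by (rule LIMSEQ_unique)
qed

lemma partial_commute:
  fixes f :: "real^'n::finite \<Rightarrow> complex"
  assumes "smooth f"
  shows "partial i (partial j f) = partial j (partial i f)"
proof
  fix x :: "real^'n"
  let ?p = "\<lambda>s t. x + s *\<^sub>R axis i 1 + t *\<^sub>R axis j 1"
  have dv: "((\<lambda>s. g (?p s t)) has_vector_derivative partial i g (?p s t)) (at s)"
    "((\<lambda>t. g (?p s t)) has_vector_derivative partial j g (?p s t)) (at t)"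
    if "g differentiable_on UNIV" for g :: "real^'n \<Rightarrow> complex" and s t
    using partial_has_vector_derivative[OF that, of "x + t *\<^sub>R axis j 1" i s]
      partial_has_vector_derivative[OF that, of "x + s *\<^sub>R axis i 1" j t]
    by (simp_all add: algebra_simps)
  note d = smooth_differentiable[OF assms] smooth_differentiable[OF smooth_partial[OF assms]]
  have c: "isCont (\<lambda>(s, t). g (?p s t)) (0, 0)" if "smooth g" for g :: "real^'n \<Rightarrow> complex"
  proof -
    have "continuous_on UNIV (\<lambda>q. g (?p (fst q) (snd q)))"
      by (intro continuous_intros continuous_on_compose2[OF smooth_continuous[OF that]]) auto
    then show ?thesis by (simp add: continuous_on_eq_continuous_at split_beta')
  qed
  \<comment> \<open>The mean value theorem needs real values, so P runs over the real and the
    imaginary part.\<close>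
  have eq: "P (partial i (partial j f) x) = P (partial j (partial i f) x)"
    if P: "bounded_linear P" for P :: "complex \<Rightarrow> real"
  proof -
    have c': "isCont (\<lambda>(s, t). P (g (?p s t))) (0, 0)" if "smooth g" for g :: "real^'n \<Rightarrow> complex"
      using bounded_linear.isCont[OF P c[OF that]] by (simp add: split_beta')
    note v = bounded_linear.has_vector_derivative[OF P dv(1)]
      bounded_linear.has_vector_derivative[OF P dv(2)]
    have "P (partial j (partial i f) (?p 0 0)) = P (partial i (partial j f) (?p 0 0))"
      by (rule mixed_derivatives_eq[where f = "\<lambda>s t. P (f (?p s t))"
            and ?f1.0 = "\<lambda>s t. P (partial i f (?p s t))" and ?f2.0 = "\<lambda>s t. P (partial j f (?p s t))"
            and ?f12.0 = "\<lambda>s t. P (partial j (partial i f) (?p s t))"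
            and ?f21.0 = "\<lambda>s t. P (partial i (partial j f) (?p s t))"])
        (auto simp: has_real_derivative_iff_has_vector_derivative
          intro!: v d c' smooth_partial assms)
    then show ?thesis by simp
  qed
  from eq[OF bounded_linear_Re] eq[OF bounded_linear_Im]
  show "partial i (partial j f) x = partial j (partial i f) x" by (simp add: complex_eq_iff)
qed

lemma iter_partial_snoc:
  "smooth f \<Longrightarrow> iter_partial (is @ [i]) f = iter_partial (i # is) f"
  by (induction "is") (auto simp: partial_commute smooth_iter_partial)

text \<open>The head of one list is located inside the other and commuted past the entries before
  it, which shortens both lists by the same entry.\<close>

lemma iter_partial_mset:
  assumes "smooth f" "mset xs = mset ys"
  shows "iter_partial xs f = iter_partial ys f"
  using assms(2)
proof (induction xs arbitrary: ys)
  case Nil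
  then show ?case by simp
next
  case (Cons i xs)
  then have "i \<in> set ys" by (metis list.set_intros(1) mset_eq_setD)
  then obtain as bs where ys: "ys = as @ i # bs" by (meson split_list)
  with Cons.prems have "mset xs = mset (as @ bs)" by simp
  from Cons.IH[OF this] have "iter_partial (i # xs) f = iter_partial (i # as) (iter_partial bs f)"
    by (simp add: iter_partial_append)
  also have "\<dots> = iter_partial ys f"
    using iter_partial_snoc[OF smooth_iter_partial[OF assms(1)], of as i bs]
    by (simp add: ys iter_partial_append)
  finally show ?case .
qed

text \<open>Removes the arbitrary choice of a list in \<open>mi_partial\<close>: the chosen list and
  any other list with the same counts agree as multisets.\<close>

lemma iter_partial_eq_mi_partial:
  assumes "smooth f"
  shows "iter_partial is f = mi_partial (count_list is) f"
proof -
  have "\<forall>i. count_list (SOME js. \<forall>i. count_list js i = count_list is i) i = count_list is i"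
    by (rule someI[of _ "is"]) simp
  then have "mset is = mset (SOME js. \<forall>i. count_list js i = count_list is i)"
    by (intro multiset_eqI) (simp add: count_mset)
  then show ?thesis unfolding mi_partial_def by (rule iter_partial_mset[OF assms])
qed

section \<open>Exponential bounds in the Gelfand--Shilov space\<close>

text \<open>Counting the derivatives by \<open>n = length is\<close> makes Leibniz' rule a binomial convolution; the
  factor \<open>n!\<close> in place of \<open>\<alpha>!\<close> is harmless because \<open>\<alpha>! \<le> n! \<le> d\<^sup>n \<alpha>!\<close>.\<close>

definition gs_bound :: "real \<Rightarrow> real \<Rightarrow> real \<Rightarrow> (real^'n::finite \<Rightarrow> complex) \<Rightarrow> bool" where
  "gs_bound h a C g \<longleftrightarrow> (\<forall>is x.
     cmod (iter_partial is g x) \<le> C * (h ^ length is * fact (length is)) * exp (- (a * norm x)))"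

lemma gs_boundD:
  "gs_bound h a C g \<Longrightarrow>
    cmod (iter_partial is g x) \<le> C * (h ^ length is * fact (length is)) * exp (- (a * norm x))"
  by (simp add: gs_bound_def)

lemma gs_bound_nonneg: "gs_bound h a C g \<Longrightarrow> C \<ge> 0"
  using gs_boundD[of h a C g "[]" 0] by simp (metis norm_ge_zero order_trans)

lemma gs_bound_mono:
  assumes "gs_bound h a C g" "C \<le> D" "b \<le> a" "h \<le> k" "0 \<le> h"
  shows "gs_bound k b D g"
  unfolding gs_bound_def
proof (intro allI)
  fix "is" x
  have C: "C \<ge> 0" by (rule gs_bound_nonneg[OF assms(1)])
  have "cmod (iter_partial is g x) \<le> C * (h ^ length is * fact (length is)) * exp (- (a * norm x))"
    by (rule gs_boundD[OF assms(1)])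
  also have "\<dots> \<le> D * (k ^ length is * fact (length is)) * exp (- (b * norm x))"
    using assms C by (intro mult_mono power_mono) (auto intro: mult_right_mono)
  finally show "cmod (iter_partial is g x) \<le> \<dots>" .
qed

lemma gs_bound_add:
  assumes "smooth f" "smooth g" "gs_bound h a C f" "gs_bound h a D g"
  shows "gs_bound h a (C + D) (\<lambda>x. f x + g x)"
  unfolding gs_bound_def iter_partial_add[OF assms(1,2)]
  by (intro allI order_trans[OF norm_triangle_ineq]
      order_trans[OF add_mono[OF gs_boundD[OF assms(3)] gs_boundD[OF assms(4)]]])
    (simp add: algebra_simps)

lemma gs_bound_cmult:
  assumes "smooth f" "gs_bound h a C f"
  shows "gs_bound h a (cmod c * C) (\<lambda>x. c * f x)"
  unfolding gs_bound_def iter_partial_cmult[OF assms(1)]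
  using mult_left_mono[OF gs_boundD[OF assms(2)], of "cmod c"] by (simp add: norm_mult mult.assoc)

lemma gs_bound_cnj:
  assumes "smooth f" "gs_bound h a C f"
  shows "gs_bound h a C (\<lambda>x. cnj (f x))"
  using assms(2) unfolding gs_bound_def iter_partial_cnj[OF assms(1)] by simp

section \<open>Factorials against exponentials\<close>

lemma power_fact_le_exp:
  fixes s :: real assumes "s \<ge> 0" shows "s ^ k / fact k \<le> exp s"
proof -
  have s: "(\<lambda>n. s ^ n /\<^sub>R fact n) sums exp s" by (rule exp_converges)
  have "(\<Sum>n\<in>{k}. s ^ n /\<^sub>R fact n) \<le> suminf (\<lambda>n. s ^ n /\<^sub>R fact n)"
    by (rule sum_le_suminf) (use assms s sums_summable in auto)
  then show ?thesis using sums_unique[OF s] by (simp add: divide_inverse mult.commute)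
qed

text \<open>If every term s^k / k! stayed below exp (s/2) / 4, summing against 2^(-k) would bound
  exp (s/2) by half of itself. Thus a suitable power turns factorial bounds into exponential decay,
  at half the rate and with the constant 4.\<close>

lemma exp_le_power_fact:
  fixes s :: real assumes "s \<ge> 0" shows "\<exists>k. exp (s / 2) / 4 \<le> s ^ k / fact k"
proof (rule ccontr)
  assume "\<not> ?thesis"
  then have *: "s ^ k / fact k \<le> exp (s / 2) / 4" for k by (simp add: not_le less_imp_le)
  have 1: "(\<lambda>n. (s / 2) ^ n /\<^sub>R fact n) sums exp (s / 2)" by (rule exp_converges)
  have 2: "(\<lambda>n. (exp (s / 2) / 4) * (1 / 2) ^ n) sums ((exp (s / 2) / 4) * (1 / (1 - 1 / 2)))"
    by (intro sums_mult geometric_sums) simp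
  have "exp (s / 2) \<le> (exp (s / 2) / 4) * (1 / (1 - 1 / 2))"
  proof (rule sums_le[OF _ 1 2])
    fix n
    show "(s / 2) ^ n /\<^sub>R fact n \<le> (exp (s / 2) / 4) * (1 / 2) ^ n"
      using mult_right_mono[OF *[of n], of "(1 / 2) ^ n"]
      by (simp add: power_divide field_simps)
  qed
  then show False using exp_gt_zero[of "s / 2"] by simp
qed

lemma sum_count_list: "(\<Sum>i\<in>UNIV. count_list is i) = length (is :: 'n::finite list)"
  using sum_count_set[of "is" UNIV] by simp

lemma mi_fact_pos: "mi_fact \<alpha> > 0"
  by (simp add: mi_fact_def prod_pos)

lemma mi_fact_Suc:
  fixes \<alpha> :: "'n::finite \<Rightarrow> nat"
  shows "mi_fact (\<alpha>(j := Suc (\<alpha> j))) = real (Suc (\<alpha> j)) * mi_fact \<alpha>"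
proof -
  have "(\<Prod>i\<in>UNIV - {j}. fact ((\<alpha>(j := Suc (\<alpha> j))) i) :: real) = (\<Prod>i\<in>UNIV - {j}. fact (\<alpha> i))"
    by (intro prod.cong) auto
  then show ?thesis
    unfolding mi_fact_def
    by (simp add: prod.remove[of UNIV j] algebra_simps)
qed

lemma mi_fact_le_fact: "mi_fact (count_list is) \<le> fact (length (is :: 'n::finite list))"
proof (induction "is")
  case Nil
  then show ?case by (simp add: mi_fact_def)
next
  case (Cons j "is")
  have "count_list (j # is) = (count_list is)(j := Suc (count_list is j))" by auto
  then have "mi_fact (count_list (j # is)) = real (Suc (count_list is j)) * mi_fact (count_list is)"
    by (simp only: mi_fact_Suc)
  also have "\<dots> \<le> real (Suc (length is)) * fact (length is)"
    by (intro mult_mono Cons) (auto simp: count_le_length less_imp_le[OF mi_fact_pos])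
  finally show ?case by (simp only: length_Cons fact_Suc of_nat_mult)
qed

text \<open>With d the dimension, some entry satisfies n \<le> d \<alpha> j, for otherwise the
  entries would sum to less than n. Lowering this entry by one costs at most the factor d.\<close>

lemma fact_le_mi_fact:
  fixes \<alpha> :: "'n::finite \<Rightarrow> nat"
  assumes "(\<Sum>i\<in>UNIV. \<alpha> i) = n"
  shows "fact n \<le> real CARD('n) ^ n * mi_fact \<alpha>"
  using assms
proof (induction n arbitrary: \<alpha>)
  case 0
  then show ?case by (simp add: mi_fact_def)
next
  case (Suc m)
  have "\<exists>j. real (Suc m) \<le> real CARD('n) * real (\<alpha> j)"
  proof (rule ccontr)
    assume "\<not> ?thesis"
    then have "\<alpha> j * CARD('n) < Suc m" for j
      by (simp only: not_ex not_le of_nat_mult[symmetric] of_nat_less_iff mult.commute)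
    then have "(\<Sum>j\<in>(UNIV::'n set). \<alpha> j * CARD('n)) < (\<Sum>j\<in>(UNIV::'n set). Suc m)"
      by (intro sum_strict_mono) auto
    with Suc.prems show False by (simp add: sum_distrib_right[symmetric])
  qed
  then obtain j where j: "real (Suc m) \<le> real CARD('n) * real (\<alpha> j)" by blast
  then have pos: "\<alpha> j > 0" by (intro Nat.gr0I) auto
  define \<beta> where "\<beta> = \<alpha>(j := \<alpha> j - 1)"
  have \<alpha>: "\<alpha> = \<beta>(j := Suc (\<beta> j))" using pos by (auto simp: \<beta>_def)
  have "(\<Sum>i\<in>UNIV. \<alpha> i) = \<alpha> j + (\<Sum>i\<in>UNIV - {j}. \<alpha> i)" by (rule sum.remove) auto
  moreover have "(\<Sum>i\<in>UNIV. \<beta> i) = \<beta> j + (\<Sum>i\<in>UNIV - {j}. \<beta> i)" by (rule sum.remove) auto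
  moreover have "(\<Sum>i\<in>UNIV - {j}. \<beta> i) = (\<Sum>i\<in>UNIV - {j}. \<alpha> i)"
    by (intro sum.cong) (auto simp: \<beta>_def)
  ultimately have "(\<Sum>i\<in>UNIV. \<beta> i) = m" using Suc.prems pos by (simp add: \<beta>_def)
  from Suc.IH[OF this] have IH: "fact m \<le> real CARD('n) ^ m * mi_fact \<beta>" .
  have "fact (Suc m) = real (Suc m) * fact m" by simp
  also have "\<dots> \<le> (real CARD('n) * real (\<alpha> j)) * (real CARD('n) ^ m * mi_fact \<beta>)"
    by (intro mult_mono j IH) auto
  also have "\<dots> = real CARD('n) ^ Suc m * (real (Suc (\<beta> j)) * mi_fact \<beta>)"
    using pos by (simp add: \<beta>_def)
  also have "real (Suc (\<beta> j)) * mi_fact \<beta> = mi_fact \<alpha>"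
    using mi_fact_Suc[of \<beta> j] \<alpha> by simp
  finally show ?case .
qed

section \<open>Seminorms and exponential bounds\<close>

lemma gs_space_smooth: "g \<in> gs_space \<Longrightarrow> smooth g"
  by (simp add: gs_space_def)

text \<open>The supremum over \<beta> allows the best monomial to be chosen at each x, and
  \<open>exp_le_power_fact\<close> makes it exponentially large in every coordinate. The constant is
  linear in the seminorm, with k and D independent of g, so that the lemma also yields continuity of
  functionals.\<close>

lemma gs_bound_seminorm:
  assumes h: "h > 0"
  shows "\<exists>k>0. \<exists>D\<ge>0. \<forall>g :: real^'n::finite \<Rightarrow> complex. g \<in> gs_space \<longrightarrow>
    gs_bound h a (D * enn2real (gs_seminorm k g)) g"
proof -
  \<comment> \<open>At most h for the sake of the derivatives, and small enough that the exponential
    rate 1 / (2 k) gained in each coordinate exceeds \<bar>a\<bar>.\<close>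
  define k where "k = min h (1 / (2 * (\<bar>a\<bar> + 1)))"
  have k: "k > 0" "k \<le> h" using h by (auto simp: k_def)
  have ka: "\<bar>a\<bar> \<le> 1 / (2 * k)"
  proof -
    have "k * (2 * (\<bar>a\<bar> + 1)) \<le> 1" by (auto simp: k_def min_def field_simps)
    then show ?thesis using k by (simp add: field_simps)
  qed
  have main: "gs_bound h a (4 ^ CARD('n) * enn2real (gs_seminorm k g)) g"
    if g: "g \<in> gs_space" for g :: "real^'n \<Rightarrow> complex"
  proof -
    define K where "K = enn2real (gs_seminorm k g)"
    have "gs_seminorm k g < top" using g k by (simp add: gs_space_def)
    then have K: "K \<ge> 0" "gs_seminorm k g = ennreal K"
      by (simp_all add: K_def)
    have b: "cmod (of_real (mi_monomial \<beta> x) * mi_partial \<alpha> g x) \<le>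
        K * (k ^ (\<Sum>i\<in>UNIV. \<alpha> i + \<beta> i) * mi_fact \<alpha> * mi_fact \<beta>)" for \<alpha> \<beta> x
    proof -
      have "ennreal (cmod (of_real (mi_monomial \<beta> x) * mi_partial \<alpha> g x) /
          (k ^ (\<Sum>i\<in>UNIV. \<alpha> i + \<beta> i) * mi_fact \<alpha> * mi_fact \<beta>)) \<le> ennreal K"
        unfolding K(2)[symmetric] gs_seminorm_def
        by (rule SUP_upper2[of \<alpha>], simp, rule SUP_upper2[of \<beta>], simp, rule SUP_upper2[of x]) auto
      then show ?thesis
        using K(1) k mi_fact_pos[of \<alpha>] mi_fact_pos[of \<beta>]
        by (simp add: divide_le_eq)
    qed
    have "gs_bound h a (4 ^ CARD('n) * K) g"
      unfolding gs_bound_def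
    proof (intro allI)
      fix "is" and x :: "real^'n"
      \<comment> \<open>The exponents \<beta> are chosen coordinatewise and depend on x; each
        coordinate loses a factor 4, whence 4 to the power of the dimension.\<close>
      have "\<forall>i. \<exists>m. exp (\<bar>x $ i\<bar> / k / 2) / 4 \<le> (\<bar>x $ i\<bar> / k) ^ m / fact m"
        using k by (intro allI exp_le_power_fact) auto
      then obtain \<beta> where \<beta>: "\<And>i. exp (\<bar>x $ i\<bar> / k / 2) / 4 \<le> (\<bar>x $ i\<bar> / k) ^ \<beta> i / fact (\<beta> i)"
        by metis
      let ?T = "cmod (iter_partial is g x)" and ?n = "length is"
      have "(\<Prod>i\<in>UNIV. exp (\<bar>x $ i\<bar> / k / 2) / 4) \<le> (\<Prod>i\<in>UNIV. (\<bar>x $ i\<bar> / k) ^ \<beta> i / fact (\<beta> i))"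
        using \<beta> by (intro prod_mono) auto
      also have "\<dots> = \<bar>mi_monomial \<beta> x\<bar> / (k ^ (\<Sum>i\<in>UNIV. \<beta> i) * mi_fact \<beta>)"
        by (simp add: prod_dividef power_divide mi_fact_def mi_monomial_def abs_prod power_sum power_abs
            prod.distrib divide_simps)
      also have "(\<Prod>i\<in>UNIV. exp (\<bar>x $ i\<bar> / k / 2) / 4) = exp ((\<Sum>i\<in>UNIV. \<bar>x $ i\<bar>) / (2 * k)) / 4 ^ CARD('n)"
        by (simp add: prod_dividef exp_sum[symmetric] sum_divide_distrib mult.commute)
      finally have 1: "exp ((\<Sum>i\<in>UNIV. \<bar>x $ i\<bar>) / (2 * k)) / 4 ^ CARD('n) \<le>
          \<bar>mi_monomial \<beta> x\<bar> / (k ^ (\<Sum>i\<in>UNIV. \<beta> i) * mi_fact \<beta>)" .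
      have "\<bar>mi_monomial \<beta> x\<bar> * ?T \<le> K * (k ^ (?n + (\<Sum>i\<in>UNIV. \<beta> i)) * mi_fact (count_list is) * mi_fact \<beta>)"
        using b[of \<beta> x "count_list is"] gs_space_smooth[OF g]
        by (simp add: norm_mult iter_partial_eq_mi_partial sum.distrib sum_count_list)
      then have 2: "\<bar>mi_monomial \<beta> x\<bar> / (k ^ (\<Sum>i\<in>UNIV. \<beta> i) * mi_fact \<beta>) * ?T \<le>
          K * (k ^ ?n * mi_fact (count_list is))"
        using k mi_fact_pos[of \<beta>] by (simp add: divide_simps power_add mult_ac)
      have "a * norm x \<le> 1 / (2 * k) * (\<Sum>i\<in>UNIV. \<bar>x $ i\<bar>)"
        using ka k norm_le_l1_cart[of x] by (intro mult_mono) auto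
      then have "exp (a * norm x) \<le> exp ((\<Sum>i\<in>UNIV. \<bar>x $ i\<bar>) / (2 * k))" by simp
      then have "exp (a * norm x) * ?T \<le> 4 ^ CARD('n) *
          (exp ((\<Sum>i\<in>UNIV. \<bar>x $ i\<bar>) / (2 * k)) / 4 ^ CARD('n)) * ?T"
        by (simp add: mult_right_mono)
      also have "\<dots> \<le> 4 ^ CARD('n) * (\<bar>mi_monomial \<beta> x\<bar> / (k ^ (\<Sum>i\<in>UNIV. \<beta> i) * mi_fact \<beta>)) * ?T"
        using 1 by (intro mult_left_mono mult_right_mono) auto
      also have "\<dots> \<le> 4 ^ CARD('n) * (K * (k ^ ?n * mi_fact (count_list is)))"
        using 2 by (simp only: mult.assoc) (intro mult_left_mono, auto)
      also have "\<dots> \<le> 4 ^ CARD('n) * (K * (h ^ ?n * fact ?n))"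
        using K k h mi_fact_le_fact[of "is"] mi_fact_pos[of "count_list is"]
        by (intro mult_left_mono mult_mono power_mono) auto
      finally show "?T \<le> 4 ^ CARD('n) * K * (h ^ ?n * fact ?n) * exp (- (a * norm x))"
        by (simp add: exp_minus divide_simps mult_ac)
    qed
    then show ?thesis by (simp add: K_def)
  qed
  then have "\<exists>D\<ge>0. \<forall>g :: real^'n \<Rightarrow> complex. g \<in> gs_space \<longrightarrow> gs_bound h a (D * enn2real (gs_seminorm k g)) g"
    by (intro exI[of _ "4 ^ CARD('n)"]) simp
  then show ?thesis using k(1) by blast
qed

lemma gs_space_bound:
  fixes g :: "real^'n::finite \<Rightarrow> complex"
  assumes "g \<in> gs_space" "h > 0"
  shows "\<exists>C. gs_bound h a C g"
  using gs_bound_seminorm[OF assms(2), of a] assms(1) by meson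

text \<open>With d the dimension, the rate d / h pays for all monomials at once, because each
  coordinate of x is at most norm x, and h / d pays for the factor d^n in passing from n! to
  \<alpha>!.\<close>

lemma gs_seminorm_le:
  fixes g :: "real^'n::finite \<Rightarrow> complex"
  assumes h: "h > 0" and b: "gs_bound (h / CARD('n)) (CARD('n) / h) C g"
  shows "gs_seminorm h g \<le> ennreal C"
  unfolding gs_seminorm_def
proof (intro SUP_least ennreal_leI)
  fix \<alpha> \<beta> :: "'n \<Rightarrow> nat" and x :: "real^'n"
  define js :: "'n list" where "js = (SOME is. \<forall>i. count_list is i = \<alpha> i)"
  have js: "count_list js i = \<alpha> i" for i
    using someI_ex[OF mi_partial_list_exists[of \<alpha>]] unfolding js_def by blast
  have len: "length js = (\<Sum>i\<in>UNIV. \<alpha> i)" using sum_count_list[of js] js by simp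
  let ?n = "\<Sum>i\<in>UNIV. \<alpha> i" and ?m = "\<Sum>i\<in>UNIV. \<beta> i" and ?d = "real CARD('n)"
  have C: "C \<ge> 0" by (rule gs_bound_nonneg[OF b])
  have "(\<Prod>i\<in>UNIV. (\<bar>x $ i\<bar> / h) ^ \<beta> i / fact (\<beta> i)) \<le> (\<Prod>i\<in>UNIV. exp (\<bar>x $ i\<bar> / h))"
    using h by (intro prod_mono conjI power_fact_le_exp) auto
  also have "\<dots> = exp ((\<Sum>i\<in>UNIV. \<bar>x $ i\<bar>) / h)"
    by (simp add: exp_sum[symmetric] sum_divide_distrib)
  also have "\<dots> \<le> exp (?d / h * norm x)"
  proof -
    have "(\<Sum>i\<in>UNIV. \<bar>x $ i\<bar>) \<le> (\<Sum>i\<in>(UNIV::'n set). norm x)"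
      by (intro sum_mono component_le_norm_cart)
    then show ?thesis using h by (simp add: divide_right_mono)
  qed
  also have "(\<Prod>i\<in>UNIV. (\<bar>x $ i\<bar> / h) ^ \<beta> i / fact (\<beta> i)) = \<bar>mi_monomial \<beta> x\<bar> / (h ^ ?m * mi_fact \<beta>)"
    by (simp add: prod_dividef power_divide mi_fact_def mi_monomial_def abs_prod power_sum power_abs
        prod.distrib divide_simps)
  finally have mono: "\<bar>mi_monomial \<beta> x\<bar> / (h ^ ?m * mi_fact \<beta>) \<le> exp (?d / h * norm x)" .
  have "cmod (mi_partial \<alpha> g x) \<le> C * ((h / ?d) ^ ?n * fact ?n) * exp (- (?d / h * norm x))"
    using gs_boundD[OF b, of js x] by (simp add: mi_partial_def js_def[symmetric] len)
  also have "\<dots> \<le> C * ((h / ?d) ^ ?n * (?d ^ ?n * mi_fact \<alpha>)) * exp (- (?d / h * norm x))"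
    using C h by (intro mult_right_mono mult_left_mono fact_le_mi_fact) auto
  also have "(h / ?d) ^ ?n * (?d ^ ?n * mi_fact \<alpha>) = h ^ ?n * mi_fact \<alpha>"
    by (simp add: power_divide)
  finally have part: "cmod (mi_partial \<alpha> g x) / (h ^ ?n * mi_fact \<alpha>) \<le> C * exp (- (?d / h * norm x))"
    using h mi_fact_pos[of \<alpha>] by (simp add: divide_le_eq mult_ac)
  have "cmod (of_real (mi_monomial \<beta> x) * mi_partial \<alpha> g x) /
      (h ^ (\<Sum>i\<in>UNIV. \<alpha> i + \<beta> i) * mi_fact \<alpha> * mi_fact \<beta>) =
      \<bar>mi_monomial \<beta> x\<bar> / (h ^ ?m * mi_fact \<beta>) * (cmod (mi_partial \<alpha> g x) / (h ^ ?n * mi_fact \<alpha>))"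
    by (simp add: norm_mult sum.distrib power_add)
  also have "\<dots> \<le> exp (?d / h * norm x) * (C * exp (- (?d / h * norm x)))"
    using h mi_fact_pos[of \<alpha>] by (intro mult_mono mono part) auto
  also have "\<dots> = C" by (simp add: exp_minus)
  finally show "cmod (of_real (mi_monomial \<beta> x) * mi_partial \<alpha> g x) /
      (h ^ (\<Sum>i\<in>UNIV. \<alpha> i + \<beta> i) * mi_fact \<alpha> * mi_fact \<beta>) \<le> C" .
qed

lemma gs_spaceI:
  fixes g :: "real^'n::finite \<Rightarrow> complex"
  assumes "smooth g" "\<And>h a. h > 0 \<Longrightarrow> \<exists>C. gs_bound h a C g"
  shows "g \<in> gs_space"
proof -
  have "gs_seminorm h g < top" if h: "h > 0" for h
  proof -
    have "\<exists>C. gs_bound (h / CARD('n)) (CARD('n) / h) C g" using h by (intro assms(2)) auto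
    then obtain C where "gs_bound (h / CARD('n)) (CARD('n) / h) C g" ..
    from gs_seminorm_le[OF h this] show ?thesis by (rule order_le_less_trans) simp
  qed
  then show ?thesis using assms(1) by (simp add: gs_space_def)
qed

text \<open>Continuity of u expressed by \<open>gs_bound\<close> alone: explicit derivative
  estimates can be inserted, and the result is linear in their constant. The parameters h, a and K
  depend on u only.\<close>

lemma gs_dual_bound:
  fixes u :: "(real^'n::finite \<Rightarrow> complex) \<Rightarrow> complex"
  assumes "u \<in> gs_dual"
  shows "\<exists>h>0. \<exists>a. \<exists>K\<ge>0. \<forall>g\<in>gs_space. \<forall>C. gs_bound h a C g \<longrightarrow> cmod (u g) \<le> K * C"
proof -
  from assms obtain h C0 where h: "h > 0"
    and C0: "\<And>g. g \<in> gs_space \<Longrightarrow> ennreal (cmod (u g)) \<le> ennreal C0 * gs_seminorm h g"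
    unfolding gs_dual_def by blast
  have "cmod (u g) \<le> max 0 C0 * C"
    if g: "g \<in> gs_space" and b: "gs_bound (h / CARD('n)) (CARD('n) / h) C g" for g C
  proof -
    have C: "C \<ge> 0" by (rule gs_bound_nonneg[OF b])
    have "ennreal (cmod (u g)) \<le> ennreal C0 * gs_seminorm h g" by (rule C0[OF g])
    also have "\<dots> \<le> ennreal (max 0 C0) * ennreal C"
      by (intro mult_mono gs_seminorm_le[OF h b] ennreal_leI) auto
    also have "\<dots> = ennreal (max 0 C0 * C)" by (simp add: ennreal_mult C)
    finally show ?thesis using C by (simp add: ennreal_le_iff)
  qed
  then show ?thesis using h
    by (intro exI[of _ "h / CARD('n)"] conjI exI[of _ "CARD('n) / h"] exI[of _ "max 0 C0"]) auto
qed

section \<open>Linear operations and conjugation in the Gelfand--Shilov space\<close>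

lemma gs_space_add:
  assumes "f \<in> gs_space" "g \<in> gs_space"
  shows "(\<lambda>x. f x + g x) \<in> gs_space"
proof (rule gs_spaceI)
  note s = gs_space_smooth[OF assms(1)] gs_space_smooth[OF assms(2)]
  show "smooth (\<lambda>x. f x + g x)" by (rule smooth_add[OF s])
  fix h a :: real assume "h > 0"
  then obtain C D where "gs_bound h a C f" "gs_bound h a D g"
    using gs_space_bound[OF assms(1)] gs_space_bound[OF assms(2)] by meson
  then show "\<exists>C. gs_bound h a C (\<lambda>x. f x + g x)" using gs_bound_add[OF s] by blast
qed

lemma gs_space_cmult:
  assumes "f \<in> gs_space"
  shows "(\<lambda>x. c * f x) \<in> gs_space"
proof (rule gs_spaceI)
  note s = gs_space_smooth[OF assms]
  show "smooth (\<lambda>x. c * f x)" by (rule smooth_cmult[OF s])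
  fix h a :: real assume "h > 0"
  then show "\<exists>C. gs_bound h a C (\<lambda>x. c * f x)"
    using gs_space_bound[OF assms] gs_bound_cmult[OF s] by meson
qed

lemma gs_space_cnj:
  assumes "f \<in> gs_space"
  shows "(\<lambda>x. cnj (f x)) \<in> gs_space"
proof (rule gs_spaceI)
  note s = gs_space_smooth[OF assms]
  show "smooth (\<lambda>x. cnj (f x))" by (rule smooth_cnj[OF s])
  fix h a :: real assume "h > 0"
  then show "\<exists>C. gs_bound h a C (\<lambda>x. cnj (f x))"
    using gs_space_bound[OF assms] gs_bound_cnj[OF s] by meson
qed

section \<open>Time-frequency shifts\<close>

text \<open>This is the conjugate of the Gabor atom at X generated by the conjugate of g. Applied to
  the conjugate of a window, it is the test function that \<open>stft_dual\<close> pairs with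
  u.\<close>

definition tf_shift ::
  "(real^'n::finite) \<times> (real^'n) \<Rightarrow> (real^'n \<Rightarrow> complex) \<Rightarrow> real^'n \<Rightarrow> complex" where
  "tf_shift X g = (\<lambda>y. g (y - fst X) * cis (- (y \<bullet> snd X)))"

lemma has_derivative_cis: "(cis has_derivative (\<lambda>v. v *\<^sub>R (\<i> * cis s))) (at s)"
proof -
  have "((\<lambda>z. exp (\<i> * z)) has_field_derivative \<i> * exp (\<i> * of_real s)) (at (of_real s))"
    by (auto intro!: derivative_eq_intros)
  from has_vector_derivative_real_field[OF this]
  show ?thesis by (simp add: has_vector_derivative_def cis_conv_exp[abs_def])
qed

lemma partial_cis:
  fixes \<xi> :: "real^'n::finite"
  shows "partial i (\<lambda>y. c * cis (- (y \<bullet> \<xi>))) = (\<lambda>y. (c * (- \<i> * of_real (\<xi> $ i))) * cis (- (y \<bullet> \<xi>)))"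
proof (intro ext partial_eqI)
  fix y :: "real^'n"
  have e: "(\<lambda>t. c * cis (- ((y + t *\<^sub>R axis i 1) \<bullet> \<xi>))) =
      (\<lambda>t. c * exp (- \<i> * of_real (y \<bullet> \<xi>) - \<i> * of_real (\<xi> $ i) * of_real t))"
    by (simp add: cis_conv_exp inner_add_left inner_axis' algebra_simps)
  have "((\<lambda>z. c * exp (- \<i> * of_real (y \<bullet> \<xi>) - \<i> * of_real (\<xi> $ i) * z)) has_field_derivative
      c * (exp (- \<i> * of_real (y \<bullet> \<xi>)) * (- \<i> * of_real (\<xi> $ i)))) (at (of_real 0))"
    by (auto intro!: derivative_eq_intros)
  from has_vector_derivative_real_field[OF this]
  show "((\<lambda>t. c * cis (- ((y + t *\<^sub>R axis i 1) \<bullet> \<xi>))) has_vector_derivative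
      c * (- \<i> * of_real (\<xi> $ i)) * cis (- (y \<bullet> \<xi>))) (at 0)"
    unfolding e by (simp add: cis_conv_exp algebra_simps)
qed

lemma cis_inner_differentiable:
  fixes \<xi> :: "real^'n::finite"
  shows "(\<lambda>y. c * cis (- (y \<bullet> \<xi>))) differentiable_on UNIV"
proof -
  have "((\<lambda>y. cis (- (y \<bullet> \<xi>))) has_derivative (\<lambda>v. (- (v \<bullet> \<xi>)) *\<^sub>R (\<i> * cis (- (y \<bullet> \<xi>))))) (at y)" for y
    by (rule has_derivative_compose[OF _ has_derivative_cis]) (auto intro!: derivative_eq_intros)
  then have "((\<lambda>y. c * cis (- (y \<bullet> \<xi>))) has_derivative
      (\<lambda>v. c * ((- (v \<bullet> \<xi>)) *\<^sub>R (\<i> * cis (- (y \<bullet> \<xi>)))))) (at y)" for y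
    by (rule has_derivative_mult_right)
  then show ?thesis
    unfolding differentiable_on_def differentiable_def by blast
qed

lemma smooth_cis: "smooth (\<lambda>y. c * cis (- (y \<bullet> (\<xi> :: real^'n::finite))))"
proof (rule smooth_coinduct[where S = "range (\<lambda>c y. c * cis (- (y \<bullet> \<xi>)))"])
  fix f i assume "f \<in> range (\<lambda>c y. c * cis (- (y \<bullet> \<xi>)))"
  then show "f differentiable_on UNIV" "partial i f \<in> range (\<lambda>c y. c * cis (- (y \<bullet> \<xi>)))"
    by (auto simp only: partial_cis cis_inner_differentiable)
qed auto

lemma iter_partial_cis:
  fixes \<xi> :: "real^'n::finite"
  shows "\<exists>c. iter_partial is (\<lambda>y. cis (- (y \<bullet> \<xi>))) = (\<lambda>y. c * cis (- (y \<bullet> \<xi>))) \<and> cmod c \<le> norm \<xi> ^ length is"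
proof (induction "is")
  case Nil
  show ?case by (intro exI[of _ 1]) simp
next
  case (Cons i "is")
  then obtain c where c: "iter_partial is (\<lambda>y. cis (- (y \<bullet> \<xi>))) = (\<lambda>y. c * cis (- (y \<bullet> \<xi>)))"
    "cmod c \<le> norm \<xi> ^ length is" by blast
  have "cmod (c * (- \<i> * of_real (\<xi> $ i))) \<le> norm \<xi> ^ length is * norm \<xi>"
    unfolding norm_mult using c(2) component_le_norm_cart[of \<xi> i] by (intro mult_mono) auto
  then show ?case
    by (intro exI[of _ "c * (- \<i> * of_real (\<xi> $ i))"]) (simp only: iter_partial_Cons c partial_cis, simp add: mult_ac)
qed

lemma iter_partial_cis_bound:
  "cmod (iter_partial is (\<lambda>y. cis (- (y \<bullet> (\<xi> :: real^'n::finite)))) y) \<le> norm \<xi> ^ length is"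
  using iter_partial_cis[of "is" \<xi>] by (auto simp: norm_mult)

text \<open>After division by \<open>h ^ n * fact n\<close> the terms are those of the exponential
  series of m / h in reverse order. Geometric growth of the derivatives of one factor therefore
  leaves h unchanged and costs only a constant.\<close>

lemma binomial_exp_sum_le:
  fixes h m :: real assumes "h > 0" "m \<ge> 0"
  shows "(\<Sum>k\<le>n. real (n choose k) * (h ^ k * fact k) * m ^ (n - k)) \<le> h ^ n * fact n * exp (m / h)"
proof -
  have "real (n choose k) * (h ^ k * fact k) * m ^ (n - k) =
      h ^ n * fact n * ((m / h) ^ (n - k) / fact (n - k))" if "k \<le> n" for k
  proof -
    have "h ^ n = h ^ k * h ^ (n - k)" using that by (simp flip: power_add)
    then show ?thesis using that assms by (simp add: binomial_fact power_divide)
  qed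
  then have "(\<Sum>k\<le>n. real (n choose k) * (h ^ k * fact k) * m ^ (n - k)) =
      h ^ n * fact n * (\<Sum>k\<le>n. (m / h) ^ (n - k) / fact (n - k))"
    by (simp add: sum_distrib_left)
  also have "(\<Sum>k\<le>n. (m / h) ^ (n - k) / fact (n - k)) = (\<Sum>k\<le>n. (m / h) ^ k / fact k)"
    by (rule sum.reindex_bij_witness[of _ "\<lambda>k. n - k" "\<lambda>k. n - k"]) auto
  also have "\<dots> \<le> exp (m / h)"
  proof -
    have s: "(\<lambda>n. (m / h) ^ n /\<^sub>R fact n) sums exp (m / h)" by (rule exp_converges)
    have "(\<Sum>k\<le>n. (m / h) ^ k /\<^sub>R fact k) \<le> suminf (\<lambda>n. (m / h) ^ n /\<^sub>R fact n)"
      by (rule sum_le_suminf) (use assms s sums_summable in auto)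
    then show ?thesis using sums_unique[OF s] by (simp add: divide_inverse mult.commute)
  qed
  finally show ?thesis using assms by (simp add: mult_left_mono)
qed

text \<open>A multiplier of exponential type costs the rate e in the decay and the factor exp (M /
  h), but nothing in h. It serves for a character (e = 0) and for a character minus 1 (e =
  1).\<close>

lemma gs_bound_mult_exp_type:
  fixes f m :: "real^'n::finite \<Rightarrow> complex"
  assumes f: "smooth f" "gs_bound h a C f" and h: "h > 0" and m: "smooth m"
    and b: "\<And>is y. cmod (iter_partial is m y) \<le> D * exp (e * norm y) * M ^ length is" and M: "M \<ge> 0"
  shows "gs_bound h (a - e) (C * D * exp (M / h)) (\<lambda>y. f y * m y)"
  unfolding gs_bound_def
proof (intro allI)
  fix "is" :: "'n list" and y :: "real^'n"
  let ?n = "length is"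
  have C: "C \<ge> 0" by (rule gs_bound_nonneg[OF f(2)])
  have "0 \<le> D * exp (e * norm y)" using b[of "[]" y] by simp (metis norm_ge_zero order_trans)
  then have D: "D \<ge> 0" by (simp add: zero_le_mult_iff)
  have "cmod (iter_partial is (\<lambda>y. f y * m y) y) \<le>
     (\<Sum>k\<le>?n. real (?n choose k) * (C * (h ^ k * fact k) * exp (- (a * norm y))) *
        (D * exp (e * norm y) * M ^ (?n - k)))"
    by (rule iter_partial_mult_bound[OF f(1) m gs_boundD[OF f(2)] b])
  also have "\<dots> = C * D * exp (- ((a - e) * norm y)) *
      (\<Sum>k\<le>?n. real (?n choose k) * (h ^ k * fact k) * M ^ (?n - k))"
  proof -
    have "exp (- ((a - e) * norm y)) = exp (- (a * norm y)) * exp (e * norm y)"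
      by (simp add: exp_add[symmetric] algebra_simps)
    then show ?thesis by (simp add: sum_distrib_left mult_ac)
  qed
  also have "\<dots> \<le> C * D * exp (- ((a - e) * norm y)) * (h ^ ?n * fact ?n * exp (M / h))"
    by (intro mult_left_mono binomial_exp_sum_le h M) (use C D in auto)
  finally show "cmod (iter_partial is (\<lambda>y. f y * m y) y) \<le>
      C * D * exp (M / h) * (h ^ ?n * fact ?n) * exp (- ((a - e) * norm y))"
    by (simp add: mult_ac)
qed

lemma gs_bound_mult_cis:
  assumes f: "smooth f" "gs_bound h a C f" and h: "h > 0"
  shows "gs_bound h a (C * exp (norm \<xi> / h)) (\<lambda>y. f y * cis (- (y \<bullet> \<xi>)))"
  using gs_bound_mult_exp_type[OF f h, of "\<lambda>y. cis (- (y \<bullet> \<xi>))" 1 0 "norm \<xi>"]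
    smooth_cis[of 1 \<xi>] iter_partial_cis_bound by auto

lemma gs_bound_shift:
  fixes f :: "real^'n::finite \<Rightarrow> complex"
  assumes f: "gs_bound h a C f" and "h > 0" "a \<ge> 0"
  shows "gs_bound h a (C * exp (a * norm x)) (\<lambda>y. f (y - x))"
  unfolding gs_bound_def iter_partial_shift
proof (intro allI)
  fix "is" :: "'n list" and y :: "real^'n"
  have C: "C \<ge> 0" by (rule gs_bound_nonneg[OF f])
  have "norm y \<le> norm (y - x) + norm x" using norm_triangle_sub[of y x] by (simp add: add.commute)
  then have "a * norm y \<le> a * norm (y - x) + a * norm x"
    using mult_left_mono[OF _ assms(3)] by (metis distrib_left)
  then have "exp (- (a * norm (y - x))) \<le> exp (a * norm x) * exp (- (a * norm y))"
    by (simp add: exp_add[symmetric])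
  then have "C * (h ^ length is * fact (length is)) * exp (- (a * norm (y - x))) \<le>
      C * (h ^ length is * fact (length is)) * (exp (a * norm x) * exp (- (a * norm y)))"
    using C assms by (intro mult_left_mono) auto
  with gs_boundD[OF f, of "is" "y - x"]
  show "cmod (iter_partial is f (y - x)) \<le>
      C * exp (a * norm x) * (h ^ length is * fact (length is)) * exp (- (a * norm y))"
    by (simp add: mult_ac)
qed

lemma smooth_tf_shift:
  assumes "smooth g" shows "smooth (tf_shift X g)"
  unfolding tf_shift_def using smooth_mult[OF smooth_shift[OF assms] smooth_cis[of 1]] by simp

lemma gs_bound_tf_shift:
  assumes "smooth g" "gs_bound h a C g" "h > 0" "a \<ge> 0"
  shows "gs_bound h a (C * exp (a * norm (fst X)) * exp (norm (snd X) / h)) (tf_shift X g)"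
  unfolding tf_shift_def
  by (rule gs_bound_mult_cis[OF smooth_shift[OF assms(1)] gs_bound_shift]) (use assms in auto)

lemma gs_space_tf_shift:
  assumes "g \<in> gs_space" shows "tf_shift X g \<in> gs_space"
proof (rule gs_spaceI)
  note s = gs_space_smooth[OF assms]
  show "smooth (tf_shift X g)" by (rule smooth_tf_shift[OF s])
  fix h a :: real assume h: "h > 0"
  then obtain C where "gs_bound h \<bar>a\<bar> C g" using gs_space_bound[OF assms] by meson
  from gs_bound_tf_shift[OF s this h, of X] obtain D where D: "gs_bound h \<bar>a\<bar> D (tf_shift X g)" by auto
  have "gs_bound h a D (tf_shift X g)" by (rule gs_bound_mono[OF D]) (use h in auto)
  then show "\<exists>C. gs_bound h a C (tf_shift X g)" by blast
qed

text \<open>C and b do not depend on X: growth in the shift parameter is at most exponential, and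
  coefficients that decay faster than every exponential absorb it.\<close>

lemma gs_bound_tf_shift_exp:
  assumes g: "g \<in> gs_space" and h: "h > 0"
  shows "\<exists>C\<ge>0. \<exists>b\<ge>0. \<forall>X. gs_bound h a (C * exp (b * norm X)) (tf_shift X g)"
proof -
  obtain C where C: "gs_bound h \<bar>a\<bar> C g" using gs_space_bound[OF g h] by blast
  have C0: "C \<ge> 0" by (rule gs_bound_nonneg[OF C])
  have "gs_bound h a (C * exp ((\<bar>a\<bar> + 1 / h) * norm X)) (tf_shift X g)" for X
  proof (rule gs_bound_mono[OF gs_bound_tf_shift[OF gs_space_smooth[OF g] C h, of X]])
    have "\<bar>a\<bar> * norm (fst X) + norm (snd X) / h \<le> \<bar>a\<bar> * norm X + norm X / h"
      using h norm_fst_le[of "fst X" "snd X"] norm_snd_le[of "snd X" "fst X"]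
      by (intro add_mono mult_left_mono divide_right_mono) auto
    also have "\<dots> = (\<bar>a\<bar> + 1 / h) * norm X" by (simp add: algebra_simps)
    finally have "exp (\<bar>a\<bar> * norm (fst X) + norm (snd X) / h) \<le> exp ((\<bar>a\<bar> + 1 / h) * norm X)" by simp
    then show "C * exp (\<bar>a\<bar> * norm (fst X)) * exp (norm (snd X) / h) \<le> C * exp ((\<bar>a\<bar> + 1 / h) * norm X)"
      using C0 by (simp only: exp_add mult.assoc) (rule mult_left_mono, auto)
  qed (use h in auto)
  moreover have "\<bar>a\<bar> + 1 / h \<ge> 0" using h by simp
  ultimately show ?thesis using C0 by blast
qed

lemma smooth_diff_bound:
  fixes f :: "real^'n::finite \<Rightarrow> complex" and B :: real
  assumes f: "smooth f" and b: "\<And>i z. z \<in> closed_segment x y \<Longrightarrow> cmod (partial i f z) \<le> B"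
  shows "cmod (f x - f y) \<le> CARD('n) * B * norm (x - y)"
proof (rule differentiable_bound[of "closed_segment x y"])
  fix z assume z: "z \<in> closed_segment x y"
  show "(f has_derivative (\<lambda>v. \<Sum>i\<in>UNIV. (v $ i) *\<^sub>R partial i f z)) (at z within closed_segment x y)"
    by (rule has_derivative_at_withinI[OF has_derivative_partials[OF smooth_differentiable[OF f]]])
  show "onorm (\<lambda>v. \<Sum>i\<in>UNIV. (v $ i) *\<^sub>R partial i f z) \<le> CARD('n) * B"
  proof (rule onorm_le)
    fix v :: "real^'n"
    have "norm (\<Sum>i\<in>UNIV. (v $ i) *\<^sub>R partial i f z) \<le> (\<Sum>i\<in>(UNIV::'n set). norm v * B)"
      using b[OF z] by (intro sum_norm_le) (auto intro!: mult_mono component_le_norm_cart)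
    then show "norm (\<Sum>i\<in>UNIV. (v $ i) *\<^sub>R partial i f z) \<le> CARD('n) * B * norm v"
      by (simp add: mult_ac)
  qed
qed auto

text \<open>Lipschitz dependence on the translation, by the mean value inequality. It spends one
  more derivative, and halving h beforehand compensates the resulting factor n + 1, which is at most
  2^(n + 1).\<close>

lemma gs_bound_shift_diff:
  fixes g :: "real^'n::finite \<Rightarrow> complex" and C :: real
  assumes g: "smooth g" and b: "gs_bound (h / 2) a C g" and h: "h > 0" and a: "a \<ge> 0"
  shows "gs_bound h a (CARD('n) * C * h * exp (a * (norm x + norm x')) * norm (x - x'))
    (\<lambda>y. g (y - x) - g (y - x'))"
  unfolding gs_bound_def
proof (intro allI)
  fix "is" :: "'n list" and y :: "real^'n"
  let ?n = "length is"
  have C: "C \<ge> 0" by (rule gs_bound_nonneg[OF b])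
  have "iter_partial is (\<lambda>y. g (y - x) + (-1) * g (y - x')) y = iter_partial is g (y - x) + (-1) * iter_partial is g (y - x')"
    unfolding iter_partial_add[OF smooth_shift[OF g] smooth_cmult[OF smooth_shift[OF g]]]
        iter_partial_cmult[OF smooth_shift[OF g]] iter_partial_shift ..
  then have e: "iter_partial is (\<lambda>y. g (y - x) - g (y - x')) y = iter_partial is g (y - x) - iter_partial is g (y - x')"
    by simp
  have "cmod (iter_partial is g (y - x) - iter_partial is g (y - x')) \<le>
      CARD('n) * (C * h * exp (a * (norm x + norm x')) * (h ^ ?n * fact ?n) * exp (- (a * norm y))) *
      norm ((y - x) - (y - x'))"
  proof (rule smooth_diff_bound[OF smooth_iter_partial[OF g]])
    fix i z assume "z \<in> closed_segment (y - x) (y - x')"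
    then obtain u where u: "0 \<le> u" "u \<le> 1" "z = (1 - u) *\<^sub>R (y - x) + u *\<^sub>R (y - x')"
      by (auto simp: in_segment)
    then have z: "z = y - ((1 - u) *\<^sub>R x + u *\<^sub>R x')" by (simp add: algebra_simps)
    have "norm ((1 - u) *\<^sub>R x + u *\<^sub>R x') \<le> (1 - u) * norm x + u * norm x'"
      using u by (intro order_trans[OF norm_triangle_ineq]) auto
    also have "\<dots> \<le> 1 * norm x + 1 * norm x'"
      using u by (intro add_mono mult_right_mono) auto
    finally have "norm y \<le> norm z + (norm x + norm x')"
      unfolding z using norm_triangle_sub[of y "(1 - u) *\<^sub>R x + u *\<^sub>R x'"] by simp
    then have "a * norm y \<le> a * norm z + a * (norm x + norm x')"
      using mult_left_mono[OF _ a] by (metis distrib_left)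
    then have ex: "exp (- (a * norm z)) \<le> exp (a * (norm x + norm x')) * exp (- (a * norm y))"
      by (simp add: exp_add[symmetric])
    have "real (Suc ?n) \<le> 2 ^ Suc ?n" using less_exp[of "Suc ?n"]
      by (metis of_nat_le_iff of_nat_numeral of_nat_power less_imp_le)
    then have F: "(h / 2) ^ Suc ?n * fact (Suc ?n) \<le> h * (h ^ ?n * fact ?n)"
      using h mult_left_mono[of "real (Suc ?n)" "2 ^ Suc ?n" "h ^ Suc ?n * fact ?n"]
      by (simp add: power_divide divide_le_eq mult_ac)
    have "C * ((h / 2) ^ Suc ?n * fact (Suc ?n)) * exp (- (a * norm z)) \<le>
       C * (h * (h ^ ?n * fact ?n)) * (exp (a * (norm x + norm x')) * exp (- (a * norm y)))"
      by (rule mult_mono[OF mult_left_mono[OF F C] ex]) (use C h in auto)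
    with gs_boundD[OF b, of "i # is" z]
    show "cmod (partial i (iter_partial is g) z) \<le>
        C * h * exp (a * (norm x + norm x')) * (h ^ ?n * fact ?n) * exp (- (a * norm y))"
      by (simp add: mult_ac)
  qed
  then show "cmod (iter_partial is (\<lambda>y. g (y - x) - g (y - x')) y) \<le>
      CARD('n) * C * h * exp (a * (norm x + norm x')) * norm (x - x') * (h ^ ?n * fact ?n) * exp (- (a * norm y))"
    unfolding e by (simp add: mult_ac norm_minus_commute)
qed

lemma cmod_cis_minus_1: "cmod (cis t - 1) \<le> \<bar>t\<bar>"
proof -
  have "norm (cis t - cis 0) \<le> 1 * norm (t - 0)"
  proof (rule differentiable_bound[of UNIV cis "\<lambda>s v. v *\<^sub>R (\<i> * cis s)"])
    fix s :: real
    show "(cis has_derivative (\<lambda>v. v *\<^sub>R (\<i> * cis s))) (at s within UNIV)"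
      by (rule has_derivative_cis)
    show "onorm (\<lambda>v. v *\<^sub>R (\<i> * cis s)) \<le> 1"
      by (rule onorm_le) (simp add: norm_mult)
  qed auto
  then show ?thesis by simp
qed

lemma iter_partial_const: "is \<noteq> [] \<Longrightarrow> iter_partial is (\<lambda>_. c) = (\<lambda>_. 0)"
proof (induction "is")
  case (Cons i "is")
  have p: "partial i (\<lambda>_. k) = (\<lambda>_. 0)" for k
    by (intro ext partial_eqI) auto
  show ?case using Cons p by (cases "is = []") auto
qed simp

lemma smooth_const: "smooth (\<lambda>_. c)"
proof -
  have "iter_partial is (\<lambda>_. c) differentiable_on UNIV" for "is"
    by (cases "is = []") (simp_all add: iter_partial_const differentiable_on_const)
  then show ?thesis unfolding smooth_def by blast
qed

lemma smooth_cis_minus_1: "smooth (\<lambda>y. cis (- (y \<bullet> \<eta>)) + (-1))"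
  using smooth_add[OF smooth_cis[of 1 \<eta>] smooth_const[of "-1"]] by simp

text \<open>The bound must be small with \<eta>. Without derivatives this costs the growth norm y
  \<le> exp (norm y); with derivatives the constant disappears, and one factor norm \<eta> is split
  off, the remaining ones being bounded by powers of 1 + norm \<eta>.\<close>

lemma iter_partial_cis_minus_1_bound:
  fixes \<eta> :: "real^'n::finite"
  shows "cmod (iter_partial is (\<lambda>y. cis (- (y \<bullet> \<eta>)) + (-1)) y) \<le> norm \<eta> * exp (1 * norm y) * (1 + norm \<eta>) ^ length is"
proof (cases "is")
  case Nil
  have "cmod (cis (- (y \<bullet> \<eta>)) - 1) \<le> \<bar>y \<bullet> \<eta>\<bar>" using cmod_cis_minus_1[of "- (y \<bullet> \<eta>)"] by simp
  also have "\<dots> \<le> norm \<eta> * norm y" using Cauchy_Schwarz_ineq2[of y \<eta>] by (simp add: mult.commute)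
  also have "\<dots> \<le> norm \<eta> * exp (norm y)"
    using exp_ge_add_one_self[of "norm y"] by (intro mult_left_mono) (linarith, simp)
  finally show ?thesis using Nil by simp
next
  case (Cons i js)
  have "iter_partial is (\<lambda>y. cis (- (y \<bullet> \<eta>)) + (-1)) y = iter_partial is (\<lambda>y. cis (- (y \<bullet> \<eta>))) y"
    using iter_partial_add[OF smooth_cis[of 1 \<eta>] smooth_const[of "-1"], of "is"] Cons
      iter_partial_const[of "is" "-1"] by simp
  then have "cmod (iter_partial is (\<lambda>y. cis (- (y \<bullet> \<eta>)) + (-1)) y) \<le> norm \<eta> ^ length is"
    using iter_partial_cis_bound by metis
  also have "\<dots> = norm \<eta> * 1 * norm \<eta> ^ length js" using Cons by simp
  also have "\<dots> \<le> norm \<eta> * exp (1 * norm y) * (1 + norm \<eta>) ^ length is"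
  proof (intro mult_mono)
    have "norm \<eta> ^ length js \<le> (1 + norm \<eta>) ^ length js" by (intro power_mono) auto
    also have "\<dots> \<le> (1 + norm \<eta>) ^ length is" using Cons by (intro power_increasing) auto
    finally show "norm \<eta> ^ length js \<le> (1 + norm \<eta>) ^ length is" .
  qed auto
  finally show ?thesis .
qed

text \<open>Position and frequency are changed one after the other: \<open>?f1\<close> is the change
  of translation, \<open>?f2\<close> the change of modulation. Each is proportional to the distance
  of the parameters, with a factor growing exponentially in them.\<close>

lemma gs_bound_tf_shift_diff:
  fixes g :: "real^'n::finite \<Rightarrow> complex"
  assumes g: "g \<in> gs_space" and h: "h > 0"
  shows "\<exists>C\<ge>0. \<exists>b\<ge>0. \<forall>X Y. gs_bound h a (C * norm (X - Y) * exp (b * (norm X + norm Y)))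
    (\<lambda>y. tf_shift X g y - tf_shift Y g y)"
proof -
  note s = gs_space_smooth[OF g]
  \<comment> \<open>The additional 1 is used up by the growth exp (norm y) of the character minus 1
    in \<open>?f2\<close>.\<close>
  define \<alpha> where "\<alpha> = \<bar>a\<bar> + 1"
  have \<alpha>: "\<alpha> \<ge> 0" by (simp add: \<alpha>_def)
  have "h / 2 > 0" using h by simp
  from gs_space_bound[OF g this] obtain C1 where C1: "gs_bound (h / 2) \<alpha> C1 g" by blast
  have C1': "gs_bound h \<alpha> C1 g" by (rule gs_bound_mono[OF C1]) (use h in auto)
  have C1_0: "C1 \<ge> 0" by (rule gs_bound_nonneg[OF C1])
  define d where "d = real CARD('n)"
  \<comment> \<open>The rate \<alpha> comes from translations and 2 / h from modulations: in
    \<open>?f2\<close> the frequency of Y and the difference of the frequencies both enter, together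
    at most 2 (norm X + norm Y).\<close>
  define b where "b = \<alpha> + 2 / h"
  define C where "C = d * C1 * h + C1 * exp (1 / h)"
  have b0: "b \<ge> 0" using h \<alpha> by (simp add: b_def)
  have C0: "C \<ge> 0" using h C1_0 by (simp add: C_def d_def)
  have main: "gs_bound h a (C * norm (X - Y) * exp (b * (norm X + norm Y))) (\<lambda>y. tf_shift X g y - tf_shift Y g y)" for X Y
  proof -
    obtain x \<xi> x' \<xi>' where XY: "X = (x, \<xi>)" "Y = (x', \<xi>')" by (cases X, cases Y)
    let ?\<eta> = "\<xi> - \<xi>'"
    note n = norm_fst_le[of x \<xi>] norm_snd_le[of \<xi> x] norm_fst_le[of x' \<xi>'] norm_snd_le[of \<xi>' x']
      norm_fst_le[of "x - x'" "\<xi> - \<xi>'"] norm_snd_le[of "\<xi> - \<xi>'" "x - x'"]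
    have XmY: "X - Y = (x - x', \<xi> - \<xi>')" by (simp add: XY)
    let ?f1 = "\<lambda>y. (g (y - x) - g (y - x')) * cis (- (y \<bullet> \<xi>))"
    let ?f2 = "\<lambda>y. tf_shift Y g y * (cis (- (y \<bullet> ?\<eta>)) + (-1))"
    have sd: "smooth (\<lambda>y. g (y - x) - g (y - x'))"
      using smooth_add[OF smooth_shift[OF s, of x] smooth_cmult[OF smooth_shift[OF s, of x'], of "-1"]] by simp
    have eq: "(\<lambda>y. tf_shift X g y - tf_shift Y g y) = (\<lambda>y. ?f1 y + ?f2 y)"
    proof
      fix y
      have "cis (- (y \<bullet> \<xi>')) * cis (- (y \<bullet> ?\<eta>)) = cis (- (y \<bullet> \<xi>))"
        unfolding cis_mult by (simp add: inner_diff_right)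
      moreover have "p * c1 - q * c2 = (p - q) * c1 + q * c2 * (c3 + - 1)"
        if "c2 * c3 = c1" for p q c1 c2 c3 :: complex
        unfolding that[symmetric] by (simp add: algebra_simps)
      ultimately show "tf_shift X g y - tf_shift Y g y = ?f1 y + ?f2 y"
        unfolding tf_shift_def XY fst_conv snd_conv by blast
    qed
    have 1: "gs_bound h \<alpha> (d * C1 * h * exp (\<alpha> * (norm x + norm x')) * norm (x - x') * exp (norm \<xi> / h)) ?f1"
      unfolding d_def by (rule gs_bound_mult_cis[OF sd gs_bound_shift_diff[OF s C1 h \<alpha>] h])
    have 2: "gs_bound h (\<alpha> - 1) (C1 * exp (\<alpha> * norm x') * exp (norm \<xi>' / h) * norm ?\<eta> * exp ((1 + norm ?\<eta>) / h)) ?f2"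
      using gs_bound_mult_exp_type[OF smooth_tf_shift[OF s] gs_bound_tf_shift[OF s C1' h \<alpha>, of Y] h
          smooth_cis_minus_1 iter_partial_cis_minus_1_bound] XY by simp
    have b1: "d * C1 * h * exp (\<alpha> * (norm x + norm x')) * norm (x - x') * exp (norm \<xi> / h) \<le>
        d * C1 * h * norm (X - Y) * exp (b * (norm X + norm Y))"
    proof -
      have "exp (\<alpha> * (norm x + norm x')) * exp (norm \<xi> / h) \<le> exp (b * (norm X + norm Y))"
      proof -
        have "norm x + norm x' \<le> norm X + norm Y" using n unfolding XY by (intro add_mono)
        moreover have "norm \<xi> \<le> 2 * (norm X + norm Y)"
          using n(2) norm_ge_zero[of X] norm_ge_zero[of Y] unfolding XY by argo
        ultimately have "\<alpha> * (norm x + norm x') + norm \<xi> / h \<le> \<alpha> * (norm X + norm Y) + (2 * (norm X + norm Y)) / h"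
          using h \<alpha> by (intro add_mono[OF mult_left_mono divide_right_mono]) auto
        also have "\<dots> = b * (norm X + norm Y)" by (simp add: b_def algebra_simps add_divide_distrib)
        finally show ?thesis by (simp add: exp_add[symmetric])
      qed
      then have "norm (x - x') * (exp (\<alpha> * (norm x + norm x')) * exp (norm \<xi> / h)) \<le> norm (X - Y) * exp (b * (norm X + norm Y))"
        using n unfolding XmY by (intro mult_mono) auto
      from mult_left_mono[OF this, of "d * C1 * h"] show ?thesis
        using C1_0 h by (simp add: d_def mult_ac)
    qed
    have b2: "C1 * exp (\<alpha> * norm x') * exp (norm \<xi>' / h) * norm ?\<eta> * exp ((1 + norm ?\<eta>) / h) \<le>
        C1 * exp (1 / h) * norm (X - Y) * exp (b * (norm X + norm Y))"
    proof -
      have "norm ?\<eta> \<le> norm \<xi> + norm \<xi>'" by (rule norm_triangle_ineq4)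
      then have "norm \<xi>' + norm ?\<eta> \<le> 2 * (norm X + norm Y)"
        using n norm_ge_zero[of X] unfolding XY by argo
      moreover have "norm x' \<le> norm X + norm Y" using n norm_ge_zero[of X] unfolding XY by argo
      ultimately have "\<alpha> * norm x' + (norm \<xi>' + norm ?\<eta>) / h \<le> \<alpha> * (norm X + norm Y) + (2 * (norm X + norm Y)) / h"
        using h \<alpha> by (intro add_mono[OF mult_left_mono divide_right_mono]) auto
      also have "\<dots> = b * (norm X + norm Y)" by (simp add: b_def algebra_simps add_divide_distrib)
      finally have "exp (\<alpha> * norm x' + (norm \<xi>' + norm ?\<eta>) / h) \<le> exp (b * (norm X + norm Y))" by simp
      then have "norm ?\<eta> * exp (\<alpha> * norm x' + (norm \<xi>' + norm ?\<eta>) / h) \<le> norm (X - Y) * exp (b * (norm X + norm Y))"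
        using n unfolding XmY by (intro mult_mono) auto
      from mult_left_mono[OF this, of "C1 * exp (1 / h)"] show ?thesis
        using C1_0 h by (simp add: mult_ac exp_add add_divide_distrib)
    qed
    have "gs_bound h a (d * C1 * h * exp (\<alpha> * (norm x + norm x')) * norm (x - x') * exp (norm \<xi> / h) +
        C1 * exp (\<alpha> * norm x') * exp (norm \<xi>' / h) * norm ?\<eta> * exp ((1 + norm ?\<eta>) / h)) (\<lambda>y. ?f1 y + ?f2 y)"
    proof (rule gs_bound_add)
      show "smooth ?f1" using smooth_mult[OF sd smooth_cis[of 1 \<xi>]] by simp
      show "smooth ?f2" by (rule smooth_mult[OF smooth_tf_shift[OF s] smooth_cis_minus_1])
    qed (rule gs_bound_mono[OF 1] gs_bound_mono[OF 2]; use h in \<open>simp add: \<alpha>_def\<close>)+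
    then show ?thesis unfolding eq
      by (rule gs_bound_mono) (use b1 b2 h in \<open>auto simp: C_def algebra_simps\<close>)
  qed
  then show ?thesis using b0 C0 by blast
qed

section \<open>The Gaussian as a product of entire functions\<close>

text \<open>A tensor product of functions of one complex variable, restricted to real points. For
  entire factors a partial derivative is a complex derivative of one factor, so that Cauchy's
  inequality bounds all derivatives without Hermite polynomials.\<close>

definition coord_prod :: "complex \<Rightarrow> ('n::finite \<Rightarrow> complex \<Rightarrow> complex) \<Rightarrow> real^'n \<Rightarrow> complex" where
  "coord_prod c H x = c * (\<Prod>i\<in>UNIV. H i (of_real (x $ i)))"

lemma coord_prod_differentiable:
  fixes H :: "'n::finite \<Rightarrow> complex \<Rightarrow> complex"
  assumes "\<And>i. H i holomorphic_on UNIV"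
  shows "coord_prod c H differentiable_on UNIV"
proof -
  have "(\<lambda>x. H i (of_real (x $ i))) differentiable (at x)" for i :: 'n and x :: "real^'n"
  proof (rule differentiable_compose[of "H i"])
    show "H i differentiable (at (of_real (x $ i)))"
      using assms[of i] by (simp add: field_differentiable_imp_differentiable holomorphic_on_imp_differentiable_at)
    have "((\<lambda>x. of_real (x $ i) :: complex) has_derivative (\<lambda>x. of_real (x $ i))) (at x)"
      by (intro bounded_linear.has_derivative[OF bounded_linear_of_real] bounded_linear_imp_has_derivative
          bounded_linear_vec_nth)
    then show "(\<lambda>x. of_real (x $ i) :: complex) differentiable (at x)" by (rule differentiableI)
  qed
  then obtain D where D: "\<And>i x. ((\<lambda>x. H i (of_real (x $ i))) has_derivative D i x) (at x)"
    unfolding differentiable_def by metis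
  have "((\<lambda>x. c * (\<Prod>i\<in>UNIV. H i (of_real (x $ i)))) has_derivative
     (\<lambda>y. c * (\<Sum>i\<in>UNIV. D i x y * (\<Prod>j\<in>UNIV - {i}. H j (of_real (x $ j)))))) (at x)" for x
    by (intro has_derivative_mult_right has_derivative_prod D)
  then show ?thesis
    unfolding coord_prod_def[abs_def] differentiable_on_def differentiable_def by blast
qed

lemma partial_coord_prod:
  fixes H :: "'n::finite \<Rightarrow> complex \<Rightarrow> complex"
  assumes "\<And>i. H i holomorphic_on UNIV"
  shows "partial j (coord_prod c H) = coord_prod c (H(j := deriv (H j)))"
proof (intro ext partial_eqI)
  fix x :: "real^'n"
  let ?P = "\<Prod>i\<in>UNIV - {j}. H i (of_real (x $ i))"
  have e: "coord_prod c H (x + t *\<^sub>R axis j 1) = c * (H j (of_real (x $ j) + of_real t) * ?P)" for t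
  proof -
    have "(\<Prod>i\<in>UNIV - {j}. H i (of_real ((x + t *\<^sub>R axis j 1) $ i))) = ?P"
      by (intro prod.cong) (auto simp: axis_def)
    then show ?thesis
      unfolding coord_prod_def by (subst prod.remove[of UNIV j]) (auto simp: axis_def)
  qed
  have "(\<Prod>i\<in>UNIV - {j}. (H(j := deriv (H j))) i (of_real (x $ i))) = ?P"
    by (intro prod.cong) auto
  then have d: "coord_prod c (H(j := deriv (H j))) x = c * (deriv (H j) (of_real (x $ j)) * ?P)"
    unfolding coord_prod_def by (subst prod.remove[of UNIV j]) auto
  have "(H j has_field_derivative deriv (H j) (of_real (x $ j) + of_real 0)) (at (of_real (x $ j) + of_real 0))"
    using assms[of j] by (simp add: holomorphic_derivI)
  then have "((\<lambda>z. H j (of_real (x $ j) + z)) has_field_derivative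
      deriv (H j) (of_real (x $ j) + of_real 0) * 1) (at (of_real 0))"
    by (rule DERIV_chain2[of "H j"]) (auto intro!: derivative_eq_intros)
  then have "((\<lambda>z. H j (of_real (x $ j) + z)) has_field_derivative deriv (H j) (of_real (x $ j))) (at (of_real 0))"
    by simp
  then have "((\<lambda>z. c * (H j (of_real (x $ j) + z) * ?P)) has_field_derivative c * (deriv (H j) (of_real (x $ j)) * ?P)) (at (of_real 0))"
    by (intro DERIV_cmult DERIV_cmult_right)
  from has_vector_derivative_real_field[OF this]
  show "((\<lambda>t. coord_prod c H (x + t *\<^sub>R axis j 1)) has_vector_derivative coord_prod c (H(j := deriv (H j))) x) (at 0)"
    unfolding e d .
qed

lemma iter_partial_coord_prod:
  assumes "\<And>i. H i holomorphic_on UNIV"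
  shows "iter_partial is (coord_prod c H) = coord_prod c (\<lambda>i. (deriv ^^ count_list is i) (H i))"
proof (induction "is")
  case (Cons j "is")
  have h: "(deriv ^^ n) (H i) holomorphic_on UNIV" for n i
    using assms by (intro holomorphic_higher_deriv) auto
  have "iter_partial (j # is) (coord_prod c H) =
      coord_prod c ((\<lambda>i. (deriv ^^ count_list is i) (H i))(j := deriv ((deriv ^^ count_list is j) (H j))))"
    by (simp add: Cons partial_coord_prod[OF h])
  also have "(\<lambda>i. (deriv ^^ count_list is i) (H i))(j := deriv ((deriv ^^ count_list is j) (H j))) =
      (\<lambda>i. (deriv ^^ count_list (j # is) i) (H i))" by auto
  finally show ?case .
qed simp

lemma smooth_coord_prod:
  assumes "\<And>i. H i holomorphic_on UNIV"
  shows "smooth (coord_prod c H)"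
  unfolding smooth_def iter_partial_coord_prod[OF assms]
  by (intro allI coord_prod_differentiable holomorphic_higher_deriv assms open_UNIV)

text \<open>Cauchy's inequality on the circle of radius R about t. A large R gives an arbitrarily
  small geometric factor, as the Gelfand--Shilov space requires, and a is an arbitrary rate of
  decay.\<close>

lemma higher_deriv_gauss_bound:
  fixes t R a :: real
  assumes R: "R > 0"
  shows "cmod ((deriv ^^ n) (\<lambda>z. exp (- (z\<^sup>2 / 2))) (of_real t)) \<le>
    fact n * (exp (R\<^sup>2 / 2 + a\<^sup>2) * exp (- (a * \<bar>t\<bar>))) / R ^ n"
proof (rule Cauchy_inequality[OF _ _ R])
  show "(\<lambda>z. exp (- (z\<^sup>2 / 2))) holomorphic_on ball (complex_of_real t) R" by (intro holomorphic_intros) auto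
  show "continuous_on (cball (complex_of_real t) R) (\<lambda>z. exp (- (z\<^sup>2 / 2)))" by (intro continuous_intros) auto
  fix x assume x: "cmod (of_real t - x) = R"
  have R2: "(t - Re x)\<^sup>2 + (Im x)\<^sup>2 = R\<^sup>2" using x by (auto simp: cmod_def)
  have "Re (- (x\<^sup>2 / 2)) = ((Im x)\<^sup>2 - (Re x)\<^sup>2) / 2" by (simp add: power2_eq_square field_simps)
  \<comment> \<open>On the circle the square of Im x is R^2 - (t - Re x)^2. Since (t - Re x)^2 + (Re
    x)^2 is at least t^2 / 2, Gaussian decay in t survives uniformly on the circle.\<close>
  also have "\<dots> \<le> R\<^sup>2 / 2 - t\<^sup>2 / 4"
  proof -
    have "0 \<le> (t - 2 * Re x)\<^sup>2" by simp
    then have "t\<^sup>2 / 2 \<le> (t - Re x)\<^sup>2 + (Re x)\<^sup>2" by (simp add: power2_eq_square algebra_simps)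
    with R2 show ?thesis by simp
  qed
  also have "\<dots> \<le> R\<^sup>2 / 2 + a\<^sup>2 - a * \<bar>t\<bar>"
  proof -
    have "0 \<le> (\<bar>t\<bar> / 2 - a)\<^sup>2" by simp
    then have "a * \<bar>t\<bar> \<le> \<bar>t\<bar>\<^sup>2 / 4 + a\<^sup>2" by (simp add: power2_eq_square algebra_simps)
    then show ?thesis by simp
  qed
  finally have "exp (Re (- (x\<^sup>2 / 2))) \<le> exp (R\<^sup>2 / 2 + a\<^sup>2 - a * \<bar>t\<bar>)" by simp
  then show "cmod (exp (- (x\<^sup>2 / 2))) \<le> exp (R\<^sup>2 / 2 + a\<^sup>2) * exp (- (a * \<bar>t\<bar>))"
    unfolding norm_exp_eq_Re exp_add[symmetric] by (simp only: diff_conv_add_uminus)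
qed

lemma gaussian_coord_prod:
  "(gaussian :: real^'n::finite \<Rightarrow> complex) =
    coord_prod (of_real (pi powr (- (real CARD('n) / 4)))) (\<lambda>i z. exp (- (z\<^sup>2 / 2)))"
proof
  fix x :: "real^'n"
  have "(norm x)\<^sup>2 = (\<Sum>i\<in>UNIV. (x $ i)\<^sup>2)"
    by (simp add: norm_vec_def L2_set_def sum_nonneg)
  then have "exp (- ((norm x)\<^sup>2 / 2)) = (\<Prod>i\<in>UNIV. exp (- ((x $ i)\<^sup>2 / 2)))"
    by (simp add: exp_sum[symmetric] sum_negf sum_divide_distrib)
  then show "gaussian x = coord_prod (of_real (pi powr (- (real CARD('n) / 4)))) (\<lambda>i z. exp (- (z\<^sup>2 / 2))) x"
    by (simp add: gaussian_def coord_prod_def flip: exp_of_real)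
qed

lemma gaussian_gs_space: "(gaussian :: real^'n::finite \<Rightarrow> complex) \<in> gs_space"
proof (rule gs_spaceI)
  let ?E = "\<lambda>z :: complex. exp (- (z\<^sup>2 / 2))"
  let ?c = "complex_of_real (pi powr (- (real CARD('n) / 4)))"
  have hol: "?E holomorphic_on UNIV" by (intro holomorphic_intros) auto
  note g = gaussian_coord_prod[where 'n = 'n]
  show "smooth (gaussian :: real^'n \<Rightarrow> complex)"
    unfolding g by (rule smooth_coord_prod[OF hol])
  fix h a0 :: real assume h: "h > 0"
  define a where "a = \<bar>a0\<bar>"
  \<comment> \<open>The radius for which the factor 1 / R^n of Cauchy's inequality is h^n.\<close>
  define R where "R = 1 / h"
  have R: "R > 0" using h by (simp add: R_def)
  define B where "B = exp (R\<^sup>2 / 2 + a\<^sup>2)"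
  have "gs_bound h a (cmod ?c * B ^ CARD('n)) (gaussian :: real^'n \<Rightarrow> complex)"
    unfolding gs_bound_def
  proof (intro allI)
    fix "is" and x :: "real^'n"
    have "cmod (iter_partial is gaussian x) =
        cmod ?c * (\<Prod>i\<in>UNIV. cmod ((deriv ^^ count_list is i) ?E (of_real (x $ i))))"
      unfolding g iter_partial_coord_prod[OF hol] by (simp add: coord_prod_def norm_mult prod_norm)
    also have "\<dots> \<le> cmod ?c * (\<Prod>i\<in>UNIV. fact (count_list is i) * (B * exp (- (a * \<bar>x $ i\<bar>))) / R ^ count_list is i)"
      unfolding B_def by (intro mult_left_mono prod_mono conjI higher_deriv_gauss_bound R) auto
    also have "(\<Prod>i\<in>UNIV. fact (count_list is i) * (B * exp (- (a * \<bar>x $ i\<bar>))) / R ^ count_list is i) =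
        mi_fact (count_list is) * (B ^ CARD('n) * exp (- (a * (\<Sum>i\<in>UNIV. \<bar>x $ i\<bar>)))) / R ^ length is"
      by (simp add: prod_dividef prod.distrib mi_fact_def exp_sum[symmetric] sum_negf sum_distrib_left
          power_sum[symmetric] sum_count_list)
    also have "\<dots> \<le> fact (length is) * (B ^ CARD('n) * exp (- (a * norm x))) / R ^ length is"
    proof -
      have "exp (- (a * (\<Sum>i\<in>UNIV. \<bar>x $ i\<bar>))) \<le> exp (- (a * norm x))"
        using norm_le_l1_cart[of x] by (simp add: a_def mult_left_mono)
      then show ?thesis using R mi_fact_le_fact[of "is"]
        by (intro divide_right_mono mult_mono) (auto simp: B_def)
    qed
    also have "\<dots> = B ^ CARD('n) * (h ^ length is * fact (length is)) * exp (- (a * norm x))"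
      using h by (simp add: R_def power_divide field_simps)
    finally show "cmod (iter_partial is gaussian x) \<le>
        cmod ?c * B ^ CARD('n) * (h ^ length is * fact (length is)) * exp (- (a * norm x))"
      by (simp add: mult_left_mono mult.assoc)
  qed
  then have "gs_bound h a0 (cmod ?c * B ^ CARD('n)) (gaussian :: real^'n \<Rightarrow> complex)"
    by (rule gs_bound_mono) (use h in \<open>simp_all add: a_def\<close>)
  then show "\<exists>C. gs_bound h a0 C (gaussian :: real^'n \<Rightarrow> complex)" ..
qed

lemma gaussian_nonzero: "(gaussian :: real^'n::finite \<Rightarrow> complex) \<noteq> (\<lambda>_. 0)"
proof
  assume "gaussian = (\<lambda>_ :: real^'n. 0 :: complex)"
  then have "gaussian (0 :: real^'n) = 0" by (rule fun_cong)
  then show False by (simp add: gaussian_def)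
qed

section \<open>Orlicz quasi-norms of convolutions\<close>

text \<open>For r > 0 this is an increasing bijection of [0, \<infinity>], with the power 1 / r as
  inverse, and hence compatible with the infimum in the Orlicz functional.\<close>

definition enn_powr :: "ennreal \<Rightarrow> real \<Rightarrow> ennreal" where
  "enn_powr t r = (if t = top then top else ennreal (enn2real t powr r))"

lemma enn_powr_ennreal: "x \<ge> 0 \<Longrightarrow> enn_powr (ennreal x) r = ennreal (x powr r)"
  by (simp add: enn_powr_def)

lemma enn_powr_top [simp]: "enn_powr top r = top"
  by (simp add: enn_powr_def)

lemma enn_powr_mono:
  assumes "s \<le> t" "r > 0" shows "enn_powr s r \<le> enn_powr t r"
proof (cases "t = top")
  case False
  then have "s \<noteq> top" "t < top" using assms(1) by (auto simp: top_unique less_top)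
  then show ?thesis using False assms
    by (auto simp: enn_powr_def intro!: ennreal_leI powr_mono2 enn2real_mono)
qed simp

lemma enn_powr_inverse: "r \<noteq> 0 \<Longrightarrow> enn_powr (enn_powr t r) (1 / r) = t"
  by (cases t) (auto simp: enn_powr_ennreal powr_powr)

lemma enn_powr_mult:
  assumes "c > 0" shows "enn_powr (ennreal c * t) r = ennreal (c powr r) * enn_powr t r"
  using assms by (cases t) (auto simp: enn_powr_ennreal powr_mult ennreal_mult[symmetric] ennreal_mult_top)

lemma enn_powr_divide:
  assumes "c > 0" shows "enn_powr (t / ennreal c) r = enn_powr t r / ennreal (c powr r)"
proof -
  have d: "s / ennreal a = ennreal (1 / a) * s" if "a > 0" for s and a :: real
    using that by (simp add: divide_ennreal_def inverse_ennreal mult.commute inverse_eq_divide)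
  show ?thesis using assms by (simp add: d enn_powr_mult powr_divide)
qed

section \<open>Young functions and Jensen's inequality with a constant\<close>

lemma young_zero: "young \<Phi> \<Longrightarrow> \<Phi> 0 = 0"
  by (simp add: young_def)

text \<open>Convexity towards 0, that is, monotonicity of \<Phi> t / t, written without a quotient
  so that infinite values are covered.\<close>

lemma young_star:
  assumes "young \<Phi>" "s \<ge> 0" "0 \<le> u" "u \<le> 1"
  shows "\<Phi> (u * s) \<le> ennreal u * \<Phi> s"
proof -
  have "\<forall>s\<ge>0. \<forall>t\<ge>0. \<forall>u\<in>{0..1}.
      \<Phi> (u * s + (1 - u) * t) \<le> ennreal u * \<Phi> s + ennreal (1 - u) * \<Phi> t"
    using assms(1) by (simp add: young_def)
  then have "\<Phi> (u * s + (1 - u) * 0) \<le> ennreal u * \<Phi> s + ennreal (1 - u) * \<Phi> 0"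
    using assms by (meson atLeastAtMost_iff order_refl)
  then show ?thesis using young_zero[OF assms(1)] by simp
qed

lemma young_mono:
  assumes "young \<Phi>" "0 \<le> s" "s \<le> t"
  shows "\<Phi> s \<le> \<Phi> t"
proof (cases "t = 0")
  case True
  then show ?thesis using assms by simp
next
  case False
  then have "\<Phi> ((s / t) * t) \<le> ennreal (s / t) * \<Phi> t"
    using assms by (intro young_star) auto
  also have "\<dots> \<le> ennreal 1 * \<Phi> t"
    using assms False by (intro mult_right_mono ennreal_leI) auto
  finally show ?thesis using False by simp
qed

lemma young_ext_0: "young \<Phi> \<Longrightarrow> young_ext \<Phi> 0 = 0"
  by (simp add: young_ext_def young_zero)

lemma young_ext_mono:
  assumes "young \<Phi>" "s \<le> t" shows "young_ext \<Phi> s \<le> young_ext \<Phi> t"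
proof (cases "t = top")
  case False
  then have "s \<noteq> top" "t < top" using assms(2) by (auto simp: top_unique less_top)
  then show ?thesis using False assms
    by (auto simp: young_ext_def intro!: young_mono enn2real_mono)
qed (simp add: young_ext_def)

lemma young_ext_star:
  assumes "young \<Phi>" "0 < s" "ennreal s \<le> t"
  shows "t / ennreal s * young_ext \<Phi> (ennreal s) \<le> young_ext \<Phi> t"
proof (cases t)
  case (real t')
  then have t': "s \<le> t'" "t' > 0" using assms by (auto simp: ennreal_le_iff)
  have "\<Phi> ((s / t') * t') \<le> ennreal (s / t') * \<Phi> t'"
    using assms t' by (intro young_star) auto
  then have "ennreal (t' / s) * \<Phi> s \<le> ennreal (t' / s) * (ennreal (s / t') * \<Phi> t')"
    using t' by (intro mult_left_mono) auto
  also have "\<dots> = \<Phi> t'"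
    using t' assms by (simp add: mult.assoc[symmetric] ennreal_mult[symmetric])
  finally show ?thesis using real assms by (simp add: young_ext_def divide_ennreal)
qed (simp add: young_ext_def)

text \<open>Superlevel sets of a monotone function are upward closed, and in a complete linear order
  such a set is an open or closed ray starting at its infimum.\<close>

lemma mono_borel_measurable_ennreal:
  fixes f :: "ennreal \<Rightarrow> ennreal"
  assumes "\<And>s t. s \<le> t \<Longrightarrow> f s \<le> f t"
  shows "f \<in> borel_measurable borel"
proof (rule borel_measurableI_greater)
  fix y
  let ?U = "{x. y < f x}"
  have up: "t \<in> ?U" if "s \<in> ?U" "s \<le> t" for s t
    using that assms[of s t] by auto
  have "?U = {Inf ?U..} \<or> ?U = {Inf ?U<..}"
  proof (cases "Inf ?U \<in> ?U")
    case True
    have "?U = {Inf ?U..}"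
    proof (intro equalityI subsetI)
      fix x assume "x \<in> ?U"
      then show "x \<in> {Inf ?U..}" by (simp only: atLeast_iff) (rule Inf_lower)
    next
      fix x assume "x \<in> {Inf ?U..}"
      then show "x \<in> ?U" using up[OF True] by (simp only: atLeast_iff)
    qed
    then show ?thesis ..
  next
    case False
    have "?U = {Inf ?U<..}"
    proof (intro equalityI subsetI)
      fix x assume "x \<in> ?U"
      then have "Inf ?U \<le> x" "Inf ?U \<noteq> x" using False by (auto intro: Inf_lower simp only:)
      then show "x \<in> {Inf ?U<..}" by (simp only: greaterThan_iff less_le) simp
    next
      fix x assume "x \<in> {Inf ?U<..}"
      then obtain s where "s \<in> ?U" "s < x" by (auto simp only: greaterThan_iff Inf_less_iff)
      then show "x \<in> ?U" using up[of s x] less_imp_le by blast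
    qed
    then show ?thesis ..
  qed
  then obtain c where "?U = {c..} \<or> ?U = {c<..}" by blast
  moreover have "V \<in> sets borel" if "V = {c..} \<or> V = {c<..}" for V :: "ennreal set"
    using that by auto
  ultimately have "?U \<in> sets borel" by blast
  then show "{x \<in> space borel. y < f x} \<in> sets borel" by simp
qed

lemma young_ext_measurable: "young \<Phi> \<Longrightarrow> young_ext \<Phi> \<in> borel_measurable borel"
  by (rule mono_borel_measurable_ennreal) (rule young_ext_mono)

text \<open>The loss of the factor 2 allows an elementary argument that also covers
  Young functions with infinite values: only the monotonicity of \<open>\<Phi> t / t\<close> is used.\<close>

lemma young_ext_nn_integral_aux:
  fixes M :: "'a measure"
  assumes \<Phi>: "young \<Phi>" and h[measurable]: "h \<in> borel_measurable M"
    and M: "emeasure M (space M) = 1" and s: "0 \<le> s" "2 * ennreal s \<le> (\<integral>\<^sup>+x. h x \<partial>M)"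
  shows "young_ext \<Phi> (ennreal s) \<le> (\<integral>\<^sup>+x. young_ext \<Phi> (h x) \<partial>M)"
proof (cases "s = 0")
  case True
  then show ?thesis by (simp add: young_ext_0[OF \<Phi>])
next
  case False
  with s have s0: "s > 0" by simp
  let ?P = "young_ext \<Phi> (ennreal s)" and ?I = "\<integral>\<^sup>+x. young_ext \<Phi> (h x) \<partial>M"
  have [measurable]: "(\<lambda>x. young_ext \<Phi> (h x)) \<in> borel_measurable M"
    by (rule measurable_compose[OF h young_ext_measurable[OF \<Phi>]])
  show ?thesis
  proof (cases "?P = top")
    case True
    \<comment> \<open>Otherwise h would be at most s almost everywhere on a probability space, and
      its mean could not reach 2 s. So the integrand is infinite on a set of positive
      measure.\<close>
    have "emeasure M {x\<in>space M. ennreal s \<le> h x} \<noteq> 0"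
    proof
      assume "emeasure M {x\<in>space M. ennreal s \<le> h x} = 0"
      then have "AE x in M. \<not> ennreal s \<le> h x"
        by (subst AE_iff_measurable[of "{x\<in>space M. ennreal s \<le> h x}"]) auto
      then have "AE x in M. h x \<le> ennreal s" by (auto elim: eventually_mono)
      then have "(\<integral>\<^sup>+x. h x \<partial>M) \<le> (\<integral>\<^sup>+x. ennreal s \<partial>M)" by (rule nn_integral_mono_AE)
      also have "\<dots> = ennreal s" by (simp add: M)
      finally have "2 * ennreal s \<le> ennreal s" using s by simp
      then have "ennreal (2 * s) \<le> ennreal s" using s0 by (simp add: ennreal_mult)
      then show False using s0 by (simp add: ennreal_le_iff)
    qed
    then have "top = (\<integral>\<^sup>+x. top * indicator {x\<in>space M. ennreal s \<le> h x} x \<partial>M)"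
      by (subst nn_integral_cmult_indicator) (auto simp: ennreal_top_mult)
    also have "\<dots> \<le> ?I"
    proof (rule nn_integral_mono)
      fix x
      show "top * indicator {x\<in>space M. ennreal s \<le> h x} x \<le> young_ext \<Phi> (h x)"
        using young_ext_mono[OF \<Phi>, of "ennreal s" "h x"] True
        by (auto simp: indicator_def top_unique)
    qed
    finally show ?thesis by (simp add: top_unique)
  next
    case False
    \<comment> \<open>The quotient of h x by s, times \<open>?P\<close>, is at most \<Phi> (h x)
      where h x \<ge> s, by monotonicity of \<Phi> t / t, and at most \<open>?P\<close> elsewhere.
      Integration yields that twice \<open>?P\<close> is at most \<open>?I\<close> plus
      \<open>?P\<close>, and the finite \<open>?P\<close> cancels.\<close>
    have "2 * ?P = 2 * ennreal s / ennreal s * ?P"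
    proof -
      have "2 * ennreal s / ennreal s = 2"
        using s0 by (simp add: ennreal_mult_divide_eq)
      then show ?thesis by simp
    qed
    also have "\<dots> \<le> (\<integral>\<^sup>+x. h x \<partial>M) / ennreal s * ?P"
      using s by (intro mult_right_mono divide_right_mono_ennreal) auto
    also have "\<dots> = (\<integral>\<^sup>+x. h x / ennreal s * ?P \<partial>M)"
      by (simp add: nn_integral_multc nn_integral_divide)
    also have "\<dots> \<le> (\<integral>\<^sup>+x. young_ext \<Phi> (h x) + ?P \<partial>M)"
    proof (rule nn_integral_mono)
      fix x
      show "h x / ennreal s * ?P \<le> young_ext \<Phi> (h x) + ?P"
      proof (cases "ennreal s \<le> h x")
        case True
        then show ?thesis using young_ext_star[OF \<Phi> s0 True] by (simp add: add_increasing2)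
      next
        case False
        then have "h x / ennreal s \<le> ennreal s / ennreal s" by (intro divide_right_mono_ennreal) auto
        also have "\<dots> = 1" using s0 by simp
        finally have "h x / ennreal s * ?P \<le> 1 * ?P" by (rule mult_right_mono) simp
        then show ?thesis by (simp add: add_increasing)
      qed
    qed
    also have "\<dots> = ?I + ?P" by (simp add: nn_integral_add M)
    finally have "?P + ?P \<le> ?I + ?P" by (simp add: mult_2)
    then show ?thesis using False by (simp add: ennreal_add_left_cancel_le add.commute)
  qed
qed

text \<open>Jensen's inequality for the probability measure with density k, up to the factor 1 / 2
  in the argument. Asking only that t lies below the mean lets pointwise estimates be inserted
  directly.\<close>

lemma young_ext_nn_integral:
  fixes M :: "'a measure"
  assumes \<Phi>: "young \<Phi>" and k[measurable]: "k \<in> borel_measurable M"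
    and h[measurable]: "h \<in> borel_measurable M"
    and 1: "(\<integral>\<^sup>+x. k x \<partial>M) = 1" and t: "t \<le> (\<integral>\<^sup>+x. k x * h x \<partial>M)"
  shows "young_ext \<Phi> (t / 2) \<le> (\<integral>\<^sup>+x. k x * young_ext \<Phi> (h x) \<partial>M)"
proof -
  let ?D = "density M k"
  have D: "emeasure ?D (space ?D) = 1" using 1 by (simp add: emeasure_density cong: nn_integral_cong_simp)
  have [measurable]: "(\<lambda>x. young_ext \<Phi> (h x)) \<in> borel_measurable M"
    by (rule measurable_compose[OF h young_ext_measurable[OF \<Phi>]])
  have I: "(\<integral>\<^sup>+x. young_ext \<Phi> (h x) \<partial>?D) = (\<integral>\<^sup>+x. k x * young_ext \<Phi> (h x) \<partial>M)"
    by (simp add: nn_integral_density)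
  have h': "(\<integral>\<^sup>+x. h x \<partial>?D) = (\<integral>\<^sup>+x. k x * h x \<partial>M)" by (simp add: nn_integral_density)
  have hD: "h \<in> borel_measurable ?D" by simp
  note aux = young_ext_nn_integral_aux[OF \<Phi> hD D, unfolded I h']
  show ?thesis
  proof (cases t)
    case (real t')
    have e: "t / 2 = ennreal (t' / 2)" using real by (simp add: divide_ennreal[symmetric])
    have "2 * ennreal (t' / 2) = t"
      using real ennreal_mult[of 2 "t' / 2"] by simp
    then have "2 * ennreal (t' / 2) \<le> (\<integral>\<^sup>+x. k x * h x \<partial>M)" using t by simp
    then show ?thesis unfolding e using real by (intro aux) auto
  next
    case top
    \<comment> \<open>If the mean is infinite, every finite s is admissible, and \<Phi> s tends to
      \<infinity>.\<close>
    have "(\<Phi> \<longlongrightarrow> top) at_top" using \<Phi> by (simp add: young_def)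
    moreover have "\<forall>\<^sub>F s in at_top. \<Phi> s \<le> (\<integral>\<^sup>+x. k x * young_ext \<Phi> (h x) \<partial>M)"
      using eventually_ge_at_top[of 0]
    proof eventually_elim
      case (elim s)
      have "young_ext \<Phi> (ennreal s) \<le> (\<integral>\<^sup>+x. k x * young_ext \<Phi> (h x) \<partial>M)"
        by (rule aux[OF elim]) (use t top in \<open>simp add: top_unique\<close>)
      then show ?case using elim by (simp add: young_ext_def)
    qed
    ultimately have "top \<le> (\<integral>\<^sup>+x. k x * young_ext \<Phi> (h x) \<partial>M)"
      by (rule tendsto_upperbound) simp
    then show ?thesis by (simp add: top_unique)
  qed
qed

section \<open>Orlicz functionals: admissible parameters, powers, measurability\<close>

lemma ennreal_inverse_antimono: "s \<le> t \<Longrightarrow> inverse t \<le> inverse (s :: ennreal)"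
  by (simp add: less_eq_ennreal.rep_eq inverse_ennreal.rep_eq ereal_inverse_antimono enn2ereal_nonneg)

lemma nn_integral_lborel_shift:
  fixes f :: "'a::euclidean_space \<Rightarrow> ennreal"
  assumes [measurable]: "f \<in> borel_measurable borel"
  shows "(\<integral>\<^sup>+x. f (x - a) \<partial>lborel) = (\<integral>\<^sup>+x. f x \<partial>lborel)"
proof -
  have "(\<integral>\<^sup>+x. f (x - a) \<partial>lborel) = (\<integral>\<^sup>+x. f x \<partial>distr lborel borel ((+) (- a)))"
    by (subst nn_integral_distr) (auto simp: algebra_simps)
  then show ?thesis by (simp add: lborel_distr_plus)
qed

lemma orlicz_norm_lborel:
  "orlicz_norm \<Phi> g = Inf {ennreal l | l. l > 0 \<and> (\<integral>\<^sup>+ x. young_ext \<Phi> (g x / ennreal l) \<partial>lborel) \<le> 1}"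
  by (simp add: orlicz_norm_def nn_integral_completion)

lemma orlicz_norm_le:
  assumes "l > 0" "(\<integral>\<^sup>+ x. young_ext \<Phi> (g x / ennreal l) \<partial>lborel) \<le> 1"
  shows "orlicz_norm \<Phi> g \<le> ennreal l"
  unfolding orlicz_norm_lborel using assms by (intro Inf_lower) auto

text \<open>The infimum need not be attained, but a t strictly above it dominates an admissible l.
  The value t = \<infinity> is included.\<close>

lemma orlicz_norm_less:
  assumes "orlicz_norm \<Phi> g < t" and \<Phi>: "young \<Phi>"
  shows "(\<integral>\<^sup>+ x. young_ext \<Phi> (g x / t) \<partial>lborel) \<le> 1"
proof -
  from assms(1) obtain l where l: "l > 0" "(\<integral>\<^sup>+ x. young_ext \<Phi> (g x / ennreal l) \<partial>lborel) \<le> 1" "ennreal l < t"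
    unfolding orlicz_norm_lborel Inf_less_iff by auto
  have "(\<integral>\<^sup>+ x. young_ext \<Phi> (g x / t) \<partial>lborel) \<le> (\<integral>\<^sup>+ x. young_ext \<Phi> (g x / ennreal l) \<partial>lborel)"
    unfolding divide_ennreal_def
    using ennreal_inverse_antimono[OF less_imp_le[OF l(3)]]
    by (intro nn_integral_mono young_ext_mono[OF \<Phi>] mult_left_mono) auto
  with l show ?thesis by simp
qed

lemma orlicz_norm_mono:
  assumes "young \<Phi>" "\<And>x. g x \<le> h x"
  shows "orlicz_norm \<Phi> g \<le> orlicz_norm \<Phi> h"
  unfolding orlicz_norm_lborel
proof (rule Inf_superset_mono, clarify)
  fix l :: real assume l: "l > 0" "(\<integral>\<^sup>+ x. young_ext \<Phi> (h x / ennreal l) \<partial>lborel) \<le> 1"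
  have "(\<integral>\<^sup>+ x. young_ext \<Phi> (g x / ennreal l) \<partial>lborel) \<le> (\<integral>\<^sup>+ x. young_ext \<Phi> (h x / ennreal l) \<partial>lborel)"
    by (intro nn_integral_mono young_ext_mono assms divide_right_mono_ennreal)
  then show "\<exists>l'. ennreal l = ennreal l' \<and> 0 < l' \<and> (\<integral>\<^sup>+ x. young_ext \<Phi> (g x / ennreal l') \<partial>lborel) \<le> 1"
    using l by (intro exI[of _ l]) auto
qed

text \<open>l is admissible for \<Phi> and g exactly if l^r is admissible for
  \<open>\<Phi>\<^sub>0\<close> and the r-th power of g. This reduces quasi-norms of order r to
  functionals of Young functions.\<close>

lemma orlicz_norm_powr:
  fixes g :: "'a::euclidean_space \<Rightarrow> ennreal"
  assumes r: "r > 0" and \<Phi>: "\<And>t. t \<ge> 0 \<Longrightarrow> \<Phi> t = \<Phi>\<^sub>0 (t powr r)"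
  shows "orlicz_norm \<Phi>\<^sub>0 (\<lambda>x. enn_powr (g x) r) = enn_powr (orlicz_norm \<Phi> g) r"
proof -
  have ye: "young_ext \<Phi> t = young_ext \<Phi>\<^sub>0 (enn_powr t r)" for t
    by (cases t) (auto simp: young_ext_def enn_powr_ennreal \<Phi>)
  define A where "A = {ennreal l | l. l > 0 \<and> (\<integral>\<^sup>+ x. young_ext \<Phi> (g x / ennreal l) \<partial>lborel) \<le> 1}"
  define B where "B = {ennreal l | l. l > 0 \<and> (\<integral>\<^sup>+ x. young_ext \<Phi>\<^sub>0 (enn_powr (g x) r / ennreal l) \<partial>lborel) \<le> 1}"
  have AB: "enn_powr a r \<in> B" if "a \<in> A" for a
  proof -
    from that obtain l where l: "a = ennreal l" "l > 0" "(\<integral>\<^sup>+ x. young_ext \<Phi> (g x / ennreal l) \<partial>lborel) \<le> 1"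
      by (auto simp: A_def)
    then show ?thesis unfolding B_def
      by (auto simp: enn_powr_ennreal ye enn_powr_divide intro!: exI[of _ "l powr r"])
  qed
  have BA: "\<exists>a\<in>A. b = enn_powr a r" if "b \<in> B" for b
  proof -
    from that obtain l where l: "b = ennreal l" "l > 0"
      "(\<integral>\<^sup>+ x. young_ext \<Phi>\<^sub>0 (enn_powr (g x) r / ennreal l) \<partial>lborel) \<le> 1" by (auto simp: B_def)
    define m where "m = l powr (1 / r)"
    have m: "m > 0" "m powr r = l" using l r by (auto simp: m_def powr_powr)
    have "ennreal m \<in> A" unfolding A_def
      using m l by (auto simp: ye enn_powr_divide)
    moreover have "b = enn_powr (ennreal m) r" using m l by (simp add: enn_powr_ennreal)
    ultimately show ?thesis by blast
  qed
  have "Inf B = enn_powr (Inf A) r"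
  proof (rule antisym)
    show "enn_powr (Inf A) r \<le> Inf B"
      using BA r by (auto intro!: Inf_greatest enn_powr_mono Inf_lower dest!: BA)
    have "enn_powr (Inf B) (1 / r) \<le> Inf A"
    proof (rule Inf_greatest)
      fix a assume "a \<in> A"
      then have "Inf B \<le> enn_powr a r" by (intro Inf_lower AB)
      then have "enn_powr (Inf B) (1 / r) \<le> enn_powr (enn_powr a r) (1 / r)"
        using r by (intro enn_powr_mono) auto
      then show "enn_powr (Inf B) (1 / r) \<le> a" using r by (simp add: enn_powr_inverse)
    qed
    then have "enn_powr (enn_powr (Inf B) (1 / r)) r \<le> enn_powr (Inf A) r"
      using r by (intro enn_powr_mono) auto
    then show "Inf B \<le> enn_powr (Inf A) r"
      using enn_powr_inverse[of "1 / r" "Inf B"] r by simp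
  qed
  then show ?thesis by (simp add: orlicz_norm_lborel A_def B_def)
qed

text \<open>The functional is below a exactly if the modular is at most 1 for some positive rational
  parameter below a. The sublevel set is thus a countable union, and each modular is measurable in
  \<zeta> by Tonelli's theorem.\<close>

lemma orlicz_norm_measurable:
  fixes H :: "'a::euclidean_space \<times> 'b::euclidean_space \<Rightarrow> ennreal"
  assumes \<Phi>: "young \<Phi>" and H[measurable]: "H \<in> borel_measurable borel"
  shows "(\<lambda>\<zeta>. orlicz_norm \<Phi> (\<lambda>x. H (x, \<zeta>))) \<in> borel_measurable borel"
proof (rule borel_measurableI_less)
  fix a
  note [measurable] = young_ext_measurable[OF \<Phi>]
  have "{\<zeta> \<in> space borel. orlicz_norm \<Phi> (\<lambda>x. H (x, \<zeta>)) < a} =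
     (\<Union>q\<in>{q::rat. q > 0 \<and> ennreal (of_rat q) < a}.
       {\<zeta> \<in> space borel. (\<integral>\<^sup>+ x. young_ext \<Phi> (H (x, \<zeta>) / ennreal (of_rat q)) \<partial>lborel) \<le> 1})"
    (is "?L = ?R")
  proof (intro equalityI subsetI)
    fix \<zeta> assume "\<zeta> \<in> ?L"
    then have *: "orlicz_norm \<Phi> (\<lambda>x. H (x, \<zeta>)) < a" by simp
    then obtain b where b: "orlicz_norm \<Phi> (\<lambda>x. H (x, \<zeta>)) < b" "b < a" using dense by blast
    then obtain l where l: "l > 0" "ennreal l < b" "(\<integral>\<^sup>+ x. young_ext \<Phi> (H (x, \<zeta>) / ennreal l) \<partial>lborel) \<le> 1"
      unfolding orlicz_norm_lborel Inf_less_iff by auto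
    have "\<exists>q::rat. l < of_rat q \<and> ennreal (of_rat q) < a"
    proof (cases a)
      case (real a')
      have "ennreal l < a" using l b by (meson less_trans)
      then have "l < a'" using real l by (simp add: ennreal_less_iff)
      then obtain q where "l < of_rat q" "of_rat q < a'" using of_rat_dense by blast
      then show ?thesis using real l by (intro exI[of _ q]) (auto intro!: ennreal_lessI)
    next
      case top
      obtain q where "l < of_rat q" "of_rat q < l + 1" using of_rat_dense[of l "l + 1"] by auto
      then show ?thesis using top by auto
    qed
    then obtain q :: rat where q: "l < of_rat q" "ennreal (of_rat q) < a" by blast
    have "orlicz_norm \<Phi> (\<lambda>x. H (x, \<zeta>)) < ennreal (of_rat q)"
      using orlicz_norm_le[OF l(1,3)] q l by (meson ennreal_less_iff le_less_trans less_imp_le)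
    from orlicz_norm_less[OF this \<Phi>] q l
    show "\<zeta> \<in> ?R" by (auto intro!: bexI[of _ q]) (metis less_trans zero_less_of_rat_iff)
  next
    fix \<zeta> assume "\<zeta> \<in> ?R"
    then obtain q :: rat where q: "q > 0" "ennreal (of_rat q) < a"
      "(\<integral>\<^sup>+ x. young_ext \<Phi> (H (x, \<zeta>) / ennreal (of_rat q)) \<partial>lborel) \<le> 1" by auto
    have "orlicz_norm \<Phi> (\<lambda>x. H (x, \<zeta>)) \<le> ennreal (of_rat q)"
      using q by (intro orlicz_norm_le) auto
    then show "\<zeta> \<in> ?L" using q by simp
  qed
  also have "\<dots> \<in> sets borel"
  proof (rule sets.countable_UN'[OF countableI_type], intro image_subsetI)
    fix q :: rat
    have "(\<lambda>p :: 'b \<times> 'a. (snd p, fst p)) \<in> borel \<Otimes>\<^sub>M lborel \<rightarrow>\<^sub>M borel"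
      unfolding borel_prod[symmetric] by measurable
    then have "(\<lambda>p. young_ext \<Phi> (H (snd p, fst p) / ennreal (of_rat q))) \<in>
        borel_measurable (borel \<Otimes>\<^sub>M lborel)"
      by (intro measurable_compose[OF _ young_ext_measurable[OF \<Phi>]] borel_measurable_divide_ennreal
          measurable_compose[OF _ H]) auto
    then have "(\<lambda>\<zeta>. \<integral>\<^sup>+ x. young_ext \<Phi> (H (x, \<zeta>) / ennreal (of_rat q)) \<partial>lborel) \<in> borel_measurable borel"
      by (intro lborel.borel_measurable_nn_integral) (simp add: split_beta')
    then show "{\<zeta> \<in> space borel. (\<integral>\<^sup>+ x. young_ext \<Phi> (H (x, \<zeta>) / ennreal (of_rat q)) \<partial>lborel) \<le> 1} \<in> sets borel"
      by (intro borel_measurable_le) auto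
  qed
  finally show "{\<zeta> \<in> space borel. orlicz_norm \<Phi> (\<lambda>x. H (x, \<zeta>)) < a} \<in> sets borel" .
qed

section \<open>Convolution and Minkowski inequalities\<close>

lemma ennreal_divide_eq_mult: "a > 0 \<Longrightarrow> s / ennreal a = ennreal (1 / a) * s"
  by (simp add: divide_ennreal_def inverse_ennreal mult.commute inverse_eq_divide)

lemma ennreal_divide_half:
  assumes "a > 0" shows "s / ennreal a / 2 = s / ennreal (2 * a)"
proof -
  have "s / ennreal a / ennreal 2 = ennreal (1 / 2) * (ennreal (1 / a) * s)"
    using assms by (simp only: ennreal_divide_eq_mult zero_less_numeral)
  also have "\<dots> = ennreal (1 / 2 * (1 / a)) * s"
    using assms by (subst ennreal_mult) (simp_all add: mult.assoc)
  also have "1 / 2 * (1 / a) = 1 / (2 * a)" by simp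
  also have "ennreal (1 / (2 * a)) * s = s / ennreal (2 * a)"
    using assms by (subst ennreal_divide_eq_mult) auto
  finally show ?thesis by simp
qed

lemma nn_integral_lborel_pair:
  fixes f :: "'a::euclidean_space \<times> 'b::euclidean_space \<Rightarrow> ennreal"
  assumes "f \<in> borel_measurable borel"
  shows "(\<integral>\<^sup>+p. f p \<partial>lborel) = (\<integral>\<^sup>+y. \<integral>\<^sup>+x. f (x, y) \<partial>lborel \<partial>lborel)"
proof -
  have "f \<in> borel_measurable (lborel \<Otimes>\<^sub>M lborel)" using assms by (simp add: lborel_prod)
  from lborel_pair.nn_integral_snd[OF this] show ?thesis by (simp add: lborel_prod)
qed

lemma nn_integral_kernel:
  fixes k :: "'a::euclidean_space \<Rightarrow> ennreal"
  assumes k: "k \<in> borel_measurable borel" "\<And>x. k (- x) = k x"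
  shows "(\<integral>\<^sup>+y. k (x - y) \<partial>lborel) = (\<integral>\<^sup>+y. k y \<partial>lborel)"
proof -
  have "k (x - y) = k (y - x)" for y using k(2)[of "x - y"] by simp
  then show ?thesis using nn_integral_lborel_shift[OF k(1), of x] by simp
qed

text \<open>Young's convolution inequality for a kernel of mass 1: Jensen's inequality with the
  density \<open>k (\<xi> - \<zeta>)\<close> in \<zeta> and Tonelli's theorem show that 2 C l is
  admissible for n whenever l is admissible for N. The 2 is the loss in Jensen's inequality.\<close>

lemma orlicz_norm_conv_le:
  fixes k N n :: "'a::euclidean_space \<Rightarrow> ennreal"
  assumes \<Phi>: "young \<Phi>" and k[measurable]: "k \<in> borel_measurable borel"
    and even: "\<And>x. k (- x) = k x" and k1: "(\<integral>\<^sup>+x. k x \<partial>lborel) = 1" and C: "C > 0"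
    and N[measurable]: "N \<in> borel_measurable borel"
    and n: "\<And>\<xi>. n \<xi> \<le> ennreal C * (\<integral>\<^sup>+\<zeta>. k (\<xi> - \<zeta>) * N \<zeta> \<partial>lborel)"
  shows "orlicz_norm \<Phi> n \<le> ennreal (2 * C) * orlicz_norm \<Phi> N"
proof -
  note [measurable] = young_ext_measurable[OF \<Phi>]
  \<comment> \<open>With the constant on the left, the right side is a bare infimum and the bound
    can be checked for each admissible l.\<close>
  have "ennreal (1 / (2 * C)) * orlicz_norm \<Phi> n \<le> orlicz_norm \<Phi> N"
    unfolding orlicz_norm_lborel[of \<Phi> N]
  proof (rule Inf_greatest, clarify)
    fix l :: real assume l: "l > 0" and adm: "(\<integral>\<^sup>+ x. young_ext \<Phi> (N x / ennreal l) \<partial>lborel) \<le> 1"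
    have "young_ext \<Phi> (n \<xi> / ennreal (2 * C * l)) \<le> (\<integral>\<^sup>+\<zeta>. k (\<xi> - \<zeta>) * young_ext \<Phi> (N \<zeta> / ennreal l) \<partial>lborel)" for \<xi>
    proof -
      have "n \<xi> / ennreal (C * l) \<le> ennreal (1 / (C * l)) * (ennreal C * (\<integral>\<^sup>+\<zeta>. k (\<xi> - \<zeta>) * N \<zeta> \<partial>lborel))"
        using C l n[of \<xi>] by (simp add: ennreal_divide_eq_mult mult_left_mono)
      also have "\<dots> = ennreal (1 / l) * (\<integral>\<^sup>+\<zeta>. k (\<xi> - \<zeta>) * N \<zeta> \<partial>lborel)"
        using C l by (simp add: mult.assoc[symmetric] ennreal_mult[symmetric])
      also have "\<dots> = (\<integral>\<^sup>+\<zeta>. ennreal (1 / l) * (k (\<xi> - \<zeta>) * N \<zeta>) \<partial>lborel)"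
        by (rule nn_integral_cmult[symmetric]) measurable
      also have "\<dots> = (\<integral>\<^sup>+\<zeta>. k (\<xi> - \<zeta>) * (N \<zeta> / ennreal l) \<partial>lborel)"
        using l by (simp add: ennreal_divide_eq_mult mult_ac)
      finally have "young_ext \<Phi> (n \<xi> / ennreal (C * l) / 2) \<le> (\<integral>\<^sup>+\<zeta>. k (\<xi> - \<zeta>) * young_ext \<Phi> (N \<zeta> / ennreal l) \<partial>lborel)"
        by (intro young_ext_nn_integral[OF \<Phi>]) (auto simp: nn_integral_kernel[OF k even] k1)
      also have "n \<xi> / ennreal (C * l) / 2 = n \<xi> / ennreal (2 * C * l)"
        using C l by (simp add: ennreal_divide_half mult.assoc)
      finally show ?thesis .
    qed
    then have "(\<integral>\<^sup>+\<xi>. young_ext \<Phi> (n \<xi> / ennreal (2 * C * l)) \<partial>lborel) \<le>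
        (\<integral>\<^sup>+\<xi>. \<integral>\<^sup>+\<zeta>. k (\<xi> - \<zeta>) * young_ext \<Phi> (N \<zeta> / ennreal l) \<partial>lborel \<partial>lborel)"
      by (rule nn_integral_mono)
    also have "\<dots> = (\<integral>\<^sup>+\<zeta>. \<integral>\<^sup>+\<xi>. k (\<xi> - \<zeta>) * young_ext \<Phi> (N \<zeta> / ennreal l) \<partial>lborel \<partial>lborel)"
      by (rule lborel_pair.Fubini') measurable
    also have "\<dots> = (\<integral>\<^sup>+\<zeta>. young_ext \<Phi> (N \<zeta> / ennreal l) \<partial>lborel)"
      by (simp add: nn_integral_multc nn_integral_lborel_shift k1)
    also note adm
    finally have "orlicz_norm \<Phi> n \<le> ennreal (2 * C * l)" using C l by (intro orlicz_norm_le) auto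
    then have "ennreal (1 / (2 * C)) * orlicz_norm \<Phi> n \<le> ennreal (1 / (2 * C)) * ennreal (2 * C * l)"
      by (rule mult_left_mono) simp
    also have "\<dots> = ennreal l" using C l by (simp add: ennreal_mult[symmetric])
    finally show "ennreal (1 / (2 * C)) * orlicz_norm \<Phi> n \<le> ennreal l" .
  qed
  then have "ennreal (2 * C) * (ennreal (1 / (2 * C)) * orlicz_norm \<Phi> n) \<le> ennreal (2 * C) * orlicz_norm \<Phi> N"
    by (rule mult_left_mono) simp
  then show ?thesis using C by (simp add: mult.assoc[symmetric] ennreal_mult[symmetric])
qed

text \<open>Minkowski's integral inequality without duality: the average over \<zeta> is taken with
  weights proportional to \<open>k (\<xi> - \<zeta>)\<close> times the norm of the slice, so that
  the slices enter normalized, and Jensen's inequality is applied to this average combined with the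
  convolution in z.\<close>

lemma orlicz_norm_minkowski:
  fixes k g :: "'a::euclidean_space \<Rightarrow> ennreal" and H :: "'a \<times> 'a \<Rightarrow> ennreal"
  assumes \<Phi>: "young \<Phi>" and k[measurable]: "k \<in> borel_measurable borel"
    and even: "\<And>x. k (- x) = k x" and k1: "(\<integral>\<^sup>+x. k x \<partial>lborel) = 1" and C: "C > 0"
    and H: "H \<in> borel_measurable borel"
    and g: "\<And>x. g x \<le> ennreal C * (\<integral>\<^sup>+\<zeta>. \<integral>\<^sup>+z. k (\<xi> - \<zeta>) * (k (x - z) * H (z, \<zeta>)) \<partial>lborel \<partial>lborel)"
  shows "orlicz_norm \<Phi> g \<le> ennreal (2 * C) * (\<integral>\<^sup>+\<zeta>. k (\<xi> - \<zeta>) * orlicz_norm \<Phi> (\<lambda>x. H (x, \<zeta>)) \<partial>lborel)"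
proof -
  note [measurable] = young_ext_measurable[OF \<Phi>]
  have H'[measurable]: "H \<in> borel_measurable (borel \<Otimes>\<^sub>M borel)" using H by (simp add: borel_prod)
  define N where "N = (\<lambda>\<zeta>. orlicz_norm \<Phi> (\<lambda>x. H (x, \<zeta>)))"
  have N[measurable]: "N \<in> borel_measurable borel"
    unfolding N_def by (rule orlicz_norm_measurable[OF \<Phi> H])
  define M where "M = (\<integral>\<^sup>+\<zeta>. k (\<xi> - \<zeta>) * N \<zeta> \<partial>lborel)"
  have w1: "(\<integral>\<^sup>+\<zeta>. k (\<xi> - \<zeta>) \<partial>lborel) = 1" by (simp add: nn_integral_kernel[OF k even] k1)
  have "orlicz_norm \<Phi> g \<le> ennreal (2 * C) * M"
  proof (cases M)
    case top
    then show ?thesis using C by (simp add: ennreal_mult_top)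
  next
    case (real m)
    have main: "orlicz_norm \<Phi> g \<le> ennreal (2 * C * (m + \<eta>))" if \<eta>: "\<eta> > 0" for \<eta>
    proof -
      define m' where "m' = m + \<eta>"
      have m': "m' > 0" using real \<eta> by (simp add: m'_def)
      \<comment> \<open>Adding \<eta> makes L strictly larger than a finite slice norm, hence
        admissible for the slice, and keeps the divisor away from 0.\<close>
      define L where "L = (\<lambda>\<zeta>. N \<zeta> + ennreal \<eta>)"
      have [measurable]: "L \<in> borel_measurable borel" unfolding L_def by measurable
      have wL: "(\<integral>\<^sup>+\<zeta>. k (\<xi> - \<zeta>) * L \<zeta> \<partial>lborel) = ennreal m'"
        unfolding L_def distrib_left using \<eta> real
        by (subst nn_integral_add) (auto simp: nn_integral_multc w1 M_def[symmetric] m'_def)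
      \<comment> \<open>Where L is infinite and the kernel positive, division and multiplication by
        L do not cancel; as the total mass is finite, this happens on a null set only.\<close>
      have fin: "AE \<zeta> in lborel. k (\<xi> - \<zeta>) * L \<zeta> \<noteq> top"
        using nn_integral_PInf_AE[of "\<lambda>\<zeta>. k (\<xi> - \<zeta>) * L \<zeta>" lborel] wL by simp
      have LH: "k (\<xi> - \<zeta>) * H (z, \<zeta>) = k (\<xi> - \<zeta>) * L \<zeta> * (H (z, \<zeta>) / L \<zeta>)"
        if "k (\<xi> - \<zeta>) * L \<zeta> \<noteq> top" for z \<zeta>
      proof (cases "L \<zeta>")
        case top
        then have "k (\<xi> - \<zeta>) = 0" using that by (auto simp: ennreal_mult_eq_top_iff)
        then show ?thesis by simp
      next
        case (real l)
        then have "l > 0" using \<eta> unfolding L_def by (metis add_increasing ennreal_eq_0_iff ennreal_le_iff2 ennreal_less_zero_iff le_zero_eq less_eq_real_def not_le zero_le)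
        then have "ennreal l * ennreal (1 / l) = 1" by (simp add: ennreal_mult[symmetric])
        then have "k (\<xi> - \<zeta>) * H (z, \<zeta>) = k (\<xi> - \<zeta>) * (ennreal l * ennreal (1 / l)) * H (z, \<zeta>)"
          by simp
        then show ?thesis by (simp only: real(2) ennreal_divide_eq_mult[OF \<open>l > 0\<close>] mult_ac)
      qed
      \<comment> \<open>A probability density in p = (z, \<zeta>) for every x. V is the function
        normalized slice by slice, and W V is the original integrand divided by m'.\<close>
      define W where "W = (\<lambda>x p. ennreal (1 / m') * (k (\<xi> - snd p) * L (snd p)) * k (x - fst p))"
      define V where "V = (\<lambda>p. H p / L (snd p))"
      have Vm: "V \<in> borel_measurable borel"
        unfolding V_def borel_prod[symmetric] by measurable
      have Wm2: "(\<lambda>(p, x). W x p) \<in> borel_measurable (borel \<Otimes>\<^sub>M borel)"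
        unfolding W_def borel_prod[symmetric, where ?'a = 'a and ?'b = 'a] by measurable
      have Wm: "W x \<in> borel_measurable borel" for x
        unfolding W_def borel_prod[symmetric] by measurable
      have W1: "(\<integral>\<^sup>+p. W x p \<partial>lborel) = 1" for x
      proof -
        have "(\<integral>\<^sup>+p. W x p \<partial>lborel) = (\<integral>\<^sup>+\<zeta>. ennreal (1 / m') * (k (\<xi> - \<zeta>) * L \<zeta>) \<partial>lborel)"
          unfolding nn_integral_lborel_pair[OF Wm] unfolding W_def
          by (simp add: nn_integral_cmult nn_integral_kernel[OF k even] k1)
        also have "\<dots> = ennreal (1 / m') * ennreal m'"
          by (simp add: nn_integral_cmult wL)
        also have "\<dots> = 1" using m' by (simp add: ennreal_mult[symmetric])
        finally show ?thesis .
      qed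
      have jensen: "young_ext \<Phi> (g x / ennreal (2 * C * m')) \<le> (\<integral>\<^sup>+p. W x p * young_ext \<Phi> (V p) \<partial>lborel)" for x
      proof -
        have "g x / ennreal (C * m') \<le> ennreal (1 / (C * m')) *
            (ennreal C * (\<integral>\<^sup>+\<zeta>. \<integral>\<^sup>+z. k (\<xi> - \<zeta>) * (k (x - z) * H (z, \<zeta>)) \<partial>lborel \<partial>lborel))"
          using C m' g[of x] by (simp add: ennreal_divide_eq_mult mult_left_mono)
        also have "\<dots> = ennreal (1 / m') * (\<integral>\<^sup>+\<zeta>. \<integral>\<^sup>+z. k (\<xi> - \<zeta>) * (k (x - z) * H (z, \<zeta>)) \<partial>lborel \<partial>lborel)"
          using C m' by (simp add: mult.assoc[symmetric] ennreal_mult[symmetric])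
        also have "\<dots> = (\<integral>\<^sup>+\<zeta>. \<integral>\<^sup>+z. ennreal (1 / m') * (k (\<xi> - \<zeta>) * (k (x - z) * H (z, \<zeta>))) \<partial>lborel \<partial>lborel)"
          by (simp add: nn_integral_cmult)
        also have "\<dots> = (\<integral>\<^sup>+\<zeta>. \<integral>\<^sup>+z. W x (z, \<zeta>) * V (z, \<zeta>) \<partial>lborel \<partial>lborel)"
        proof (rule nn_integral_cong_AE, use fin in eventually_elim)
          case (elim \<zeta>)
          show ?case
          proof (rule nn_integral_cong)
            fix z
            have "ennreal (1 / m') * (k (\<xi> - \<zeta>) * (k (x - z) * H (z, \<zeta>))) =
                ennreal (1 / m') * k (x - z) * (k (\<xi> - \<zeta>) * H (z, \<zeta>))" by (simp add: mult_ac)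
            also have "\<dots> = W x (z, \<zeta>) * V (z, \<zeta>)"
              unfolding LH[OF elim] W_def V_def by (simp add: mult_ac)
            finally show "ennreal (1 / m') * (k (\<xi> - \<zeta>) * (k (x - z) * H (z, \<zeta>))) = W x (z, \<zeta>) * V (z, \<zeta>)" .
          qed
        qed
        also have "\<dots> = (\<integral>\<^sup>+p. W x p * V p \<partial>lborel)"
          by (rule nn_integral_lborel_pair[symmetric]) (intro borel_measurable_times_ennreal Wm Vm)
        finally have "young_ext \<Phi> (g x / ennreal (C * m') / 2) \<le> (\<integral>\<^sup>+p. W x p * young_ext \<Phi> (V p) \<partial>lborel)"
          using Wm Vm by (intro young_ext_nn_integral[OF \<Phi>]) (auto simp: W1)
        also have "g x / ennreal (C * m') / 2 = g x / ennreal (2 * C * m')"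
          using C m' by (simp add: ennreal_divide_half mult.assoc)
        finally show ?thesis .
      qed
      \<comment> \<open>If the slice norm is infinite, V vanishes on the slice, because division by
        \<infinity> gives 0.\<close>
      have adm: "(\<integral>\<^sup>+z. young_ext \<Phi> (V (z, \<zeta>)) \<partial>lborel) \<le> 1" for \<zeta>
      proof (cases "N \<zeta>")
        case top
        then show ?thesis by (simp add: V_def L_def young_ext_0[OF \<Phi>])
      next
        case (real l)
        then have "N \<zeta> < L \<zeta>" using \<eta> by (simp add: L_def ennreal_less_iff flip: ennreal_plus)
        from orlicz_norm_less[OF this[unfolded N_def] \<Phi>] show ?thesis by (simp add: V_def)
      qed
      have VPm: "(\<lambda>p. young_ext \<Phi> (V p)) \<in> borel_measurable borel"
        by (rule measurable_compose[OF Vm young_ext_measurable[OF \<Phi>]])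
      have "(\<integral>\<^sup>+x. young_ext \<Phi> (g x / ennreal (2 * C * m')) \<partial>lborel) \<le>
          (\<integral>\<^sup>+x. \<integral>\<^sup>+p. W x p * young_ext \<Phi> (V p) \<partial>lborel \<partial>lborel)"
        by (intro nn_integral_mono jensen)
      also have "\<dots> = (\<integral>\<^sup>+p. \<integral>\<^sup>+x. W x p * young_ext \<Phi> (V p) \<partial>lborel \<partial>lborel)"
      proof (rule lborel_pair.Fubini')
        have "(\<lambda>q. W (snd q) (fst q) * young_ext \<Phi> (V (fst q))) \<in> borel_measurable (borel \<Otimes>\<^sub>M borel)"
          using Wm2 measurable_compose[OF measurable_fst VPm]
          by (intro borel_measurable_times_ennreal) (auto simp: split_beta')
        then show "(\<lambda>(p, x). W x p * young_ext \<Phi> (V p)) \<in> borel_measurable (lborel \<Otimes>\<^sub>M lborel)"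
          by (simp add: split_beta')
      qed
      also have "\<dots> = (\<integral>\<^sup>+p. ennreal (1 / m') * (k (\<xi> - snd p) * L (snd p)) * young_ext \<Phi> (V p) \<partial>lborel)"
        unfolding W_def by (simp add: nn_integral_multc nn_integral_cmult nn_integral_lborel_shift k1)
      also have "\<dots> = (\<integral>\<^sup>+\<zeta>. \<integral>\<^sup>+z. ennreal (1 / m') * (k (\<xi> - \<zeta>) * L \<zeta>) * young_ext \<Phi> (V (z, \<zeta>)) \<partial>lborel \<partial>lborel)"
      proof (subst nn_integral_lborel_pair)
        have "(\<lambda>p :: 'a \<times> 'a. ennreal (1 / m') * (k (\<xi> - snd p) * L (snd p))) \<in> borel_measurable borel"
          unfolding borel_prod[symmetric] by measurable
        then show "(\<lambda>p. ennreal (1 / m') * (k (\<xi> - snd p) * L (snd p)) * young_ext \<Phi> (V p)) \<in> borel_measurable borel"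
          by (rule borel_measurable_times_ennreal[OF _ VPm])
      qed simp
      also have "\<dots> = (\<integral>\<^sup>+\<zeta>. ennreal (1 / m') * (k (\<xi> - \<zeta>) * L \<zeta>) * (\<integral>\<^sup>+z. young_ext \<Phi> (V (z, \<zeta>)) \<partial>lborel) \<partial>lborel)"
      proof (intro nn_integral_cong nn_integral_cmult)
        fix \<zeta> :: 'a
        have "(\<lambda>z :: 'a. (z, \<zeta>)) \<in> borel \<rightarrow>\<^sub>M borel" unfolding borel_prod[symmetric] by measurable
        from measurable_compose[OF this VPm]
        show "(\<lambda>z. young_ext \<Phi> (V (z, \<zeta>))) \<in> borel_measurable lborel" by simp
      qed
      also have "\<dots> \<le> (\<integral>\<^sup>+\<zeta>. ennreal (1 / m') * (k (\<xi> - \<zeta>) * L \<zeta>) * 1 \<partial>lborel)"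
        by (intro nn_integral_mono mult_left_mono adm) auto
      also have "\<dots> = ennreal (1 / m') * ennreal m'" by (simp add: nn_integral_cmult wL)
      also have "\<dots> = 1" using m' by (simp add: ennreal_mult[symmetric])
      finally show ?thesis using C m' unfolding m'_def[symmetric] by (intro orlicz_norm_le) auto
    qed
    show ?thesis
    proof (rule ennreal_le_epsilon)
      fix e :: real assume e: "e > 0"
      have "orlicz_norm \<Phi> g \<le> ennreal (2 * C * (m + e / (2 * C)))" using e C by (intro main) auto
      also have "2 * C * (m + e / (2 * C)) = 2 * C * m + e" using C by (simp add: field_simps)
      also have "ennreal (2 * C * m + e) = ennreal (2 * C) * M + ennreal e"
        using real C e by (simp add: ennreal_mult)
      finally show "orlicz_norm \<Phi> g \<le> ennreal (2 * C) * M + ennreal e" .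
    qed
  qed
  then show ?thesis by (simp add: M_def N_def)
qed

text \<open>Passing to r-th powers turns both quasi-norms into functionals of Young functions;
  Minkowski's inequality in x and the convolution inequality in \<xi> each contribute a factor 2. H
  is a Borel measurable minorant of the weighted F, since the slices of the latter need not be
  measurable.\<close>

lemma mixed_orlicz_norm_le:
  fixes F G :: "'a::euclidean_space \<times> 'a \<Rightarrow> complex" and \<omega> H :: "'a \<times> 'a \<Rightarrow> real"
    and k :: "'a \<Rightarrow> ennreal"
  assumes "quasi_young r \<Phi>\<^sub>1" "quasi_young r \<Phi>\<^sub>2" and k: "k \<in> borel_measurable borel"
    and even: "\<And>x. k (- x) = k x" and k1: "(\<integral>\<^sup>+x. k x \<partial>lborel) = 1" and C: "C > 0"
    and H: "H \<in> borel_measurable borel" "\<And>p. 0 \<le> H p" "\<And>p. H p \<le> cmod (F p * of_real (\<omega> p))"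
    and G: "\<And>x \<xi>. ennreal (cmod (G (x, \<xi>) * of_real (\<omega> (x, \<xi>))) powr r) \<le>
       ennreal C * (\<integral>\<^sup>+\<zeta>. \<integral>\<^sup>+z. k (\<xi> - \<zeta>) * (k (x - z) * ennreal (H (z, \<zeta>) powr r)) \<partial>lborel \<partial>lborel)"
  shows "mixed_orlicz_norm \<Phi>\<^sub>1 \<Phi>\<^sub>2 \<omega> G \<le> ennreal ((4 * C) powr (1 / r)) * mixed_orlicz_norm \<Phi>\<^sub>1 \<Phi>\<^sub>2 \<omega> F"
proof -
  obtain Y1 Y2 where r: "r > 0" and Y: "young Y1" "young Y2"
    "\<And>t. t \<ge> 0 \<Longrightarrow> \<Phi>\<^sub>1 t = Y1 (t powr r)" "\<And>t. t \<ge> 0 \<Longrightarrow> \<Phi>\<^sub>2 t = Y2 (t powr r)"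
    using assms(1,2) unfolding quasi_young_def by blast
  have pY: "orlicz_norm Y1 (\<lambda>x. enn_powr (g x) r) = enn_powr (orlicz_norm \<Phi>\<^sub>1 g) r"
    "orlicz_norm Y2 (\<lambda>x. enn_powr (g x) r) = enn_powr (orlicz_norm \<Phi>\<^sub>2 g) r"
    for g :: "'a \<Rightarrow> ennreal"
    by (rule orlicz_norm_powr; use r Y in auto)+
  define n where "n = (\<lambda>F \<xi>. orlicz_norm \<Phi>\<^sub>1 (\<lambda>x. ennreal (cmod (F (x, \<xi>) * of_real (\<omega> (x, \<xi>))))))"
  define N where "N = (\<lambda>\<zeta>. orlicz_norm Y1 (\<lambda>z. ennreal (H (z, \<zeta>) powr r)))"
  have Hm: "(\<lambda>p. ennreal (H p powr r)) \<in> borel_measurable borel" using H(1) by measurable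
  have Nm: "N \<in> borel_measurable borel"
    unfolding N_def by (rule orlicz_norm_measurable[OF Y(1) Hm])
  have pn: "enn_powr (n F \<xi>) r = orlicz_norm Y1 (\<lambda>x. ennreal (cmod (F (x, \<xi>) * of_real (\<omega> (x, \<xi>))) powr r))" for F \<xi>
    by (simp add: n_def pY(1)[symmetric] enn_powr_ennreal)
  have nG: "enn_powr (n G \<xi>) r \<le> ennreal (2 * C) * (\<integral>\<^sup>+\<zeta>. k (\<xi> - \<zeta>) * N \<zeta> \<partial>lborel)" for \<xi>
    unfolding pn N_def by (rule orlicz_norm_minkowski[OF Y(1) k even k1 C Hm G])
  have nF: "N \<zeta> \<le> enn_powr (n F \<zeta>) r" for \<zeta>
    unfolding pn N_def using H(2,3) r by (intro orlicz_norm_mono[OF Y(1)] ennreal_leI powr_mono2) auto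
  have m: "enn_powr (mixed_orlicz_norm \<Phi>\<^sub>1 \<Phi>\<^sub>2 \<omega> F) r = orlicz_norm Y2 (\<lambda>\<xi>. enn_powr (n F \<xi>) r)" for F
    by (simp add: mixed_orlicz_norm_def n_def pY(2))
  have "enn_powr (mixed_orlicz_norm \<Phi>\<^sub>1 \<Phi>\<^sub>2 \<omega> G) r \<le> ennreal (2 * (2 * C)) * orlicz_norm Y2 N"
    unfolding m by (rule orlicz_norm_conv_le[OF Y(2) k even k1 _ Nm nG]) (use C in auto)
  also have "\<dots> \<le> ennreal (4 * C) * enn_powr (mixed_orlicz_norm \<Phi>\<^sub>1 \<Phi>\<^sub>2 \<omega> F) r"
    unfolding m using nF by (intro mult_mono orlicz_norm_mono[OF Y(2)]) auto
  also have "\<dots> = enn_powr (ennreal ((4 * C) powr (1 / r)) * mixed_orlicz_norm \<Phi>\<^sub>1 \<Phi>\<^sub>2 \<omega> F) r"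
    using C r by (simp add: enn_powr_mult powr_powr)
  finally have "enn_powr (enn_powr (mixed_orlicz_norm \<Phi>\<^sub>1 \<Phi>\<^sub>2 \<omega> G) r) (1 / r) \<le>
      enn_powr (enn_powr (ennreal ((4 * C) powr (1 / r)) * mixed_orlicz_norm \<Phi>\<^sub>1 \<Phi>\<^sub>2 \<omega> F) r) (1 / r)"
    by (rule enn_powr_mono) (use r in auto)
  then show ?thesis using r by (simp add: enn_powr_inverse)
qed

section \<open>Powers of functions dominated by their own convolutions\<close>

text \<open>The supremum \<open>N\<close> over \<open>Y\<close> of \<open>F Y exp (- A |X - Y|)\<close> absorbs the factor \<open>F powr (1 - r)\<close>:
  \<open>N \<le> C N powr (1 - r) J\<close> with \<open>J\<close> the integral on the right, whence \<open>N powr r \<le> C J\<close> if \<open>N\<close> is finite.\<close>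

lemma maximal_bound:
  fixes F G :: "'a::euclidean_space \<Rightarrow> real" and C A r :: real
  assumes F0: "\<And>X. F X \<ge> 0" and Fm[measurable]: "F \<in> borel_measurable borel"
    and r: "0 < r" "r \<le> 1" and A: "A > 0" and C: "C \<ge> 0"
    and F: "\<And>X. ennreal (F X) \<le> ennreal C * (\<integral>\<^sup>+Y. ennreal (exp (- (A * norm (X - Y))) * F Y) \<partial>lborel)"
    and fin: "\<And>Y. F Y * exp (- (A * norm (X - Y))) \<le> K"
    and G0: "\<And>X. G X \<ge> 0"
    and G: "\<And>X. ennreal (G X) \<le> ennreal C * (\<integral>\<^sup>+Y. ennreal (exp (- (A * norm (X - Y))) * F Y) \<partial>lborel)"
  shows "ennreal (G X powr r) \<le> ennreal C * (\<integral>\<^sup>+Y. ennreal (exp (- (r * A * norm (X - Y))) * F Y powr r) \<partial>lborel)"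
proof -
  define N where "N = (SUP Y. F Y * exp (- (A * norm (X - Y))))"
  have bdd: "bdd_above (range (\<lambda>Y. F Y * exp (- (A * norm (X - Y)))))"
    using fin by (auto intro!: bdd_aboveI[of _ K])
  have N: "F Y * exp (- (A * norm (X - Y))) \<le> N" for Y
    unfolding N_def by (rule cSUP_upper[OF _ bdd]) simp
  have N0: "N \<ge> 0" using N[of X] F0[of X] by (meson exp_ge_zero mult_nonneg_nonneg order_trans)
  define J where "J = (\<integral>\<^sup>+Y. ennreal (exp (- (r * A * norm (X - Y))) * F Y powr r) \<partial>lborel)"
  have I: "(\<integral>\<^sup>+Y. ennreal (exp (- (A * norm (X - Y))) * F Y) \<partial>lborel) \<le> ennreal (N powr (1 - r)) * J"
  proof -
    \<comment> \<open>The power 1 - r of F Y exp (- A |X - Y|) is bounded by means of N, and only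
      the power r stays under the integral; this produces the rate r A.\<close>
    have "exp (- (A * norm (X - Y))) * F Y \<le> N powr (1 - r) * (exp (- (r * A * norm (X - Y))) * F Y powr r)" for Y
    proof (cases "F Y = 0")
      case False
      let ?m = "F Y * exp (- (A * norm (X - Y)))"
      have m: "?m > 0" using False F0[of Y] by simp
      have "?m = ?m powr (1 - r) * ?m powr r" using m by (simp add: powr_add[symmetric])
      also have "\<dots> \<le> N powr (1 - r) * ?m powr r"
        using N[of Y] m r by (intro mult_right_mono powr_mono2) auto
      also have "?m powr r = exp (- (r * A * norm (X - Y))) * F Y powr r"
        using F0[of Y] by (simp add: powr_mult powr_def[of "exp _"] mult_ac)
      finally show ?thesis by (simp add: mult.commute)
    qed simp
    then have "(\<integral>\<^sup>+Y. ennreal (exp (- (A * norm (X - Y))) * F Y) \<partial>lborel) \<le>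
        (\<integral>\<^sup>+Y. ennreal (N powr (1 - r)) * ennreal (exp (- (r * A * norm (X - Y))) * F Y powr r) \<partial>lborel)"
      by (intro nn_integral_mono) (simp add: ennreal_mult[symmetric])
    also have "\<dots> = ennreal (N powr (1 - r)) * J"
      unfolding J_def by (rule nn_integral_cmult) measurable
    finally show ?thesis .
  qed
  show ?thesis
  proof (cases "J = top \<and> C > 0")
    case True
    then show ?thesis by (simp add: J_def[symmetric] ennreal_mult_top)
  next
    case nottop: False
    show ?thesis
    proof (cases "C = 0 \<or> N = 0")
      case True
      have "ennreal (G X) \<le> 0"
      proof (cases "C = 0")
        case True then show ?thesis using G[of X] by simp
      next
        case False
        then have "N = 0" using True by simp
        then have "ennreal (N powr (1 - r)) * J = 0" by simp
        with I have "(\<integral>\<^sup>+Y. ennreal (exp (- (A * norm (X - Y))) * F Y) \<partial>lborel) = 0" by simp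
        then show ?thesis using G[of X] by simp
      qed
      then have "G X = 0" using G0[of X] by simp
      then show ?thesis using r by simp
    next
      case False
      then have C0: "C > 0" and Npos: "N > 0" using C N0 by auto
      then obtain j where j: "j \<ge> 0" "J = ennreal j" using nottop by (cases J) auto
      have b: "(\<integral>\<^sup>+Y. ennreal (exp (- (A * norm (X - Y))) * F Y) \<partial>lborel) \<le> ennreal (N powr (1 - r) * j)"
        using I j by (simp add: ennreal_mult)
      \<comment> \<open>Estimating F W by the convolution around W and using |X - Y| \<le> |X - W| +
        |W - Y| brings the integral back to the centre X, so that the bound is uniform in W and
        passes to the supremum N.\<close>
      have "F W * exp (- (A * norm (X - W))) \<le> C * (N powr (1 - r) * j)" for W
      proof -
        have "ennreal (F W * exp (- (A * norm (X - W)))) =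
            ennreal (exp (- (A * norm (X - W)))) * ennreal (F W)"
          by (simp add: ennreal_mult F0 mult.commute)
        also have "\<dots> \<le> ennreal (exp (- (A * norm (X - W)))) *
            (ennreal C * (\<integral>\<^sup>+Y. ennreal (exp (- (A * norm (W - Y))) * F Y) \<partial>lborel))"
          by (intro mult_left_mono F) simp
        also have "\<dots> = ennreal C * (ennreal (exp (- (A * norm (X - W)))) *
            (\<integral>\<^sup>+Y. ennreal (exp (- (A * norm (W - Y))) * F Y) \<partial>lborel))"
          by (simp add: mult_ac)
        also have "ennreal (exp (- (A * norm (X - W)))) *
            (\<integral>\<^sup>+Y. ennreal (exp (- (A * norm (W - Y))) * F Y) \<partial>lborel) =
            (\<integral>\<^sup>+Y. ennreal (exp (- (A * norm (X - W)))) * ennreal (exp (- (A * norm (W - Y))) * F Y) \<partial>lborel)"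
          by (rule nn_integral_cmult[symmetric]) measurable
        also have "\<dots> \<le> (\<integral>\<^sup>+Y. ennreal (exp (- (A * norm (X - Y))) * F Y) \<partial>lborel)"
        proof (rule nn_integral_mono)
          fix Y
          have "norm (X - Y) \<le> norm (X - W) + norm (W - Y)"
            using norm_triangle_ineq[of "X - W" "W - Y"] by simp
          then have "A * norm (X - Y) \<le> A * norm (X - W) + A * norm (W - Y)"
            using A by (metis distrib_left mult_left_mono less_imp_le)
          then have "exp (- (A * norm (X - W))) * exp (- (A * norm (W - Y))) \<le> exp (- (A * norm (X - Y)))"
            by (simp add: exp_add[symmetric])
          then show "ennreal (exp (- (A * norm (X - W)))) * ennreal (exp (- (A * norm (W - Y))) * F Y)
              \<le> ennreal (exp (- (A * norm (X - Y))) * F Y)"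
            using F0[of Y] mult_right_mono[OF _ F0[of Y]]
            by (simp add: ennreal_mult[symmetric] mult.assoc[symmetric])
        qed
        also note b
        finally have "ennreal (F W * exp (- (A * norm (X - W)))) \<le> ennreal (C * (N powr (1 - r) * j))"
          using C0 by (simp add: ennreal_mult mult_left_mono j)
        then show ?thesis using C0 j by (simp add: ennreal_le_iff)
      qed
      then have "N \<le> C * (N powr (1 - r) * j)"
        unfolding N_def by (intro cSUP_least) auto
      then have "N powr (1 - r) * N powr r \<le> N powr (1 - r) * (C * j)"
        using Npos by (simp add: powr_add[symmetric] mult_ac)
      \<comment> \<open>N is finite and positive here, so the power 1 - r cancels.\<close>
      then have NC: "N powr r \<le> C * j" using Npos by simp
      have "ennreal (G X) \<le> ennreal (C * (N powr (1 - r) * j))"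
        using order_trans[OF G[of X] mult_left_mono[OF b]] C0 j by (simp add: ennreal_mult)
      then have "G X \<le> C * j * N powr (1 - r)" using C0 j by (simp add: ennreal_le_iff mult_ac)
      \<comment> \<open>The bound on N powr r is inserted with the exponent (1 - r) / r; with the
        explicit factor \<open>C * j\<close> the exponents add up to 1 / r.\<close>
      also have "N powr (1 - r) = (N powr r) powr ((1 - r) / r)" using r by (simp add: powr_powr)
      also have "\<dots> \<le> (C * j) powr ((1 - r) / r)"
        using NC r by (intro powr_mono2) auto
      finally have "G X \<le> C * j * (C * j) powr ((1 - r) / r)"
        using C0 j by (simp add: mult_left_mono)
      also have "\<dots> = (C * j) powr (1 / r)"
      proof (cases "C * j = 0")
        case False
        then have "C * j > 0" using C0 j by simp
        then have "C * j * (C * j) powr ((1 - r) / r) = (C * j) powr (1 + (1 - r) / r)"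
          by (simp add: powr_add)
        also have "1 + (1 - r) / r = 1 / r" using r by (simp add: field_simps)
        finally show ?thesis .
      qed auto
      finally have "G X powr r \<le> ((C * j) powr (1 / r)) powr r"
        using r G0 by (intro powr_mono2) auto
      also have "\<dots> = C * j" using r C0 j by (simp add: powr_powr)
      finally have "ennreal (G X powr r) \<le> ennreal (C * j)" by (rule ennreal_leI)
      then show ?thesis unfolding J_def[symmetric] using j C0 by (simp add: ennreal_mult)
    qed
  qed
qed

text \<open>The growth bound on \<open>F\<close> only serves to make the supremum finite, first for a rate depending
  on \<open>F\<close> and then for \<open>A\<close> itself; the constant therefore does not depend on it.\<close>

lemma powr_kernel_bound:
  fixes F G :: "'a::euclidean_space \<Rightarrow> real" and C :: "real \<Rightarrow> real" and A r :: real
  assumes F0: "\<And>X. F X \<ge> 0" and Fm[measurable]: "F \<in> borel_measurable borel"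
    and r: "0 < r" "r \<le> 1" and A: "A > 0" and C: "\<And>a. C a \<ge> 0"
    and F: "\<And>a X. a > 0 \<Longrightarrow> ennreal (F X) \<le> ennreal (C a) * (\<integral>\<^sup>+Y. ennreal (exp (- (a * norm (X - Y))) * F Y) \<partial>lborel)"
    and G0: "\<And>X. G X \<ge> 0"
    and G: "\<And>a X. a > 0 \<Longrightarrow> ennreal (G X) \<le> ennreal (C a) * (\<integral>\<^sup>+Y. ennreal (exp (- (a * norm (X - Y))) * F Y) \<partial>lborel)"
    and growth: "\<And>Y. F Y \<le> K * exp (B * norm Y)"
  shows "ennreal (G X powr r) \<le> ennreal (C A) * (\<integral>\<^sup>+Y. ennreal (exp (- (r * A * norm (X - Y))) * F Y powr r) \<partial>lborel)"
proof (cases "C A > 0 \<and> (\<integral>\<^sup>+Y. ennreal (exp (- (r * A * norm (X - Y))) * F Y powr r) \<partial>lborel) = top")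
  case True
  then show ?thesis by (simp add: ennreal_mult_top)
next
  case False
  define J where "J = (\<integral>\<^sup>+Y. ennreal (exp (- (r * A * norm (X - Y))) * F Y powr r) \<partial>lborel)"
  have K: "K \<ge> 0"
    using order_trans[OF F0 growth[of 0]] by simp
  show ?thesis
  proof (cases "C A = 0")
    case True
    then have "G X = 0" using G[OF A, of X] G0[of X] by simp
    then show ?thesis using r by simp
  next
    case CA: False
    then obtain j where j: "j \<ge> 0" "J = ennreal j" using False C[of A] unfolding J_def[symmetric]
      by (cases J) auto
    \<comment> \<open>At this rate the kernel beats the growth of F, so the supremum is finite
      around every centre.\<close>
    define A' where "A' = max A \<bar>B\<bar>"
    have A': "A' > 0" "A' \<ge> A" "A' \<ge> \<bar>B\<bar>" using A by (auto simp: A'_def)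
    have fin': "F Y * exp (- (A' * norm (W - Y))) \<le> K * exp (\<bar>B\<bar> * norm W)" for Y W
    proof -
      have "F Y * exp (- (A' * norm (W - Y))) \<le> K * exp (B * norm Y) * exp (- (A' * norm (W - Y)))"
        by (intro mult_right_mono growth) simp
      also have "\<dots> = K * exp (B * norm Y - A' * norm (W - Y))" by (simp add: exp_diff exp_minus divide_inverse)
      also have "\<dots> \<le> K * exp (\<bar>B\<bar> * norm W)"
      proof -
        have "B * norm Y \<le> \<bar>B\<bar> * norm Y" by (intro mult_right_mono) auto
        also have "\<dots> \<le> \<bar>B\<bar> * (norm W + norm (W - Y))"
          using norm_triangle_sub[of Y W] by (intro mult_left_mono) (auto simp: norm_minus_commute)
        also have "\<dots> \<le> \<bar>B\<bar> * norm W + A' * norm (W - Y)"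
          unfolding distrib_left using A' by (intro add_left_mono mult_right_mono) auto
        finally show ?thesis using K by (intro mult_left_mono) auto
      qed
      finally show ?thesis .
    qed
    have m': "ennreal (F Y powr r) \<le> ennreal (C A') * (\<integral>\<^sup>+Z. ennreal (exp (- (r * A' * norm (Y - Z))) * F Z powr r) \<partial>lborel)" for Y
      by (rule maximal_bound[OF F0 Fm r A'(1) C F[OF A'(1)] fin' F0 F[OF A'(1)]])
    \<comment> \<open>The estimate at the rate A' bounds the r-th power of F Y by an integral
      centred at Y, and the factor exp (- r A |X - Y|) moves the centre to X. As J is finite, so is
      the supremum for the rate A.\<close>
    have "(F Y * exp (- (A * norm (X - Y)))) powr r \<le> C A' * j" for Y
    proof -
      have "ennreal ((F Y * exp (- (A * norm (X - Y)))) powr r) =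
          ennreal (exp (- (r * A * norm (X - Y)))) * ennreal (F Y powr r)"
        using F0[of Y] by (simp add: powr_mult ennreal_mult[symmetric] powr_def[of "exp _"] mult_ac)
      also have "\<dots> \<le> ennreal (exp (- (r * A * norm (X - Y)))) *
          (ennreal (C A') * (\<integral>\<^sup>+Z. ennreal (exp (- (r * A' * norm (Y - Z))) * F Z powr r) \<partial>lborel))"
        by (intro mult_left_mono m') simp
      also have "\<dots> = ennreal (C A') * (ennreal (exp (- (r * A * norm (X - Y)))) *
          (\<integral>\<^sup>+Z. ennreal (exp (- (r * A' * norm (Y - Z))) * F Z powr r) \<partial>lborel))"
        by (simp add: mult_ac)
      also have "ennreal (exp (- (r * A * norm (X - Y)))) *
          (\<integral>\<^sup>+Z. ennreal (exp (- (r * A' * norm (Y - Z))) * F Z powr r) \<partial>lborel) =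
          (\<integral>\<^sup>+Z. ennreal (exp (- (r * A * norm (X - Y)))) * ennreal (exp (- (r * A' * norm (Y - Z))) * F Z powr r) \<partial>lborel)"
        by (rule nn_integral_cmult[symmetric]) measurable
      also have "\<dots> \<le> J"
        unfolding J_def
      proof (rule nn_integral_mono)
        fix Z
        have "norm (X - Z) \<le> norm (X - Y) + norm (Y - Z)"
          using norm_triangle_ineq[of "X - Y" "Y - Z"] by simp
        then have "r * A * norm (X - Z) \<le> r * A * norm (X - Y) + r * A * norm (Y - Z)"
          using A r by (metis distrib_left mult_left_mono less_imp_le mult_pos_pos)
        also have "\<dots> \<le> r * A * norm (X - Y) + r * A' * norm (Y - Z)"
          using A' r by (intro add_left_mono mult_right_mono mult_left_mono) auto
        finally have "exp (- (r * A * norm (X - Y))) * exp (- (r * A' * norm (Y - Z))) \<le> exp (- (r * A * norm (X - Z)))"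
          by (simp add: exp_add[symmetric])
        then show "ennreal (exp (- (r * A * norm (X - Y)))) * ennreal (exp (- (r * A' * norm (Y - Z))) * F Z powr r)
            \<le> ennreal (exp (- (r * A * norm (X - Z))) * F Z powr r)"
          using mult_right_mono[of _ _ "F Z powr r"]
          by (simp add: ennreal_mult[symmetric] mult.assoc[symmetric])
      qed
      finally have "ennreal ((F Y * exp (- (A * norm (X - Y)))) powr r) \<le> ennreal (C A' * j)"
        using j C[of A'] by (simp add: ennreal_mult mult_left_mono)
      then show ?thesis using j C[of A'] by (simp add: ennreal_le_iff)
    qed
    then have "((F Y * exp (- (A * norm (X - Y)))) powr r) powr (1 / r) \<le> (C A' * j) powr (1 / r)" for Y
      using r by (intro powr_mono2) auto
    then have "\<bar>F Y * exp (- (A * norm (X - Y)))\<bar> \<le> (C A' * j) powr (1 / r)" for Y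
      using r by (simp add: powr_powr)
    then have fin: "F Y * exp (- (A * norm (X - Y))) \<le> (C A' * j) powr (1 / r)" for Y
      using abs_ge_self order_trans by blast
    show ?thesis
      by (rule maximal_bound[OF F0 Fm r A C F[OF A] fin G0 G[OF A]])
  qed
qed

section \<open>Fourier inversion\<close>

text \<open>The norm dominates every coordinate, so with d the dimension the function is at most a
  product of one-dimensional exponentials of rate a / d. Up to a factor, each of these is bounded by
  an exponential density plus its reflection.\<close>

lemma integrable_exp_norm:
  fixes a :: real
  assumes a: "a > 0"
  shows "integrable lborel (\<lambda>x :: 'a::euclidean_space. exp (- (a * norm x)))"
proof (rule integrableI_bounded)
  define c where "c = a / DIM('a)"
  have c: "c > 0" using a by (simp add: c_def)
  have E1: "(\<integral>\<^sup>+t. ennreal (exponential_density c t) \<partial>lborel) = 1"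
    using prob_space.emeasure_space_1[OF prob_space_exponential_density[OF c]]
    by (simp add: emeasure_density)
  have E2: "(\<integral>\<^sup>+t. ennreal (exponential_density c (- t)) \<partial>lborel) = 1"
    using nn_integral_real_affine[of "\<lambda>t. ennreal (exponential_density c t)" "-1" 0] E1 by simp
  have "(\<integral>\<^sup>+t. ennreal (exp (- (c * \<bar>t\<bar>))) \<partial>lborel) \<le>
      (\<integral>\<^sup>+t. ennreal (1 / c) * (ennreal (exponential_density c t) + ennreal (exponential_density c (- t))) \<partial>lborel)"
  proof (rule nn_integral_mono)
    fix t :: real
    have "exp (- (c * \<bar>t\<bar>)) \<le> 1 / c * (exponential_density c t + exponential_density c (- t))"
      using c by (auto simp: exponential_density_def field_simps)
    then have "ennreal (exp (- (c * \<bar>t\<bar>))) \<le> ennreal (1 / c * (exponential_density c t + exponential_density c (- t)))"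
      by (rule ennreal_leI)
    also have "\<dots> = ennreal (1 / c) * (ennreal (exponential_density c t) + ennreal (exponential_density c (- t)))"
      unfolding ennreal_plus[OF exponential_density_nonneg[OF c] exponential_density_nonneg[OF c], symmetric]
      using c by (intro ennreal_mult add_nonneg_nonneg exponential_density_nonneg) auto
    finally show "ennreal (exp (- (c * \<bar>t\<bar>))) \<le> \<dots>" .
  qed
  also have "\<dots> = ennreal (1 / c) * 2"
    by (simp add: nn_integral_cmult nn_integral_add E1 E2)
  also have "\<dots> < top" by (simp add: ennreal_mult_less_top)
  finally have fin: "(\<integral>\<^sup>+t. ennreal (exp (- (c * \<bar>t\<bar>))) \<partial>lborel) < top" .
  have "(\<integral>\<^sup>+(x::'a). ennreal (norm (exp (- (a * norm x)))) \<partial>lborel) \<le>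
      (\<integral>\<^sup>+(x::'a). (\<Prod>b\<in>Basis. ennreal (exp (- (c * \<bar>x \<bullet> b\<bar>)))) \<partial>lborel)"
  proof (rule nn_integral_mono)
    fix x :: 'a
    have "(\<Sum>b\<in>Basis. c * \<bar>x \<bullet> b\<bar>) \<le> (\<Sum>b\<in>(Basis::'a set). c * norm x)"
      using c by (intro sum_mono mult_left_mono Basis_le_norm) auto
    also have "\<dots> = a * norm x" by (simp add: c_def)
    finally have "exp (- (a * norm x)) \<le> (\<Prod>b\<in>Basis. exp (- (c * \<bar>x \<bullet> b\<bar>)))"
      by (simp add: exp_sum[symmetric] sum_negf)
    then show "ennreal (norm (exp (- (a * norm x)))) \<le> (\<Prod>b\<in>Basis. ennreal (exp (- (c * \<bar>x \<bullet> b\<bar>))))"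
      by (simp add: prod_ennreal ennreal_leI)
  qed
  also have "\<dots> = (\<Prod>b\<in>(Basis::'a set). (\<integral>\<^sup>+t. ennreal (exp (- (c * \<bar>t\<bar>))) \<partial>lborel))"
    by (rule nn_integral_lborel_prod) auto
  also have "\<dots> < \<infinity>" using fin by (simp add: power_less_top_ennreal)
  finally show "(\<integral>\<^sup>+(x::'a). ennreal (norm (exp (- (a * norm x)))) \<partial>lborel) < \<infinity>" .
qed measurable

lemma lborel_affine_euclidean_integral:
  fixes f :: "'a::euclidean_space \<Rightarrow> complex" and t :: 'a
  assumes f[measurable]: "f \<in> borel_measurable borel" and c: "c \<noteq> 0"
  shows "(\<integral>x. f x \<partial>lborel) = of_real (\<bar>c\<bar> ^ DIM('a)) * (\<integral>x. f (t + c *\<^sub>R x) \<partial>lborel)"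
    and "integrable lborel f \<longleftrightarrow> integrable lborel (\<lambda>x. f (t + c *\<^sub>R x))"
proof -
  let ?D = "density (distr lborel borel (\<lambda>x. t + c *\<^sub>R x)) (\<lambda>_. ennreal (\<bar>c\<bar> ^ DIM('a)))"
  have D: "lborel = ?D" by (rule lborel_affine[OF c])
  have "(\<integral>x. f x \<partial>?D) = (\<integral>x. (\<bar>c\<bar> ^ DIM('a)) *\<^sub>R f x \<partial>distr lborel borel (\<lambda>x. t + c *\<^sub>R x))"
    by (subst integral_density) auto
  also have "\<dots> = (\<integral>x. (\<bar>c\<bar> ^ DIM('a)) *\<^sub>R f (t + c *\<^sub>R x) \<partial>lborel)"
    by (subst integral_distr) auto
  also have "\<dots> = of_real (\<bar>c\<bar> ^ DIM('a)) * (\<integral>x. f (t + c *\<^sub>R x) \<partial>lborel)"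
    by (simp add: scaleR_conv_of_real)
  finally show "(\<integral>x. f x \<partial>lborel) = of_real (\<bar>c\<bar> ^ DIM('a)) * (\<integral>x. f (t + c *\<^sub>R x) \<partial>lborel)"
    using D by simp
  have "integrable ?D f \<longleftrightarrow> integrable lborel (\<lambda>x. (\<bar>c\<bar> ^ DIM('a)) *\<^sub>R f (t + c *\<^sub>R x))"
    by (subst integrable_density) (auto simp: integrable_distr_eq)
  also have "\<dots> \<longleftrightarrow> integrable lborel (\<lambda>x. f (t + c *\<^sub>R x))"
  proof
    assume "integrable lborel (\<lambda>x. (\<bar>c\<bar> ^ DIM('a)) *\<^sub>R f (t + c *\<^sub>R x))"
    then have "integrable lborel (\<lambda>x. inverse (\<bar>c\<bar> ^ DIM('a)) *\<^sub>R (\<bar>c\<bar> ^ DIM('a)) *\<^sub>R f (t + c *\<^sub>R x))"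
      by (rule integrable_scaleR_right)
    moreover have "inverse (\<bar>c\<bar> ^ DIM('a)) *\<^sub>R (\<bar>c\<bar> ^ DIM('a)) *\<^sub>R z = z" for z :: complex
      using c by simp
    ultimately show "integrable lborel (\<lambda>x. f (t + c *\<^sub>R x))" by (simp only:)
  qed (rule integrable_scaleR_right)
  finally show "integrable lborel f \<longleftrightarrow> integrable lborel (\<lambda>x. f (t + c *\<^sub>R x))" using D by simp
qed

lemma integrable_lborel_pair_mult:
  fixes f :: "'a::euclidean_space \<times> 'b::euclidean_space \<Rightarrow> complex" and a :: "'a \<Rightarrow> real" and b :: "'b \<Rightarrow> real"
  assumes [measurable]: "f \<in> borel_measurable (lborel \<Otimes>\<^sub>M lborel)"
    and a: "integrable lborel a" and b: "integrable lborel b"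
    and le: "\<And>x y. cmod (f (x, y)) \<le> a x * b y" and pos: "\<And>x. 0 \<le> a x" "\<And>y. 0 \<le> b y"
  shows "integrable (lborel \<Otimes>\<^sub>M lborel) f"
proof (rule integrableI_bounded)
  have [measurable]: "a \<in> borel_measurable borel" "b \<in> borel_measurable borel"
    using borel_measurable_integrable[OF a] borel_measurable_integrable[OF b] by simp_all
  have "(\<integral>\<^sup>+p. ennreal (cmod (f p)) \<partial>(lborel \<Otimes>\<^sub>M lborel)) = (\<integral>\<^sup>+x. \<integral>\<^sup>+y. ennreal (cmod (f (x, y))) \<partial>lborel \<partial>lborel)"
    by (rule lborel.nn_integral_fst[symmetric]) measurable
  also have "\<dots> \<le> (\<integral>\<^sup>+x. \<integral>\<^sup>+y. ennreal (a x) * ennreal (b y) \<partial>lborel \<partial>lborel)"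
    using le pos by (intro nn_integral_mono) (simp add: ennreal_mult[symmetric] ennreal_leI)
  also have "\<dots> = (\<integral>\<^sup>+x. ennreal (a x) \<partial>lborel) * (\<integral>\<^sup>+y. ennreal (b y) \<partial>lborel)"
    by (simp add: nn_integral_cmult nn_integral_multc)
  also have "\<dots> < \<infinity>"
    using a b pos by (simp add: nn_integral_eq_integral ennreal_mult_less_top)
  finally show "(\<integral>\<^sup>+p. ennreal (norm (f p)) \<partial>(lborel \<Otimes>\<^sub>M lborel)) < \<infinity>" .
qed measurable

text \<open>The product form is the one to which the characteristic function of the one-dimensional
  normal distribution applies.\<close>

definition gauss_density :: "'a::euclidean_space \<Rightarrow> real" where
  "gauss_density x = (\<Prod>b\<in>Basis. std_normal_density (x \<bullet> b))"

lemma gauss_density_eq: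
  "gauss_density (x :: 'a::euclidean_space) = (1 / sqrt (2 * pi)) ^ DIM('a) * exp (- ((norm x)\<^sup>2 / 2))"
proof -
  have n: "(norm x)\<^sup>2 = (\<Sum>b\<in>Basis. (x \<bullet> b)\<^sup>2)"
    unfolding power2_norm_eq_inner euclidean_inner[of x x] by (simp add: power2_eq_square)
  show ?thesis
    unfolding gauss_density_def n std_normal_density_def prod.distrib
    by (simp add: exp_sum[symmetric] sum_negf sum_divide_distrib)
qed

lemma gauss_density_fourier:
  fixes w :: "'a::euclidean_space"
  shows "integrable lborel (\<lambda>\<xi> :: 'a. gauss_density \<xi>)"
    and "(\<integral>\<xi>. of_real (gauss_density \<xi>) * cis (w \<bullet> \<xi>) \<partial>lborel) = of_real (exp (- ((norm w)\<^sup>2 / 2)))"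
proof -
  interpret P: product_sigma_finite "\<lambda>_ :: 'a. lborel :: real measure" ..
  let ?T = "\<lambda>f. \<Sum>b\<in>(Basis :: 'a set). f b *\<^sub>R b"
  have Tm: "?T \<in> (\<Pi>\<^sub>M b\<in>Basis. lborel) \<rightarrow>\<^sub>M borel" by measurable
  define f where "f = (\<lambda>b t. complex_of_real (std_normal_density t) * cis ((w \<bullet> b) * t))"
  have fi: "integrable lborel (f b)" for b
    unfolding f_def
  proof (rule Bochner_Integration.integrable_bound[OF integrable_normal_density[of 1 0]])
    have [measurable]: "cis \<in> borel_measurable borel"
      by (intro borel_measurable_continuous_onI continuous_intros)
    show "(\<lambda>t. complex_of_real (std_normal_density t) * cis ((w \<bullet> b) * t)) \<in> borel_measurable lborel"
      by measurable
  qed (auto simp: norm_mult)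
  have f1: "(\<integral>t. f b t \<partial>lborel) = of_real (exp (- ((w \<bullet> b)\<^sup>2 / 2)))" for b
  proof -
    have "char std_normal_distribution (w \<bullet> b) = (\<integral>t. std_normal_density t *\<^sub>R iexp ((w \<bullet> b) * t) \<partial>lborel)"
      unfolding char_def by (subst integral_density) auto
    also have "\<dots> = (\<integral>t. f b t \<partial>lborel)"
      by (simp add: f_def scaleR_conv_of_real cis_conv_exp)
    finally show ?thesis by (simp add: char_std_normal_distribution)
  qed
  have eq: "of_real (gauss_density \<xi>) * cis (w \<bullet> \<xi>) = (\<Prod>b\<in>Basis. f b (\<xi> \<bullet> b))" for \<xi> :: 'a
  proof -
    have "cis (w \<bullet> \<xi>) = (\<Prod>b\<in>Basis. cis ((w \<bullet> b) * (\<xi> \<bullet> b)))"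
      unfolding euclidean_inner[of w \<xi>] cis_conv_exp by (simp add: exp_sum[symmetric] sum_distrib_left)
    then show ?thesis by (simp add: gauss_density_def f_def prod.distrib)
  qed
  have comp: "(\<Prod>b\<in>Basis. f b (?T x \<bullet> b)) = (\<Prod>b\<in>Basis. f b (x b))" for x :: "'a \<Rightarrow> real"
    by (intro prod.cong) auto
  have Fm: "(\<lambda>\<xi> :: 'a. \<Prod>b\<in>Basis. f b (\<xi> \<bullet> b)) \<in> borel_measurable borel"
  proof (intro borel_measurable_prod)
    fix b :: 'a
    have "f b \<in> borel_measurable borel" using borel_measurable_integrable[OF fi[of b]] by simp
    then show "(\<lambda>\<xi>. f b (\<xi> \<bullet> b)) \<in> borel_measurable borel" by measurable
  qed
  have "(\<integral>\<xi>. (\<Prod>b\<in>Basis. f b (\<xi> \<bullet> b)) \<partial>lborel) =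
      (\<integral>x. (\<Prod>b\<in>Basis. f b (x b)) \<partial>(\<Pi>\<^sub>M b\<in>Basis. lborel))"
    by (subst lborel_eq) (simp only: integral_distr[OF Tm Fm] comp)
  also have "\<dots> = (\<Prod>b\<in>Basis. \<integral>t. f b t \<partial>lborel)"
    by (rule P.product_integral_prod) (auto intro: fi)
  also have "\<dots> = of_real (\<Prod>b\<in>Basis. exp (- ((w \<bullet> b)\<^sup>2 / 2)))" by (simp add: f1)
  also have "(\<Prod>b\<in>Basis. exp (- ((w \<bullet> b)\<^sup>2 / 2))) = exp (- ((norm w)\<^sup>2 / 2))"
  proof -
    have n: "(norm w)\<^sup>2 = (\<Sum>b\<in>Basis. (w \<bullet> b)\<^sup>2)"
      unfolding power2_norm_eq_inner euclidean_inner[of w w] by (simp add: power2_eq_square)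
    show ?thesis unfolding n by (simp add: exp_sum[symmetric] sum_negf sum_divide_distrib)
  qed
  finally show "(\<integral>\<xi>. of_real (gauss_density \<xi>) * cis (w \<bullet> \<xi>) \<partial>lborel) = of_real (exp (- ((norm w)\<^sup>2 / 2)))"
    unfolding eq .
  have gm: "(\<lambda>\<xi>::'a. gauss_density \<xi>) \<in> borel_measurable borel" unfolding gauss_density_def by measurable
  show "integrable lborel (\<lambda>\<xi> :: 'a. gauss_density \<xi>)"
  proof (rule integrableI_nonneg)
    have "(\<integral>\<^sup>+(\<xi>::'a). ennreal (gauss_density \<xi>) \<partial>lborel) = (\<integral>\<^sup>+(\<xi>::'a). (\<Prod>b\<in>Basis. ennreal (std_normal_density (\<xi> \<bullet> b))) \<partial>lborel)"
      by (simp add: gauss_density_def prod_ennreal normal_density_nonneg)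
    also have "\<dots> = (\<Prod>b\<in>(Basis::'a set). \<integral>\<^sup>+t. ennreal (std_normal_density t) \<partial>lborel)"
      by (rule nn_integral_lborel_prod) auto
    also have "\<dots> < \<infinity>"
      by (simp add: nn_integral_eq_integral integrable_normal_density normal_density_nonneg)
    finally show "(\<integral>\<^sup>+(\<xi>::'a). ennreal (gauss_density \<xi>) \<partial>lborel) < \<infinity>" .
  qed (use gm in \<open>auto simp: gauss_density_def normal_density_nonneg prod_nonneg\<close>)
qed

text \<open>Gaussian regularization: the factor \<open>p (c *\<^sub>R \<xi>)\<close> makes Fubini's
  theorem applicable, the inner integral becomes a rescaled Gaussian centred at y, and both sides
  converge as c tends to 0. Integrability of the transform dominates one side, boundedness of G the
  other.\<close>

lemma fourier_inversion:
  fixes G :: "'a::euclidean_space \<Rightarrow> complex"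
  assumes cont: "continuous_on UNIV G" and int: "integrable lborel G" and bd: "\<And>x. cmod (G x) \<le> B"
    and hat: "integrable lborel (\<lambda>\<xi>. \<integral>z. G z * cis (z \<bullet> \<xi>) \<partial>lborel)"
  shows "(\<integral>\<xi>. (\<integral>z. G z * cis (z \<bullet> \<xi>) \<partial>lborel) * cis (- (y \<bullet> \<xi>)) \<partial>lborel) = of_real ((2 * pi) ^ DIM('a)) * G y"
proof -
  define p :: "'a \<Rightarrow> real" where "p = gauss_density"
  define \<gamma> :: "'a \<Rightarrow> real" where "\<gamma> w = exp (- ((norm w)\<^sup>2 / 2))" for w
  define k where "k = (1 / sqrt (2 * pi)) ^ DIM('a)"
  have k: "k > 0" by (simp add: k_def)
  have pg: "p w = k * \<gamma> w" for w by (simp add: p_def \<gamma>_def k_def gauss_density_eq)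
  have pi': "integrable lborel p" unfolding p_def by (rule gauss_density_fourier(1))
  have pF: "(\<integral>\<xi>. of_real (p \<xi>) * cis (w \<bullet> \<xi>) \<partial>lborel) = of_real (\<gamma> w)" for w
    unfolding p_def \<gamma>_def by (rule gauss_density_fourier(2))
  have \<gamma>1: "\<gamma> w \<le> 1" and \<gamma>0: "\<gamma> w \<ge> 0" for w by (simp_all add: \<gamma>_def)
  have \<gamma>c: "continuous_on UNIV \<gamma>" unfolding \<gamma>_def by (auto intro!: continuous_intros)
  have [measurable]: "\<gamma> \<in> borel_measurable borel" by (rule borel_measurable_continuous_onI[OF \<gamma>c])
  have [measurable]: "p \<in> borel_measurable borel" using borel_measurable_integrable[OF pi'] by simp
  have [measurable]: "G \<in> borel_measurable borel" by (rule borel_measurable_continuous_onI[OF cont])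
  have cism[measurable]: "cis \<in> borel_measurable borel"
    by (intro borel_measurable_continuous_onI continuous_intros)
  have \<gamma>i: "integrable lborel \<gamma>"
  proof -
    have "\<gamma> = (\<lambda>w. (1 / k) * p w)" using k by (auto simp: pg)
    then show ?thesis using pi' by simp
  qed
  have \<gamma>I: "(\<integral>w. complex_of_real (\<gamma> w) \<partial>lborel) = of_real (1 / k)"
  proof -
    have "(\<integral>w. complex_of_real (p w) \<partial>lborel) = 1" using pF[of 0] by (simp add: \<gamma>_def)
    then have "of_real k * (\<integral>w. complex_of_real (\<gamma> w) \<partial>lborel) = 1" by (simp add: pg)
    then show ?thesis using k by (simp add: field_simps)
  qed
  have \<gamma>R: "(\<integral>w. \<gamma> w \<partial>lborel) = 1 / k"
    using \<gamma>I unfolding integral_complex_of_real by (simp only: of_real_eq_iff)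
  have g0: "\<gamma> 0 = 1" by (simp add: \<gamma>_def)
  define Gh where "Gh \<xi> = (\<integral>z. G z * cis (z \<bullet> \<xi>) \<partial>lborel)" for \<xi>
  have Ghi: "integrable lborel Gh" using hat by (simp add: Gh_def[abs_def])
  have [measurable]: "Gh \<in> borel_measurable borel" using borel_measurable_integrable[OF Ghi] by simp
  have main: "(\<integral>\<xi>. Gh \<xi> * cis (- (y \<bullet> \<xi>)) * of_real (p (c *\<^sub>R \<xi>)) \<partial>lborel) = (\<integral>w. G (y + c *\<^sub>R w) * of_real (\<gamma> w) \<partial>lborel)"
    if c: "c > 0" for c :: real
  proof -
    let ?cd = "complex_of_real (\<bar>c\<bar> ^ DIM('a))"
    have cd: "?cd \<noteq> 0" using c by simp
    have pc: "integrable lborel (\<lambda>\<xi>. complex_of_real (p (c *\<^sub>R \<xi>)))"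
      using lborel_affine_euclidean_integral(2)[of "\<lambda>\<xi>. complex_of_real (p \<xi>)" c 0] c pi' by simp
    have pc': "integrable lborel (\<lambda>\<xi>. p (c *\<^sub>R \<xi>))" using integrable_Re[OF pc] by simp
    have "(\<integral>\<xi>. Gh \<xi> * cis (- (y \<bullet> \<xi>)) * of_real (p (c *\<^sub>R \<xi>)) \<partial>lborel) =
        (\<integral>\<xi>. \<integral>z. G z * cis (z \<bullet> \<xi>) * (cis (- (y \<bullet> \<xi>)) * of_real (p (c *\<^sub>R \<xi>))) \<partial>lborel \<partial>lborel)"
      unfolding Gh_def integral_mult_left_zero by (simp only: mult.assoc)
    also have "\<dots> = (\<integral>z. \<integral>\<xi>. G z * cis (z \<bullet> \<xi>) * (cis (- (y \<bullet> \<xi>)) * of_real (p (c *\<^sub>R \<xi>))) \<partial>lborel \<partial>lborel)"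
    proof (rule lborel_pair.Fubini_integral, rule integrable_lborel_pair_mult[OF _ integrable_norm[OF int] pc'])
      show "(\<lambda>(z, \<xi>). G z * cis (z \<bullet> \<xi>) * (cis (- (y \<bullet> \<xi>)) * of_real (p (c *\<^sub>R \<xi>)))) \<in> borel_measurable (lborel \<Otimes>\<^sub>M lborel)"
        by measurable
    qed (auto simp: norm_mult pg k less_imp_le \<gamma>0)
    also have "\<dots> = (\<integral>z. G z * (of_real (\<gamma> ((1 / c) *\<^sub>R (z - y))) / ?cd) \<partial>lborel)"
    proof (rule Bochner_Integration.integral_cong[OF refl])
      fix z
      have "of_real (\<gamma> ((1 / c) *\<^sub>R (z - y))) = (\<integral>\<eta>. of_real (p \<eta>) * cis (((1 / c) *\<^sub>R (z - y)) \<bullet> \<eta>) \<partial>lborel)"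
        by (rule pF[symmetric])
      also have "\<dots> = ?cd * (\<integral>\<xi>. of_real (p (0 + c *\<^sub>R \<xi>)) * cis (((1 / c) *\<^sub>R (z - y)) \<bullet> (0 + c *\<^sub>R \<xi>)) \<partial>lborel)"
        by (rule lborel_affine_euclidean_integral(1)) (use c in auto)
      also have "\<dots> = ?cd * (\<integral>\<xi>. of_real (p (c *\<^sub>R \<xi>)) * cis ((z - y) \<bullet> \<xi>) \<partial>lborel)"
      proof -
        have "((1 / c) *\<^sub>R (z - y)) \<bullet> (0 + c *\<^sub>R \<xi>) = (z - y) \<bullet> \<xi>" for \<xi>
          unfolding add_0_left inner_scaleR_left inner_scaleR_right using c by simp
        then show ?thesis by (simp only: add_0_left)
      qed
      finally have e: "(\<integral>\<xi>. of_real (p (c *\<^sub>R \<xi>)) * cis ((z - y) \<bullet> \<xi>) \<partial>lborel) = of_real (\<gamma> ((1 / c) *\<^sub>R (z - y))) / ?cd"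
        using nonzero_mult_div_cancel_left[OF cd] by metis
      have "(\<integral>\<xi>. G z * cis (z \<bullet> \<xi>) * (cis (- (y \<bullet> \<xi>)) * of_real (p (c *\<^sub>R \<xi>))) \<partial>lborel) =
          (\<integral>\<xi>. G z * (of_real (p (c *\<^sub>R \<xi>)) * cis ((z - y) \<bullet> \<xi>)) \<partial>lborel)"
      proof (rule Bochner_Integration.integral_cong[OF refl])
        fix \<xi>
        have "cis ((z - y) \<bullet> \<xi>) = cis (z \<bullet> \<xi>) * cis (- (y \<bullet> \<xi>))"
          unfolding cis_mult by (simp add: inner_diff_left)
        then show "G z * cis (z \<bullet> \<xi>) * (cis (- (y \<bullet> \<xi>)) * of_real (p (c *\<^sub>R \<xi>))) = G z * (of_real (p (c *\<^sub>R \<xi>)) * cis ((z - y) \<bullet> \<xi>))"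
          by (simp add: mult_ac)
      qed
      also have "\<dots> = G z * (of_real (\<gamma> ((1 / c) *\<^sub>R (z - y))) / ?cd)"
        by (simp add: e)
      finally show "(\<integral>\<xi>. G z * cis (z \<bullet> \<xi>) * (cis (- (y \<bullet> \<xi>)) * of_real (p (c *\<^sub>R \<xi>))) \<partial>lborel) = \<dots>" .
    qed
    also have "\<dots> = ?cd * (\<integral>w. G (y + c *\<^sub>R w) * (of_real (\<gamma> ((1 / c) *\<^sub>R ((y + c *\<^sub>R w) - y))) / ?cd) \<partial>lborel)"
      by (rule lborel_affine_euclidean_integral(1)) (use c in auto)
    also have "\<dots> = (\<integral>w. G (y + c *\<^sub>R w) * of_real (\<gamma> w) \<partial>lborel)"
      using c cd by simp
    finally show ?thesis .
  qed
  let ?c = "\<lambda>n. inverse (real (Suc n))"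
  have c0: "?c \<longlonglongrightarrow> 0" by (rule LIMSEQ_inverse_real_of_nat)
  have L1: "(\<lambda>n. \<integral>\<xi>. Gh \<xi> * cis (- (y \<bullet> \<xi>)) * of_real (p (?c n *\<^sub>R \<xi>)) \<partial>lborel)
      \<longlonglongrightarrow> (\<integral>\<xi>. Gh \<xi> * cis (- (y \<bullet> \<xi>)) * of_real (p (0 *\<^sub>R \<xi>)) \<partial>lborel)"
  proof (rule integral_dominated_convergence[where w = "\<lambda>\<xi>. k * cmod (Gh \<xi>)"])
    show "AE \<xi> in lborel. (\<lambda>n. Gh \<xi> * cis (- (y \<bullet> \<xi>)) * of_real (p (?c n *\<^sub>R \<xi>))) \<longlonglongrightarrow> Gh \<xi> * cis (- (y \<bullet> \<xi>)) * of_real (p (0 *\<^sub>R \<xi>))"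
    proof (rule AE_I2)
      fix \<xi>
      have "(\<lambda>n. \<gamma> (?c n *\<^sub>R \<xi>)) \<longlonglongrightarrow> \<gamma> (0 *\<^sub>R \<xi>)"
        by (rule continuous_on_tendsto_compose[OF \<gamma>c tendsto_scaleR[OF c0 tendsto_const]]) auto
      then show "(\<lambda>n. Gh \<xi> * cis (- (y \<bullet> \<xi>)) * of_real (p (?c n *\<^sub>R \<xi>))) \<longlonglongrightarrow> Gh \<xi> * cis (- (y \<bullet> \<xi>)) * of_real (p (0 *\<^sub>R \<xi>))"
        unfolding pg by (intro tendsto_intros)
    qed
    show "integrable lborel (\<lambda>\<xi>. k * cmod (Gh \<xi>))" using Ghi by simp
    show "AE \<xi> in lborel. cmod (Gh \<xi> * cis (- (y \<bullet> \<xi>)) * of_real (p (?c n *\<^sub>R \<xi>))) \<le> k * cmod (Gh \<xi>)" for n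
    proof (rule AE_I2)
      fix \<xi>
      have "p (?c n *\<^sub>R \<xi>) \<le> k" using k \<gamma>1[of "?c n *\<^sub>R \<xi>"] by (simp add: pg)
      moreover have "p (?c n *\<^sub>R \<xi>) \<ge> 0" using k \<gamma>0[of "?c n *\<^sub>R \<xi>"] by (simp add: pg)
      ultimately show "cmod (Gh \<xi> * cis (- (y \<bullet> \<xi>)) * of_real (p (?c n *\<^sub>R \<xi>))) \<le> k * cmod (Gh \<xi>)"
        using mult_left_mono[of "p (?c n *\<^sub>R \<xi>)" k "cmod (Gh \<xi>)"] by (simp add: norm_mult mult.commute)
    qed
  qed measurable
  have L2: "(\<lambda>n. \<integral>w. G (y + ?c n *\<^sub>R w) * of_real (\<gamma> w) \<partial>lborel) \<longlonglongrightarrow> (\<integral>w. G (y + 0 *\<^sub>R w) * of_real (\<gamma> w) \<partial>lborel)"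
  proof (rule integral_dominated_convergence[where w = "\<lambda>w. B * \<gamma> w"])
    show "AE w in lborel. (\<lambda>n. G (y + ?c n *\<^sub>R w) * of_real (\<gamma> w)) \<longlonglongrightarrow> G (y + 0 *\<^sub>R w) * of_real (\<gamma> w)"
    proof (rule AE_I2)
      fix w
      have "(\<lambda>n. G (y + ?c n *\<^sub>R w)) \<longlonglongrightarrow> G (y + 0 *\<^sub>R w)"
        by (rule continuous_on_tendsto_compose[OF cont tendsto_add[OF tendsto_const tendsto_scaleR[OF c0 tendsto_const]]]) auto
      then show "(\<lambda>n. G (y + ?c n *\<^sub>R w) * of_real (\<gamma> w)) \<longlonglongrightarrow> G (y + 0 *\<^sub>R w) * of_real (\<gamma> w)"
        by (intro tendsto_intros)
    qed
    show "integrable lborel (\<lambda>w. B * \<gamma> w)" using \<gamma>i by simp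
    show "AE w in lborel. cmod (G (y + ?c n *\<^sub>R w) * of_real (\<gamma> w)) \<le> B * \<gamma> w" for n
      using bd \<gamma>0 by (auto simp: norm_mult mult_right_mono)
  qed measurable
  have e: "(\<integral>\<xi>. Gh \<xi> * cis (- (y \<bullet> \<xi>)) * of_real (p (?c n *\<^sub>R \<xi>)) \<partial>lborel) = (\<integral>w. G (y + ?c n *\<^sub>R w) * of_real (\<gamma> w) \<partial>lborel)" for n
    by (rule main) simp
  have "(\<integral>\<xi>. Gh \<xi> * cis (- (y \<bullet> \<xi>)) * of_real (p (0 *\<^sub>R \<xi>)) \<partial>lborel) = (\<integral>w. G (y + 0 *\<^sub>R w) * of_real (\<gamma> w) \<partial>lborel)"
    by (rule LIMSEQ_unique[OF L1[unfolded e] L2])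
  then have "(\<integral>\<xi>. Gh \<xi> * cis (- (y \<bullet> \<xi>)) \<partial>lborel) * of_real k = G y * of_real (1 / k)"
    by (simp add: pg g0 \<gamma>R)
  then have "(\<integral>\<xi>. Gh \<xi> * cis (- (y \<bullet> \<xi>)) \<partial>lborel) = of_real (1 / (k * k)) * G y"
    using k by (simp add: field_simps)
  \<comment> \<open>One factor k is the value p 0, the other the reciprocal of the integral of
    \<gamma>; with d the dimension, both are (2 \<pi>)^(-d/2).\<close>
  also have "1 / (k * k) = (2 * pi) ^ DIM('a)"
  proof -
    have "1 / sqrt (2 * pi) * (1 / sqrt (2 * pi)) = 1 / (2 * pi)" by simp
    then have "k * k = (1 / (2 * pi)) ^ DIM('a)" unfolding k_def power_mult_distrib[symmetric] by (simp only:)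
    then show ?thesis by (simp add: power_divide)
  qed
  finally show ?thesis by (simp add: Gh_def)
qed

section \<open>Decay of Fourier transforms\<close>

lemma smooth_borel_measurable: "smooth f \<Longrightarrow> f \<in> borel_measurable borel"
  by (rule borel_measurable_continuous_onI[OF smooth_continuous])

lemma cis_borel_measurable [measurable]: "cis \<in> borel_measurable borel"
  by (intro borel_measurable_continuous_onI continuous_intros)

lemma continuous_AE_zero:
  fixes f :: "'a::euclidean_space \<Rightarrow> complex"
  assumes f: "continuous_on UNIV f" and ae: "AE x in lebesgue. f x = 0"
  shows "f = (\<lambda>_. 0)"
proof -
  have op: "open {x. f x \<noteq> 0}" by (rule open_Collect_neq[OF f continuous_on_const])
  have S: "{x. f x \<noteq> 0} \<in> sets lebesgue" using borel_open[OF op] by (simp add: sets_completionI_sets)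
  then have "{x. f x \<noteq> 0} \<in> null_sets lebesgue"
    using ae by (subst (asm) AE_iff_measurable[OF S]) auto
  then have "negligible {x. f x \<noteq> 0}" by (simp add: negligible_iff_null_sets)
  then have "{x. f x \<noteq> 0} = {}" using open_not_negligible[OF op] by blast
  then show ?thesis by auto
qed

lemma gs_bound_integrable:
  assumes "smooth f" "gs_bound h a C f" "a > 0"
  shows "integrable lborel f"
  using gs_boundD[OF assms(2), of "[]"] smooth_borel_measurable[OF assms(1)]
  by (intro Bochner_Integration.integrable_bound[OF integrable_mult_right[OF integrable_exp_norm[OF assms(3)], of C]])
    (auto intro!: AE_I2 order_trans[OF _ abs_ge_self])

lemma fact_add_le: "fact (m + n) \<le> (2 ^ (m + n) * (fact m * fact n) :: real)"
proof -
  have "real ((m + n) choose m) \<le> real (2 ^ (m + n))"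
    using binomial_le_pow2 of_nat_le_iff by blast
  moreover have "(fact (m + n) :: real) = (fact m * fact n) * real ((m + n) choose m)"
    by (simp add: binomial_fact)
  ultimately show ?thesis by (simp add: mult.commute mult_right_mono)
qed

text \<open>The inequality (m + n)! \<le> 2^(m + n) m! n! separates the derivatives already taken
  from further ones, at the cost of doubling h.\<close>

lemma gs_bound_iter_partial:
  fixes g :: "real^'n::finite \<Rightarrow> complex"
  assumes b: "gs_bound h a C g" and h: "h > 0"
  shows "\<exists>D. gs_bound (2 * h) a D (iter_partial js g)"
proof
  have C: "C \<ge> 0" by (rule gs_bound_nonneg[OF b])
  let ?m = "length js"
  show "gs_bound (2 * h) a (C * ((2 * h) ^ ?m * fact ?m)) (iter_partial js g)"
    unfolding gs_bound_def
  proof (intro allI)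
    fix "is" :: "'n list" and x
    let ?n = "length is"
    have "cmod (iter_partial is (iter_partial js g) x) \<le> C * (h ^ (?n + ?m) * fact (?n + ?m)) * exp (- (a * norm x))"
      using gs_boundD[OF b, of "is @ js" x] by (simp add: iter_partial_append)
    also have "\<dots> \<le> C * (h ^ (?n + ?m) * (2 ^ (?n + ?m) * (fact ?n * fact ?m))) * exp (- (a * norm x))"
      using C h fact_add_le by (intro mult_right_mono mult_left_mono) auto
    also have "\<dots> = C * ((2 * h) ^ ?m * fact ?m) * ((2 * h) ^ ?n * fact ?n) * exp (- (a * norm x))"
      by (simp add: power_add power_mult_distrib mult_ac)
    finally show "cmod (iter_partial is (iter_partial js g) x) \<le> \<dots>" .
  qed
qed

text \<open>Dominated convergence works with sequences, so derivatives are used as limits of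
  difference quotients along a null sequence.\<close>

lemma has_vector_derivative_seq:
  fixes f :: "real \<Rightarrow> complex"
  assumes f: "(f has_vector_derivative D) (at 0)" and t: "t \<longlonglongrightarrow> 0" "\<And>n. t n \<noteq> 0"
  shows "(\<lambda>n. (f (t n) - f 0) / of_real (t n)) \<longlonglongrightarrow> D"
proof -
  have "((\<lambda>y. norm ((f y - f 0) - (y - 0) *\<^sub>R D) / norm (y - 0)) \<longlongrightarrow> 0) (at 0)"
    using f unfolding has_vector_derivative_def has_derivative_at by simp
  moreover have "filterlim t (at 0) sequentially"
    unfolding filterlim_at using t by (auto intro!: always_eventually)
  ultimately have "(\<lambda>n. norm ((f (t n) - f 0) - (t n - 0) *\<^sub>R D) / norm (t n - 0)) \<longlonglongrightarrow> 0"
    by (rule filterlim_compose)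
  moreover have "norm ((f (t n) - f 0) - (t n - 0) *\<^sub>R D) / norm (t n - 0) = norm ((f (t n) - f 0) / of_real (t n) - D)" for n
  proof -
    have "(f (t n) - f 0) / of_real (t n) - D = ((f (t n) - f 0) - (t n - 0) *\<^sub>R D) / of_real (t n)"
      using t(2)[of n] by (simp add: field_simps scaleR_conv_of_real)
    then show ?thesis using t(2)[of n] by (simp add: norm_divide)
  qed
  ultimately have "(\<lambda>n. norm ((f (t n) - f 0) / of_real (t n) - D)) \<longlonglongrightarrow> 0" by simp
  then show ?thesis by (simp add: tendsto_norm_zero_iff Lim_null[symmetric])
qed

text \<open>Translation invariance takes the place of integration by parts: the difference quotient
  of G is moved onto the character, and both quotients converge, the first one under the integral by
  dominated convergence.\<close>

lemma fourier_partial: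
  fixes G :: "real^'n::finite \<Rightarrow> complex"
  assumes G: "smooth G" and b: "gs_bound h 1 C G" and h: "h > 0"
  shows "(\<integral>y. partial j G y * cis (y \<bullet> \<xi>) \<partial>lborel) = - \<i> * of_real (\<xi> $ j) * (\<integral>y. G y * cis (y \<bullet> \<xi>) \<partial>lborel)"
proof -
  let ?t = "\<lambda>n. inverse (real (Suc n))"
  let ?I = "\<integral>y. G y * cis (y \<bullet> \<xi>) \<partial>lborel"
  let ?e = "axis j 1 :: real^'n"
  have t0: "?t \<longlonglongrightarrow> 0" by (rule LIMSEQ_inverse_real_of_nat)
  have [measurable]: "G \<in> borel_measurable borel" "partial j G \<in> borel_measurable borel"
    by (intro smooth_borel_measurable G smooth_partial)+
  have Gi: "integrable lborel (\<lambda>y. G y * cis (y \<bullet> \<xi>))"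
    by (rule Bochner_Integration.integrable_bound[OF gs_bound_integrable[OF G b]]) (auto simp: norm_mult)
  \<comment> \<open>exp 1 accounts for translations by at most 1, and 2 h appears because the
    Lipschitz bound for translations starts from half of its parameter.\<close>
  define K where "K = real CARD('n) * C * (2 * h) * exp 1"
  have C: "C \<ge> 0" by (rule gs_bound_nonneg[OF b])
  have dq': "cmod ((G (y + t *\<^sub>R ?e) - G y) / of_real t) \<le> K * exp (- (1 * norm y))" if t: "0 < t" "t \<le> 1" for t y
  proof -
    let ?x = "- (t *\<^sub>R ?e)"
    have nx: "norm ?x = t" using t by simp
    have b': "gs_bound (2 * h / 2) 1 C G" using b by simp
    have "cmod (G (y - ?x) - G (y - 0)) \<le> real CARD('n) * C * (2 * h) * exp (1 * (norm ?x + norm (0 :: real^'n))) * norm (?x - 0) * exp (- (1 * norm y))"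
      using gs_boundD[OF gs_bound_shift_diff[OF G b', of ?x 0], of "[]" y] h by simp
    also have "\<dots> \<le> real CARD('n) * C * (2 * h) * exp 1 * norm (?x - 0) * exp (- (1 * norm y))"
      using C h t unfolding nx by (intro mult_right_mono mult_left_mono) auto
    finally have "cmod (G (y - ?x) - G (y - 0)) \<le> K * exp (- (1 * norm y)) * t"
      using t by (simp add: K_def mult_ac)
    then show ?thesis using t by (simp add: norm_divide pos_divide_le_eq)
  qed
  have dq: "cmod ((G (y + ?t n *\<^sub>R ?e) - G y) / of_real (?t n)) \<le> K * exp (- (1 * norm y))" for n y
    by (rule dq') (auto simp: inverse_le_1_iff)
  have L1: "(\<lambda>n. \<integral>y. (G (y + ?t n *\<^sub>R ?e) - G y) / of_real (?t n) * cis (y \<bullet> \<xi>) \<partial>lborel) \<longlonglongrightarrow>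
      (\<integral>y. partial j G y * cis (y \<bullet> \<xi>) \<partial>lborel)"
  proof (rule integral_dominated_convergence[where w = "\<lambda>y. K * exp (- (1 * norm y))"])
    show "integrable lborel (\<lambda>y :: real^'n. K * exp (- (1 * norm y)))"
      by (intro integrable_mult_right integrable_exp_norm) simp
    show "AE y in lborel. (\<lambda>n. (G (y + ?t n *\<^sub>R ?e) - G y) / of_real (?t n) * cis (y \<bullet> \<xi>)) \<longlonglongrightarrow> partial j G y * cis (y \<bullet> \<xi>)"
    proof (intro AE_I2 tendsto_mult tendsto_const)
      fix y
      have "((\<lambda>t. G (y + t *\<^sub>R ?e)) has_vector_derivative partial j G y) (at 0)"
        using partial_has_vector_derivative[OF smooth_differentiable[OF G], of y j 0] by simp
      from has_vector_derivative_seq[OF this t0]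
      show "(\<lambda>n. (G (y + ?t n *\<^sub>R ?e) - G y) / of_real (?t n)) \<longlonglongrightarrow> partial j G y" by simp
    qed
    show "AE y in lborel. cmod ((G (y + ?t n *\<^sub>R ?e) - G y) / of_real (?t n) * cis (y \<bullet> \<xi>)) \<le> K * exp (- (1 * norm y))" for n
      unfolding norm_mult norm_cis mult_1_right by (intro AE_I2 dq)
  qed measurable
  have I: "(\<integral>y. (G (y + ?t n *\<^sub>R ?e) - G y) / of_real (?t n) * cis (y \<bullet> \<xi>) \<partial>lborel) =
      (cis (- ((?t n *\<^sub>R ?e) \<bullet> \<xi>)) - 1) / of_real (?t n) * ?I" for n
  proof -
    let ?s = "?t n *\<^sub>R ?e"
    have m: "(\<lambda>y. G y * cis ((y - ?s) \<bullet> \<xi>)) \<in> borel_measurable borel" by measurable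
    have e: "G y * cis ((y - ?s) \<bullet> \<xi>) = cis (- (?s \<bullet> \<xi>)) * (G y * cis (y \<bullet> \<xi>))" for y
    proof -
      have "cis ((y - ?s) \<bullet> \<xi>) = cis (- (?s \<bullet> \<xi>)) * cis (y \<bullet> \<xi>)"
        unfolding cis_mult by (simp add: inner_diff_left)
      then show ?thesis by (simp only: mult_ac)
    qed
    have i2: "integrable lborel (\<lambda>y. G y * cis ((y - ?s) \<bullet> \<xi>))"
      unfolding e using Gi by (intro integrable_mult_right)
    have "(\<integral>y. G (y + ?s) * cis (y \<bullet> \<xi>) \<partial>lborel) = (\<integral>y. G y * cis ((y - ?s) \<bullet> \<xi>) \<partial>lborel)"
      using lborel_affine_euclidean_integral(1)[OF m, of 1 ?s] by (simp add: add.commute)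
    then have 1: "(\<integral>y. G (y + ?s) * cis (y \<bullet> \<xi>) \<partial>lborel) = cis (- (?s \<bullet> \<xi>)) * ?I"
      unfolding e by simp
    have i1: "integrable lborel (\<lambda>y. G (y + ?s) * cis (y \<bullet> \<xi>))"
      using lborel_affine_euclidean_integral(2)[OF m, of 1 ?s] i2 by (simp add: add.commute)
    have "(\<integral>y. (G (y + ?s) - G y) / of_real (?t n) * cis (y \<bullet> \<xi>) \<partial>lborel) =
        (\<integral>y. (1 / of_real (?t n)) * (G (y + ?s) * cis (y \<bullet> \<xi>) - G y * cis (y \<bullet> \<xi>)) \<partial>lborel)"
      by (rule Bochner_Integration.integral_cong[OF refl]) (simp add: field_simps)
    also have "\<dots> = (1 / of_real (?t n)) * (cis (- (?s \<bullet> \<xi>)) * ?I - ?I)"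
      unfolding integral_mult_right_zero Bochner_Integration.integral_diff[OF i1 Gi] 1 ..
    finally show ?thesis by (simp add: field_simps)
  qed
  have "((\<lambda>t. cis (- ((t *\<^sub>R ?e) \<bullet> \<xi>))) has_vector_derivative - \<i> * of_real (\<xi> $ j)) (at 0)"
    using partial_has_vector_derivative[OF cis_inner_differentiable[of 1 \<xi>], of 0 j 0]
    by (simp add: partial_cis[of j 1 \<xi>, simplified])
  from has_vector_derivative_seq[OF this t0]
  have "(\<lambda>n. (cis (- ((?t n *\<^sub>R ?e) \<bullet> \<xi>)) - 1) / of_real (?t n) * ?I) \<longlonglongrightarrow> - \<i> * of_real (\<xi> $ j) * ?I"
    by (intro tendsto_mult tendsto_const) simp
  with L1 show ?thesis unfolding I by (rule LIMSEQ_unique)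
qed

lemma fourier_partial_power:
  fixes G :: "real^'n::finite \<Rightarrow> complex"
  assumes G: "smooth G" and b: "gs_bound h 1 C G" and h: "h > 0"
  shows "(\<integral>y. iter_partial (replicate n j) G y * cis (y \<bullet> \<xi>) \<partial>lborel) =
    (- \<i> * of_real (\<xi> $ j)) ^ n * (\<integral>y. G y * cis (y \<bullet> \<xi>) \<partial>lborel)"
proof (induction n)
  case (Suc n)
  obtain D where D: "gs_bound (2 * h) 1 D (iter_partial (replicate n j) G)"
    using gs_bound_iter_partial[OF b h] by blast
  show ?case
    using fourier_partial[OF smooth_iter_partial[OF G] D, of j \<xi>] h by (simp add: Suc)
qed simp

lemma exists_large_component:
  fixes \<xi> :: "real^'n::finite"
  shows "\<exists>j. norm \<xi> \<le> real CARD('n) * \<bar>\<xi> $ j\<bar>"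
proof (rule ccontr)
  assume "\<not> ?thesis"
  then have "real CARD('n) * \<bar>\<xi> $ j\<bar> < norm \<xi>" for j by (simp add: not_le)
  then have "(\<Sum>j\<in>UNIV. real CARD('n) * \<bar>\<xi> $ j\<bar>) < (\<Sum>j\<in>(UNIV :: 'n set). norm \<xi>)"
    by (intro sum_strict_mono) auto
  then have "(\<Sum>j\<in>UNIV. \<bar>\<xi> $ j\<bar>) < norm \<xi>" by (simp add: sum_distrib_left[symmetric])
  with norm_le_l1_cart[of \<xi>] show False by simp
qed

text \<open>Each power of \<open>\<xi> $ j\<close> costs one derivative, so its n-th power times the
  transform is at most a multiple of h^n n!, for every n. The best n gives decay in this coordinate
  at the rate 1 / (2 h) by \<open>exp_le_power_fact\<close>, and some coordinate is at least norm
  \<xi> divided by the dimension.\<close>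

lemma fourier_decay:
  fixes G :: "real^'n::finite \<Rightarrow> complex"
  assumes G: "smooth G" and b: "gs_bound h 1 C G" and h: "h > 0"
  shows "cmod (\<integral>y. G y * cis (y \<bullet> \<xi>) \<partial>lborel) \<le>
    4 * C * (\<integral>y. exp (- (1 * norm (y :: real^'n))) \<partial>lborel) * exp (- (norm \<xi> / (2 * h * CARD('n))))"
proof -
  let ?I = "\<integral>y. G y * cis (y \<bullet> \<xi>) \<partial>lborel" and ?E = "\<integral>y. exp (- (1 * norm (y :: real^'n))) \<partial>lborel"
  have C: "C \<ge> 0" by (rule gs_bound_nonneg[OF b])
  obtain j where j: "norm \<xi> \<le> real CARD('n) * \<bar>\<xi> $ j\<bar>" using exists_large_component by blast
  obtain n where n: "exp (\<bar>\<xi> $ j\<bar> / h / 2) / 4 \<le> (\<bar>\<xi> $ j\<bar> / h) ^ n / fact n"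
    using exp_le_power_fact[of "\<bar>\<xi> $ j\<bar> / h"] h by auto
  have "\<bar>\<xi> $ j\<bar> ^ n * cmod ?I = cmod (\<integral>y. iter_partial (replicate n j) G y * cis (y \<bullet> \<xi>) \<partial>lborel)"
    unfolding fourier_partial_power[OF G b h] by (simp add: norm_mult norm_power)
  also have "\<dots> \<le> (\<integral>y. C * (h ^ n * fact n) * exp (- (1 * norm (y :: real^'n))) \<partial>lborel)"
  proof (rule Bochner_Integration.integral_norm_bound_integral)
    have e: "integrable lborel (\<lambda>y :: real^'n. C * (h ^ n * fact n) * exp (- (1 * norm y)))"
      by (intro integrable_mult_right integrable_exp_norm) simp
    show "integrable lborel (\<lambda>y :: real^'n. C * (h ^ n * fact n) * exp (- (1 * norm y)))" by (rule e)
    have [measurable]: "iter_partial (replicate n j) G \<in> borel_measurable borel"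
      by (intro smooth_borel_measurable smooth_iter_partial G)
    have le: "cmod (iter_partial (replicate n j) G y * cis (y \<bullet> \<xi>)) \<le> C * (h ^ n * fact n) * exp (- (1 * norm y))" for y
      using gs_boundD[OF b, of "replicate n j" y] by (simp add: norm_mult)
    then show "\<And>y. y \<in> space lborel \<Longrightarrow> cmod (iter_partial (replicate n j) G y * cis (y \<bullet> \<xi>)) \<le> C * (h ^ n * fact n) * exp (- (1 * norm y))" by blast
    show "integrable lborel (\<lambda>y. iter_partial (replicate n j) G y * cis (y \<bullet> \<xi>))"
      by (rule Bochner_Integration.integrable_bound[OF e])
        (use le in \<open>auto intro!: AE_I2 order_trans[OF _ abs_ge_self]\<close>)
  qed
  also have "\<dots> = C * (h ^ n * fact n) * ?E" by simp
  finally have A: "(\<bar>\<xi> $ j\<bar> / h) ^ n / fact n * cmod ?I \<le> C * ?E"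
    using h by (simp add: power_divide divide_simps mult_ac)
  have B: "exp (\<bar>\<xi> $ j\<bar> / h / 2) / 4 * cmod ?I \<le> (\<bar>\<xi> $ j\<bar> / h) ^ n / fact n * cmod ?I"
    by (rule mult_right_mono[OF n]) simp
  have 1: "exp (\<bar>\<xi> $ j\<bar> / h / 2) * cmod ?I \<le> 4 * C * ?E" using order_trans[OF B A] by simp
  have "norm \<xi> / (2 * h * CARD('n)) \<le> \<bar>\<xi> $ j\<bar> / h / 2"
    using j h by (simp add: field_simps)
  then have "exp (norm \<xi> / (2 * h * CARD('n))) * cmod ?I \<le> 4 * C * ?E"
    using 1 by (meson exp_le_cancel_iff mult_right_mono norm_ge_zero order_trans)
  moreover have "I \<le> M * exp (- s)" if "exp s * I \<le> M" for s I M :: real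
    using mult_right_mono[OF that, of "exp (- s)"] by (simp add: exp_minus mult_ac)
  ultimately show ?thesis by blast
qed

section \<open>Expansion into time-frequency shifts\<close>

text \<open>The rate a + 1 in y and in y - x yields the rate a in x, by the triangle inequality, and
  leaves the rate 1 in y for integrability. As both factors have the same parameter, all n + 1
  Leibniz terms coincide, and n + 1 \<le> 2^n accounts for h / 2.\<close>

lemma gs_bound_product_shift:
  fixes f g :: "real^'n::finite \<Rightarrow> complex"
  assumes f: "smooth f" "gs_bound (h / 2) (a + 1) C f" and g: "smooth g" "gs_bound (h / 2) (a + 1) D g"
    and h: "h > 0" and a: "a \<ge> 0"
  shows "gs_bound h 1 (C * D * exp (- (a * norm x))) (\<lambda>y. f y * g (y - x))"
  unfolding gs_bound_def
proof (intro allI)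
  fix "is" :: "'n list" and y :: "real^'n"
  let ?n = "length is"
  have CD: "C \<ge> 0" "D \<ge> 0" by (rule gs_bound_nonneg[OF f(2)] gs_bound_nonneg[OF g(2)])+
  let ?e1 = "exp (- ((a + 1) * norm y))" and ?e2 = "exp (- ((a + 1) * norm (y - x)))"
  have "cmod (iter_partial is (\<lambda>y. f y * g (y - x)) y) \<le>
     (\<Sum>k\<le>?n. real (?n choose k) * (C * ((h / 2) ^ k * fact k) * ?e1) * (D * ((h / 2) ^ (?n - k) * fact (?n - k)) * ?e2))"
    by (rule iter_partial_mult_bound[OF f(1) smooth_shift[OF g(1)] gs_boundD[OF f(2)]])
      (use gs_boundD[OF g(2)] in \<open>simp add: iter_partial_shift\<close>)
  also have "\<dots> = (\<Sum>k\<le>?n. C * D * ((h / 2) ^ ?n * fact ?n) * (?e1 * ?e2))"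
  proof (rule sum.cong[OF refl])
    fix k assume "k \<in> {..?n}"
    then have k: "k \<le> ?n" by simp
    have "(fact ?n :: real) = fact k * fact (?n - k) * real (?n choose k)" using k by (simp add: binomial_fact)
    moreover have "(h / 2) ^ ?n = (h / 2) ^ k * (h / 2) ^ (?n - k)" using k by (simp flip: power_add)
    ultimately show "real (?n choose k) * (C * ((h / 2) ^ k * fact k) * ?e1) * (D * ((h / 2) ^ (?n - k) * fact (?n - k)) * ?e2) =
        C * D * ((h / 2) ^ ?n * fact ?n) * (?e1 * ?e2)" by (simp only: mult_ac)
  qed
  also have "\<dots> = real (Suc ?n) * (h / 2) ^ ?n * (C * D * fact ?n * (?e1 * ?e2))" by simp
  also have "\<dots> \<le> h ^ ?n * (C * D * fact ?n * (exp (- (a * norm x)) * exp (- (1 * norm y))))"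
  proof (rule mult_mono[OF _ mult_left_mono])
    have "real (Suc ?n) \<le> 2 ^ ?n"
      by (metis less_exp Suc_leI of_nat_le_iff of_nat_numeral of_nat_power)
    then show "real (Suc ?n) * (h / 2) ^ ?n \<le> h ^ ?n" using h mult_left_mono[of "real (Suc ?n)" "2 ^ ?n" "h ^ ?n"]
      by (simp add: power_divide divide_le_eq mult_ac)
    have "norm x \<le> norm y + norm (y - x)" using norm_triangle_ineq4[of y "y - x"] by simp
    then have "a * norm x \<le> a * (norm y + norm (y - x))" using a by (rule mult_left_mono)
    then have "a * norm x + 1 * norm y \<le> (a + 1) * norm y + (a + 1) * norm (y - x)"
      using norm_ge_zero[of "y - x"] by (simp only: distrib_right distrib_left)
    then show "?e1 * ?e2 \<le> exp (- (a * norm x)) * exp (- (1 * norm y))"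
      by (simp add: exp_add[symmetric])
  qed (use CD h in auto)
  finally show "cmod (iter_partial is (\<lambda>y. f y * g (y - x)) y) \<le>
      C * D * exp (- (a * norm x)) * (h ^ ?n * fact ?n) * exp (- (1 * norm y))" by (simp only: mult_ac)
qed

text \<open>At fixed x, Fourier inversion in \<xi> recovers f y \<phi> (y - x); multiplication by
  the conjugate of \<phi> (y - x) and integration over x leave f y times the squared norm of \<phi>.
  Up to a constant, k is the short-time Fourier transform of f with the conjugate window, taken at
  (x, -\<xi>). It decays in x by \<open>gs_bound_product_shift\<close> and in \<xi> by
  \<open>fourier_decay\<close>.\<close>

lemma gs_space_reproducing:
  fixes f \<phi> :: "real^'n::finite \<Rightarrow> complex"
  assumes f: "f \<in> gs_space" and \<phi>: "\<phi> \<in> gs_space" "\<phi> \<noteq> (\<lambda>_. 0)"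
  shows "\<exists>k. k \<in> borel_measurable borel \<and> (\<forall>A. \<exists>C. \<forall>Y. cmod (k Y) \<le> C * exp (- (A * norm Y))) \<and>
    (\<forall>y. f y = (\<integral>Y. k Y * tf_shift Y (\<lambda>z. cnj (\<phi> z)) y \<partial>lborel))"
proof -
  note s = gs_space_smooth[OF f] gs_space_smooth[OF \<phi>(1)]
  have [measurable]: "f \<in> borel_measurable borel" "\<phi> \<in> borel_measurable borel"
    by (intro smooth_borel_measurable s)+
  have [measurable]: "cnj \<in> borel_measurable borel"
    by (intro borel_measurable_continuous_onI continuous_intros)
  \<comment> \<open>The two normalizations: q comes from the integration over translations, P from
    Fourier inversion.\<close>
  define q where "q = (\<integral>x. (cmod (\<phi> x))\<^sup>2 \<partial>lborel)"
  define P where "P = (2 * pi) ^ DIM(real^'n)"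
  define G where "G x y = f y * \<phi> (y - x)" for x y
  define Gh where "Gh Y = (\<integral>y. G (fst Y) y * cis (y \<bullet> snd Y) \<partial>lborel)" for Y
  define k where "k Y = Gh Y / of_real (P * q)" for Y
  have P: "P > 0" by (simp add: P_def)
  have Gs: "smooth (G x)" for x
    unfolding G_def by (rule smooth_mult[OF s(1) smooth_shift[OF s(2)]])
  have decay: "\<exists>C\<ge>0. \<forall>Y. cmod (Gh Y) \<le> C * exp (- (A * norm Y))" for A
  proof -
    define a where "a = \<bar>A\<bar> + 1"
    \<comment> \<open>Chosen so that the rate in \<open>fourier_decay\<close> is exactly a.\<close>
    define h where "h = 1 / (2 * a * CARD('n))"
    have a: "a > 0" and h: "h > 0" by (auto simp: a_def h_def)
    have "h / 2 > 0" using h by simp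
    from gs_space_bound[OF f this] gs_space_bound[OF \<phi>(1) this]
    obtain C1 C2 where C: "gs_bound (h / 2) (a + 1) C1 f" "gs_bound (h / 2) (a + 1) C2 \<phi>" by meson
    have C0: "C1 \<ge> 0" "C2 \<ge> 0" using C gs_bound_nonneg by blast+
    let ?E = "\<integral>y. exp (- (1 * norm (y :: real^'n))) \<partial>lborel"
    have E: "?E \<ge> 0" by simp
    have "cmod (Gh Y) \<le> 4 * (C1 * C2) * ?E * exp (- (A * norm Y))" for Y
    proof -
      obtain x \<xi> where Y: "Y = (x, \<xi>)" by (cases Y)
      have "cmod (Gh Y) \<le> 4 * (C1 * C2 * exp (- (a * norm x))) * ?E * exp (- (norm \<xi> / (2 * h * CARD('n))))"
        unfolding Gh_def Y fst_conv snd_conv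
        by (rule fourier_decay[OF Gs _ h]) (use gs_bound_product_shift[OF s(1) C(1) s(2) C(2) h, of x] a in \<open>simp add: G_def[abs_def]\<close>)
      also have "norm \<xi> / (2 * h * CARD('n)) = a * norm \<xi>" using a by (simp add: h_def field_simps)
      also have "4 * (C1 * C2 * exp (- (a * norm x))) * ?E * exp (- (a * norm \<xi>)) =
          4 * (C1 * C2) * ?E * (exp (- (a * norm x)) * exp (- (a * norm \<xi>)))" by (simp only: mult_ac)
      also have "\<dots> \<le> 4 * (C1 * C2) * ?E * exp (- (A * norm Y))"
      proof (rule mult_left_mono)
        have "A * norm Y \<le> a * norm Y" by (intro mult_right_mono) (auto simp: a_def)
        also have "\<dots> \<le> a * (norm x + norm \<xi>)"
          using a norm_Pair_le[of x \<xi>] unfolding Y by (intro mult_left_mono) auto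
        finally show "exp (- (a * norm x)) * exp (- (a * norm \<xi>)) \<le> exp (- (A * norm Y))"
          by (simp add: exp_add[symmetric] algebra_simps)
      qed (use C0 E in auto)
      finally show ?thesis .
    qed
    then show ?thesis using C0 E by (intro exI[of _ "4 * (C1 * C2) * ?E"]) auto
  qed
  have Ghm: "Gh \<in> borel_measurable borel"
  proof -
    have "(\<lambda>p :: ((real^'n) \<times> (real^'n)) \<times> (real^'n). f (snd p) * \<phi> (snd p - fst (fst p)) * cis (snd p \<bullet> snd (fst p)))
        \<in> borel_measurable ((borel \<Otimes>\<^sub>M borel) \<Otimes>\<^sub>M lborel)" by measurable
    then have "(\<lambda>Y. \<integral>y. f y * \<phi> (y - fst Y) * cis (y \<bullet> snd Y) \<partial>lborel) \<in> borel_measurable (borel \<Otimes>\<^sub>M borel)"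
      by (intro lborel.borel_measurable_lebesgue_integral) (simp add: split_beta')
    then show ?thesis unfolding Gh_def[abs_def] G_def by (simp add: borel_prod)
  qed
  have q: "q > 0"
  proof -
    obtain x0 where x0: "\<phi> x0 \<noteq> 0" using \<phi>(2) by auto
    have cont: "continuous_on UNIV (\<lambda>x. (cmod (\<phi> x))\<^sup>2)"
      by (intro continuous_intros smooth_continuous s)
    have int: "integrable lborel (\<lambda>x. (cmod (\<phi> x))\<^sup>2)"
    proof -
      obtain C where C: "gs_bound 1 1 C \<phi>" using gs_space_bound[OF \<phi>(1), of 1 1] by auto
      have "(cmod (\<phi> x))\<^sup>2 \<le> C\<^sup>2 * exp (- (2 * norm x))" for x
      proof -
        have "(cmod (\<phi> x))\<^sup>2 \<le> (C * exp (- (norm x)))\<^sup>2"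
          using gs_boundD[OF C, of "[]" x] by (intro power_mono) auto
        also have "\<dots> = C\<^sup>2 * exp (- (2 * norm x))"
          by (simp add: power_mult_distrib power2_eq_square exp_add[symmetric])
        finally show ?thesis .
      qed
      then show ?thesis
        by (intro Bochner_Integration.integrable_bound[OF integrable_mult_right[OF integrable_exp_norm[of 2], of "C\<^sup>2"]])
          (auto intro!: AE_I2)
    qed
    have "q \<noteq> 0"
    proof
      assume "q = 0"
      then have "AE x in lborel. (cmod (\<phi> x))\<^sup>2 = 0"
        unfolding q_def using int by (subst (asm) integral_nonneg_eq_0_iff_AE) auto
      then have "AE x in lebesgue. \<phi> x = 0" by (simp add: AE_completion)
      then have "\<phi> = (\<lambda>_. 0)" by (rule continuous_AE_zero[OF smooth_continuous[OF s(2)]])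
      then show False using x0 by auto
    qed
    then show ?thesis unfolding q_def by (simp add: less_le)
  qed
  have rep: "f y = (\<integral>Y. k Y * tf_shift Y (\<lambda>z. cnj (\<phi> z)) y \<partial>lborel)" for y
  proof -
    obtain C where C: "C \<ge> 0" "\<And>Y. cmod (Gh Y) \<le> C * exp (- (2 * norm Y))" using decay[of 2] by blast
    obtain D where D: "gs_bound 1 0 D \<phi>" using gs_space_bound[OF \<phi>(1), of 1 0] by auto
    have D0: "D \<ge> 0" by (rule gs_bound_nonneg[OF D])
    have phiD: "cmod (\<phi> x) \<le> D" for x using gs_boundD[OF D, of "[]" x] by simp
    \<comment> \<open>Half of the rate 2 goes to each variable, which makes the iterated integral
      absolutely convergent.\<close>
    have e: "exp (- (2 * norm (x, \<xi>))) \<le> exp (- (1 * norm x)) * exp (- (1 * norm \<xi>))" for x \<xi> :: "real^'n"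
      using norm_fst_le[of x \<xi>] norm_snd_le[of \<xi> x] by (simp add: exp_add[symmetric])
    have Gh2: "cmod (Gh (x, \<xi>)) \<le> C * (exp (- (1 * norm x)) * exp (- (1 * norm \<xi>)))" for x \<xi>
      using order_trans[OF C(2) mult_left_mono[OF e C(1)]] .
    have "(\<integral>Y. Gh Y * tf_shift Y (\<lambda>z. cnj (\<phi> z)) y \<partial>lborel) =
        (\<integral>Y. Gh Y * tf_shift Y (\<lambda>z. cnj (\<phi> z)) y \<partial>(lborel \<Otimes>\<^sub>M lborel))" by (simp add: lborel_prod)
    also have "\<dots> = (\<integral>x. \<integral>\<xi>. Gh (x, \<xi>) * tf_shift (x, \<xi>) (\<lambda>z. cnj (\<phi> z)) y \<partial>lborel \<partial>lborel)"
    proof (rule lborel_pair.integral_fst'[symmetric], rule integrable_lborel_pair_mult[where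
          a = "\<lambda>x. C * exp (- (1 * norm x))" and b = "\<lambda>\<xi>. D * exp (- (1 * norm \<xi>))"])
      have [measurable]: "Gh \<in> borel_measurable (borel \<Otimes>\<^sub>M borel)" using Ghm by (simp add: borel_prod)
      show "(\<lambda>Y. Gh Y * tf_shift Y (\<lambda>z. cnj (\<phi> z)) y) \<in> borel_measurable (lborel \<Otimes>\<^sub>M lborel)"
        unfolding tf_shift_def by measurable
      fix x \<xi>
      have "cmod (Gh (x, \<xi>) * tf_shift (x, \<xi>) (\<lambda>z. cnj (\<phi> z)) y) \<le> C * (exp (- (1 * norm x)) * exp (- (1 * norm \<xi>))) * D"
        unfolding norm_mult using C(1) phiD by (intro mult_mono Gh2) (auto simp: tf_shift_def norm_mult)
      then show "cmod (Gh (x, \<xi>) * tf_shift (x, \<xi>) (\<lambda>z. cnj (\<phi> z)) y) \<le> C * exp (- (1 * norm x)) * (D * exp (- (1 * norm \<xi>)))"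
        by (simp only: mult_ac)
    next
      show "integrable lborel (\<lambda>x :: real^'n. C * exp (- (1 * norm x)))" "integrable lborel (\<lambda>x :: real^'n. D * exp (- (1 * norm x)))"
        by (intro integrable_mult_right integrable_exp_norm, simp)+
    qed (use C D0 in auto)
    also have "\<dots> = (\<integral>x. of_real P * (f y * of_real ((cmod (\<phi> (y - x)))\<^sup>2)) \<partial>lborel)"
    proof (rule Bochner_Integration.integral_cong[OF refl])
      fix x :: "real^'n"
      obtain C1 C2 where "gs_bound (1 / 2) 1 C1 f" "gs_bound (1 / 2) 1 C2 \<phi>"
        using gs_space_bound[OF f, of "1 / 2" 1] gs_space_bound[OF \<phi>(1), of "1 / 2" 1] by auto
      then have Gb: "gs_bound 1 1 (C1 * C2) (G x)"
        using gs_bound_product_shift[of f 1 0 C1 \<phi> C2 x] s by (simp add: G_def[abs_def])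
      have "cmod (G x z) \<le> C1 * C2" for z
      proof -
        have "cmod (G x z) \<le> C1 * C2 * exp (- (1 * norm z))" using gs_boundD[OF Gb, of "[]" z] by simp
        also have "\<dots> \<le> C1 * C2 * 1"
          using gs_bound_nonneg[OF Gb] by (intro mult_left_mono) auto
        finally show ?thesis by simp
      qed
      moreover have "integrable lborel (\<lambda>\<xi>. Gh (x, \<xi>))"
      proof (rule Bochner_Integration.integrable_bound)
        show "integrable lborel (\<lambda>\<xi> :: real^'n. C * exp (- (1 * norm x)) * exp (- (1 * norm \<xi>)))"
          by (intro integrable_mult_right integrable_exp_norm) simp
        have "(\<lambda>\<xi>. (x, \<xi>)) \<in> borel \<rightarrow>\<^sub>M borel" by (intro borel_measurable_continuous_onI continuous_intros)
        from measurable_compose[OF this Ghm] show "(\<lambda>\<xi>. Gh (x, \<xi>)) \<in> borel_measurable lborel" by simp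
      qed (use Gh2[of x] C in \<open>auto intro!: AE_I2 simp: mult.assoc\<close>)
      ultimately have inv: "(\<integral>\<xi>. Gh (x, \<xi>) * cis (- (y \<bullet> \<xi>)) \<partial>lborel) = of_real P * G x y"
        unfolding P_def Gh_def fst_conv snd_conv
        by (intro fourier_inversion smooth_continuous Gs gs_bound_integrable[OF Gs Gb]) auto
      have "(\<integral>\<xi>. Gh (x, \<xi>) * tf_shift (x, \<xi>) (\<lambda>z. cnj (\<phi> z)) y \<partial>lborel) =
          (\<integral>\<xi>. cnj (\<phi> (y - x)) * (Gh (x, \<xi>) * cis (- (y \<bullet> \<xi>))) \<partial>lborel)"
        by (simp add: tf_shift_def mult_ac)
      also have "\<dots> = cnj (\<phi> (y - x)) * (of_real P * G x y)" by (simp add: inv)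
      also have "\<dots> = of_real P * (f y * of_real ((cmod (\<phi> (y - x)))\<^sup>2))"
        unfolding G_def complex_norm_square by (simp add: mult_ac)
      finally show "(\<integral>\<xi>. Gh (x, \<xi>) * tf_shift (x, \<xi>) (\<lambda>z. cnj (\<phi> z)) y \<partial>lborel) = \<dots>" .
    qed
    also have "\<dots> = of_real P * (f y * of_real q)"
    proof -
      have "(\<integral>x. complex_of_real ((cmod (\<phi> (y - x)))\<^sup>2) \<partial>lborel) = (\<integral>x. complex_of_real ((cmod (\<phi> x))\<^sup>2) \<partial>lborel)"
        using lborel_affine_euclidean_integral(1)[of "\<lambda>x. complex_of_real ((cmod (\<phi> x))\<^sup>2)" "-1" y] by simp
      also have "\<dots> = of_real q" unfolding q_def by (rule integral_complex_of_real)
      finally show ?thesis by simp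
    qed
    finally have main: "(\<integral>Y. Gh Y * tf_shift Y (\<lambda>z. cnj (\<phi> z)) y \<partial>lborel) = of_real P * (f y * of_real q)" .
    have "(\<integral>Y. k Y * tf_shift Y (\<lambda>z. cnj (\<phi> z)) y \<partial>lborel) =
        (\<integral>Y. Gh Y * tf_shift Y (\<lambda>z. cnj (\<phi> z)) y / of_real (P * q) \<partial>lborel)"
      by (simp add: k_def)
    also have "\<dots> = of_real P * (f y * of_real q) / of_real (P * q)"
      by (simp only: integral_divide_zero main)
    also have "\<dots> = f y" using P q by simp
    finally show ?thesis by simp
  qed
  have "\<exists>C. \<forall>Y. cmod (k Y) \<le> C * exp (- (A * norm Y))" for A
  proof -
    obtain C where C: "\<And>Y. cmod (Gh Y) \<le> C * exp (- (A * norm Y))" using decay[of A] by blast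
    have "cmod (k Y) \<le> C / (P * q) * exp (- (A * norm Y))" for Y
      using C[of Y] P q by (simp add: k_def norm_divide norm_mult divide_right_mono)
    then show ?thesis by blast
  qed
  moreover have "k \<in> borel_measurable borel" unfolding k_def[abs_def] using Ghm by measurable
  ultimately show ?thesis using rep by (intro exI[of _ k]) auto
qed

section \<open>The reproducing formula for ultradistributions\<close>

lemma iter_partial_sum:
  assumes "finite S" "\<And>z. z \<in> S \<Longrightarrow> smooth (F z)"
  shows "smooth (\<lambda>x. \<Sum>z\<in>S. c z * F z x) \<and>
    iter_partial is (\<lambda>x. \<Sum>z\<in>S. c z * F z x) = (\<lambda>x. \<Sum>z\<in>S. c z * iter_partial is (F z) x)"
  using assms
proof (induction S rule: finite_induct)
  case empty
  have "iter_partial is (\<lambda>_. 0) = (\<lambda>_. 0)" by (cases "is = []") (auto simp: iter_partial_const)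
  then show ?case by (simp add: smooth_const)
next
  case (insert z S)
  then have IH: "smooth (\<lambda>x. \<Sum>z\<in>S. c z * F z x)"
    "iter_partial is (\<lambda>x. \<Sum>z\<in>S. c z * F z x) = (\<lambda>x. \<Sum>z\<in>S. c z * iter_partial is (F z) x)" by auto
  have s: "smooth (F z)" using insert.prems by simp
  show ?case
    unfolding sum.insert[OF insert.hyps]
    using smooth_add[OF smooth_cmult[OF s, of "c z"] IH(1)]
      iter_partial_add[OF smooth_cmult[OF s, of "c z"] IH(1), of "is"] IH(2)
    by (simp add: iter_partial_cmult[OF s])
qed

lemma gs_dual_add: "u \<in> gs_dual \<Longrightarrow> f \<in> gs_space \<Longrightarrow> g \<in> gs_space \<Longrightarrow> u (\<lambda>x. f x + g x) = u f + u g"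
  by (simp add: gs_dual_def)

lemma gs_dual_cmult: "u \<in> gs_dual \<Longrightarrow> f \<in> gs_space \<Longrightarrow> u (\<lambda>x. c * f x) = c * u f"
  by (simp add: gs_dual_def)

lemma gs_dual_diff:
  assumes "u \<in> gs_dual" "f \<in> gs_space" "g \<in> gs_space"
  shows "(\<lambda>x. f x - g x) \<in> gs_space" "u (\<lambda>x. f x - g x) = u f - u g"
  using gs_space_add[OF assms(2) gs_space_cmult[OF assms(3), of "-1"]]
    gs_dual_add[OF assms(1,2) gs_space_cmult[OF assms(3), of "-1"]] gs_dual_cmult[OF assms(1,3), of "-1"]
  by simp_all

lemma gs_dual_sum:
  assumes u: "u \<in> gs_dual" and "finite S" "\<And>z. z \<in> S \<Longrightarrow> F z \<in> gs_space"
  shows "(\<lambda>x. \<Sum>z\<in>S. c z * F z x) \<in> gs_space \<and> u (\<lambda>x. \<Sum>z\<in>S. c z * F z x) = (\<Sum>z\<in>S. c z * u (F z))"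
  using assms(2,3)
proof (induction S rule: finite_induct)
  case empty
  show ?case
    using gs_space_cmult[OF gaussian_gs_space, of 0] gs_dual_cmult[OF u gaussian_gs_space, of 0] by simp
next
  case (insert z S)
  then have IH: "(\<lambda>x. \<Sum>z\<in>S. c z * F z x) \<in> gs_space"
    "u (\<lambda>x. \<Sum>z\<in>S. c z * F z x) = (\<Sum>z\<in>S. c z * u (F z))" by auto
  have z: "F z \<in> gs_space" using insert.prems by simp
  show ?case
    unfolding sum.insert[OF insert.hyps]
    using gs_space_add[OF gs_space_cmult[OF z] IH(1)] gs_dual_add[OF u gs_space_cmult[OF z] IH(1)]
      gs_dual_cmult[OF u z] IH(2) by simp
qed

text \<open>By the mean value inequality, the bound w on the derivative also dominates the
  difference quotients.\<close>

lemma has_vector_derivative_integral: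
  fixes F F' :: "real \<Rightarrow> 'a \<Rightarrow> complex"
  assumes d: "\<And>t Y. ((\<lambda>t. F t Y) has_vector_derivative F' t Y) (at t)"
    and i: "\<And>t. integrable M (F t)" and m: "F' 0 \<in> borel_measurable M"
    and w: "integrable M w" "\<And>t Y. cmod (F' t Y) \<le> w Y"
  shows "((\<lambda>t. \<integral>Y. F t Y \<partial>M) has_vector_derivative (\<integral>Y. F' 0 Y \<partial>M)) (at 0)"
proof -
  let ?I = "\<lambda>t. \<integral>Y. F t Y \<partial>M" and ?D = "\<integral>Y. F' 0 Y \<partial>M"
  have "((\<lambda>h. norm (?I (0 + h) - ?I 0 - h *\<^sub>R ?D) / norm h) \<longlongrightarrow> 0) (at 0)"
  proof (subst tendsto_at_iff_sequentially, intro allI impI)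
    fix t :: "nat \<Rightarrow> real" assume "\<forall>n. t n \<in> UNIV - {0}" and t: "t \<longlonglongrightarrow> 0"
    then have t0: "t n \<noteq> 0" for n by auto
    have "(\<lambda>n. \<integral>Y. (F (t n) Y - F 0 Y) / of_real (t n) \<partial>M) \<longlonglongrightarrow> ?D"
    proof (rule integral_dominated_convergence[OF m _ w(1)])
      show "(\<lambda>Y. (F (t n) Y - F 0 Y) / of_real (t n)) \<in> borel_measurable M" for n
        using borel_measurable_integrable[OF i] by measurable
      show "AE Y in M. (\<lambda>n. (F (t n) Y - F 0 Y) / of_real (t n)) \<longlonglongrightarrow> F' 0 Y"
      proof (rule AE_I2)
        fix Y
        show "(\<lambda>n. (F (t n) Y - F 0 Y) / of_real (t n)) \<longlonglongrightarrow> F' 0 Y"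
          by (rule has_vector_derivative_seq[OF d t t0])
      qed
      show "AE Y in M. norm ((F (t n) Y - F 0 Y) / of_real (t n)) \<le> w Y" for n
      proof (rule AE_I2)
        fix Y
        have "norm (F (t n) Y - F 0 Y) \<le> w Y * norm (t n - 0)"
        proof (rule differentiable_bound[of UNIV "\<lambda>t. F t Y" "\<lambda>t h. h *\<^sub>R F' t Y"])
          fix s :: real
          show "((\<lambda>t. F t Y) has_derivative (\<lambda>h. h *\<^sub>R F' s Y)) (at s within UNIV)"
            using d[of Y s] by (simp add: has_vector_derivative_def)
          show "onorm (\<lambda>h. h *\<^sub>R F' s Y) \<le> w Y"
            using w(2)[of s Y] by (intro onorm_le) (simp add: mult.commute mult_left_mono)
        qed auto
        then show "norm ((F (t n) Y - F 0 Y) / of_real (t n)) \<le> w Y"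
          using t0[of n] by (simp add: norm_divide divide_le_eq)
      qed
    qed
    moreover have "(\<integral>Y. (F (t n) Y - F 0 Y) / of_real (t n) \<partial>M) = (?I (t n) - ?I 0) / of_real (t n)" for n
      by (simp only: integral_divide_zero Bochner_Integration.integral_diff[OF i i])
    ultimately have "(\<lambda>n. (?I (t n) - ?I 0) / of_real (t n)) \<longlonglongrightarrow> ?D" by (simp only:)
    then have "(\<lambda>n. norm ((?I (t n) - ?I 0) / of_real (t n) - ?D)) \<longlonglongrightarrow> 0"
      by (simp add: tendsto_norm_zero_iff Lim_null[symmetric])
    moreover have "norm (?I (0 + t n) - ?I 0 - t n *\<^sub>R ?D) / norm (t n) = norm ((?I (t n) - ?I 0) / of_real (t n) - ?D)" for n
    proof -
      have "(?I (t n) - ?I 0) / of_real (t n) - ?D = (?I (t n) - ?I 0 - t n *\<^sub>R ?D) / of_real (t n)"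
        using t0[of n] by (simp add: field_simps scaleR_conv_of_real)
      then show ?thesis by (simp add: norm_divide)
    qed
    ultimately show "((\<lambda>h. norm (?I (0 + h) - ?I 0 - h *\<^sub>R ?D) / norm h) \<circ> t) \<longlonglongrightarrow> 0"
      by (simp add: o_def)
  qed
  then show ?thesis
    unfolding has_vector_derivative_def has_derivative_at by (simp add: bounded_linear_scaleR_left)
qed

lemma exp_decay_integrable:
  fixes f :: "'a::euclidean_space \<Rightarrow> complex"
  assumes [measurable]: "f \<in> borel_measurable borel" and le: "\<And>x. cmod (f x) \<le> C * exp (- (1 * norm x))"
  shows "integrable lborel f"
  by (rule Bochner_Integration.integrable_bound[OF integrable_mult_right[OF integrable_exp_norm[of 1], of C]])
    (use le in \<open>auto intro!: AE_I2 order_trans[OF _ abs_ge_self]\<close>)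

text \<open>The Lipschitz estimate for time-frequency shifts, read off at one derivative and one
  point. It supplies measurability in Y for integrals over shifts.\<close>

lemma tf_shift_continuous:
  fixes g :: "real^'n::finite \<Rightarrow> complex"
  assumes g: "g \<in> gs_space"
  shows "continuous_on UNIV (\<lambda>Y. iter_partial is (tf_shift Y g) y)"
proof -
  obtain C b where C: "\<And>X Y. gs_bound 1 0 (C * norm (X - Y) * exp (b * (norm X + norm Y))) (\<lambda>y. tf_shift X g y - tf_shift Y g y)"
    using gs_bound_tf_shift_diff[OF g zero_less_one, of 0] by blast
  have s: "smooth (tf_shift Y g)" for Y by (rule smooth_tf_shift[OF gs_space_smooth[OF g]])
  have e: "iter_partial is (\<lambda>y. tf_shift X g y - tf_shift Y g y) y = iter_partial is (tf_shift X g) y - iter_partial is (tf_shift Y g) y" for X Y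
    using iter_partial_add[OF s[of X] smooth_cmult[OF s[of Y], of "-1"], of "is"]
      iter_partial_cmult[OF s[of Y], of "is" "-1"] by simp
  have le: "cmod (iter_partial is (tf_shift X g) y - iter_partial is (tf_shift Y g) y) \<le>
      C * norm (X - Y) * exp (b * (norm X + norm Y)) * (1 ^ length is * fact (length is))" for X Y
    using gs_boundD[OF C, of "is" X Y y] by (simp add: e)
  show ?thesis
    unfolding continuous_on_def
  proof (intro ballI)
    fix X :: "(real^'n) \<times> (real^'n)"
    have "((\<lambda>Y. C * norm (Y - X) * exp (b * (norm Y + norm X)) * (1 ^ length is * fact (length is))) \<longlongrightarrow>
        C * norm (X - X) * exp (b * (norm X + norm X)) * (1 ^ length is * fact (length is))) (at X)"
      by (intro tendsto_intros)
    then have "((\<lambda>Y. iter_partial is (tf_shift Y g) y - iter_partial is (tf_shift X g) y) \<longlongrightarrow> 0) (at X)"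
      by (intro Lim_null_comparison[OF always_eventually[OF allI[OF le]]]) simp
    then show "((\<lambda>Y. iter_partial is (tf_shift Y g) y) \<longlongrightarrow> iter_partial is (tf_shift X g) y) (at X within UNIV)"
      by (simp add: Lim_null[symmetric])
  qed
qed

text \<open>Using the decay of k at the rate b + 1 leaves the rate 1, which is integrable.\<close>

lemma exp_decay_mult:
  fixes k :: "'a::real_normed_vector \<Rightarrow> complex"
  assumes k: "\<And>A. \<exists>C. \<forall>Y. cmod (k Y) \<le> C * exp (- (A * norm Y))"
  shows "\<exists>C\<ge>0. \<forall>Y. cmod (k Y) * (D * exp (b * norm Y)) \<le> C * exp (- (1 * norm Y))"
proof -
  obtain C where C: "\<And>Y. cmod (k Y) \<le> C * exp (- ((b + 1) * norm Y))" using k by blast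
  have C0: "C \<ge> 0" using order_trans[OF norm_ge_zero C[of 0]] by simp
  have "cmod (k Y) * (D * exp (b * norm Y)) \<le> C * \<bar>D\<bar> * exp (- (1 * norm Y))" for Y
  proof -
    have "cmod (k Y) * (D * exp (b * norm Y)) \<le> cmod (k Y) * (\<bar>D\<bar> * exp (b * norm Y))"
      by (intro mult_left_mono mult_right_mono) auto
    also have "\<dots> \<le> (C * exp (- ((b + 1) * norm Y))) * (\<bar>D\<bar> * exp (b * norm Y))"
      by (intro mult_right_mono C) auto
    also have "\<dots> = C * \<bar>D\<bar> * (exp (- ((b + 1) * norm Y)) * exp (b * norm Y))" by (simp only: mult_ac)
    also have "exp (- ((b + 1) * norm Y)) * exp (b * norm Y) = exp (- (1 * norm Y))"
      by (simp add: exp_add[symmetric] algebra_simps)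
    finally show ?thesis .
  qed
  then show ?thesis using C0 by (intro exI[of _ "C * \<bar>D\<bar>"]) auto
qed

lemma iter_partial_integral_tf_shift:
  fixes g :: "real^'n::finite \<Rightarrow> complex"
  assumes g: "g \<in> gs_space" and k[measurable]: "k \<in> borel_measurable borel"
    and kd: "\<And>A. \<exists>C. \<forall>Y. cmod (k Y) \<le> C * exp (- (A * norm Y))"
  shows "iter_partial is (\<lambda>y. \<integral>Y. k Y * tf_shift Y g y \<partial>lborel) = (\<lambda>y. \<integral>Y. k Y * iter_partial is (tf_shift Y g) y \<partial>lborel)"
proof (induction "is")
  case (Cons i "is")
  obtain C b where C: "\<And>Y. gs_bound 1 0 (C * exp (b * norm Y)) (tf_shift Y g)"
    using gs_bound_tf_shift_exp[OF g zero_less_one, of 0] by blast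
  have le: "cmod (iter_partial js (tf_shift Y g) y) \<le> (C * fact (length js)) * exp (b * norm Y)" for js Y y
    using gs_boundD[OF C, of js Y y] by (simp add: mult_ac)
  have m[measurable]: "(\<lambda>Y. iter_partial js (tf_shift Y g) y) \<in> borel_measurable borel" for js y
    by (rule borel_measurable_continuous_onI[OF tf_shift_continuous[OF g]])
  have dom: "\<exists>E\<ge>0. \<forall>Y y. cmod (k Y * iter_partial js (tf_shift Y g) y) \<le> E * exp (- (1 * norm Y))" for js
  proof -
    obtain E where E: "E \<ge> 0" "\<And>Y. cmod (k Y) * ((C * fact (length js)) * exp (b * norm Y)) \<le> E * exp (- (1 * norm Y))"
      using exp_decay_mult[OF kd] by meson
    have "cmod (k Y * iter_partial js (tf_shift Y g) y) \<le> E * exp (- (1 * norm Y))" for Y y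
      unfolding norm_mult by (rule order_trans[OF mult_left_mono[OF le] E(2)]) simp
    then show ?thesis using E(1) by blast
  qed
  have "partial i (\<lambda>y. \<integral>Y. k Y * iter_partial is (tf_shift Y g) y \<partial>lborel) y = (\<integral>Y. k Y * iter_partial (i # is) (tf_shift Y g) y \<partial>lborel)" for y
  proof (rule partial_eqI)
    obtain E1 where E1: "\<And>Y y. cmod (k Y * iter_partial is (tf_shift Y g) y) \<le> E1 * exp (- (1 * norm Y))" using dom by meson
    obtain E2 where E2: "\<And>Y y. cmod (k Y * iter_partial (i # is) (tf_shift Y g) y) \<le> E2 * exp (- (1 * norm Y))" using dom by meson
    have "((\<lambda>t. \<integral>Y. k Y * iter_partial is (tf_shift Y g) (y + t *\<^sub>R axis i 1) \<partial>lborel) has_vector_derivative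
       (\<integral>Y. k Y * iter_partial (i # is) (tf_shift Y g) (y + 0 *\<^sub>R axis i 1) \<partial>lborel)) (at 0)"
    proof (rule has_vector_derivative_integral[where F = "\<lambda>t Y. k Y * iter_partial is (tf_shift Y g) (y + t *\<^sub>R axis i 1)"
          and F' = "\<lambda>t Y. k Y * iter_partial (i # is) (tf_shift Y g) (y + t *\<^sub>R axis i 1)"
          and w = "\<lambda>Y. E2 * exp (- (1 * norm Y))"])
      fix t Y
      have "((\<lambda>t. iter_partial is (tf_shift Y g) (y + t *\<^sub>R axis i 1)) has_vector_derivative
          iter_partial (i # is) (tf_shift Y g) (y + t *\<^sub>R axis i 1)) (at t)"
        using partial_has_vector_derivative[OF smoothD[OF smooth_tf_shift[OF gs_space_smooth[OF g]]]] by simp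
      then show "((\<lambda>t. k Y * iter_partial is (tf_shift Y g) (y + t *\<^sub>R axis i 1)) has_vector_derivative
          k Y * iter_partial (i # is) (tf_shift Y g) (y + t *\<^sub>R axis i 1)) (at t)"
        by (rule has_vector_derivative_mult_right)
    next
      fix t
      show "integrable lborel (\<lambda>Y. k Y * iter_partial is (tf_shift Y g) (y + t *\<^sub>R axis i 1))"
        by (rule exp_decay_integrable[OF _ E1]) measurable
    next
      show "integrable lborel (\<lambda>Y :: (real^'n) \<times> (real^'n). E2 * exp (- (1 * norm Y)))"
        by (intro integrable_mult_right integrable_exp_norm) simp
    next
      fix t Y show "cmod (k Y * iter_partial (i # is) (tf_shift Y g) (y + t *\<^sub>R axis i 1)) \<le> E2 * exp (- (1 * norm Y))"
        by (rule E2)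
    qed measurable
    then show "((\<lambda>t. \<integral>Y. k Y * iter_partial is (tf_shift Y g) (y + t *\<^sub>R axis i 1) \<partial>lborel) has_vector_derivative
       (\<integral>Y. k Y * iter_partial (i # is) (tf_shift Y g) y \<partial>lborel)) (at 0)" by simp
  qed
  then show ?case by (auto simp: Cons)
qed simp

text \<open>Replacing Y by a simple s Y turns the integral into a finite sum whose complex weights
  are the integrals of b over the cells of s. The same weights serve every \<Theta>, in particular
  the derivatives of the shifts and the values of a functional.\<close>

lemma integral_simple_function_compose:
  fixes b :: "'a \<Rightarrow> complex" and s :: "'a \<Rightarrow> 'b" and \<Theta> :: "'b \<Rightarrow> complex"
  assumes s: "simple_function M s" and b: "integrable M b"
  shows "(\<integral>Y. b Y * \<Theta> (s Y) \<partial>M) = (\<Sum>z\<in>s ` space M. (\<integral>Y. b Y * indicator (s -` {z} \<inter> space M) Y \<partial>M) * \<Theta> z)"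
    and "integrable M (\<lambda>Y. b Y * \<Theta> (s Y))"
proof -
  have fin: "finite (s ` space M)" by (rule simple_functionD(1)[OF s])
  have i: "integrable M (\<lambda>Y. b Y * indicator (s -` {z} \<inter> space M) Y)" for z
  proof -
    have "(\<lambda>Y. b Y * indicator (s -` {z} \<inter> space M) Y) = (\<lambda>Y. indicat_real (s -` {z} \<inter> space M) Y *\<^sub>R b Y)"
      by (auto simp: indicator_def)
    then show ?thesis
      using integrable_mult_indicator[OF simple_functionD(2)[OF s, of "{z}"] b] by simp
  qed
  have eq: "b Y * \<Theta> (s Y) = (\<Sum>z\<in>s ` space M. b Y * indicator (s -` {z} \<inter> space M) Y * \<Theta> z)" if Y: "Y \<in> space M" for Y
  proof -
    have "(\<Sum>z\<in>s ` space M. b Y * indicator (s -` {z} \<inter> space M) Y * \<Theta> z) =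
        (\<Sum>z\<in>s ` space M. if z = s Y then b Y * \<Theta> z else 0)"
      using Y by (intro sum.cong) (auto simp: indicator_def)
    also have "\<dots> = b Y * \<Theta> (s Y)" using fin Y by (simp add: sum.delta')
    finally show ?thesis by simp
  qed
  show "(\<integral>Y. b Y * \<Theta> (s Y) \<partial>M) = (\<Sum>z\<in>s ` space M. (\<integral>Y. b Y * indicator (s -` {z} \<inter> space M) Y \<partial>M) * \<Theta> z)"
    by (subst Bochner_Integration.integral_cong[OF refl eq]) (auto simp: i)
  show "integrable M (\<lambda>Y. b Y * \<Theta> (s Y))"
    by (subst Bochner_Integration.integrable_cong[OF refl eq]) (auto simp: i)
qed

section \<open>Functionals applied to time-frequency shifts\<close>

lemma gs_dual_tf_shift_bounds:
  fixes u :: "(real^'n::finite \<Rightarrow> complex) \<Rightarrow> complex"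
  assumes u: "u \<in> gs_dual" and g: "g \<in> gs_space"
  obtains h a K C b where "h > 0" "K \<ge> 0" "C \<ge> 0" "b \<ge> 0"
    "\<forall>f\<in>gs_space. \<forall>D. gs_bound h a D f \<longrightarrow> cmod (u f) \<le> K * D"
    "\<forall>Y. gs_bound h a (C * exp (b * norm Y)) (tf_shift Y g)"
    "\<forall>X Y. gs_bound h a (C * norm (X - Y) * exp (b * (norm X + norm Y))) (\<lambda>y. tf_shift X g y - tf_shift Y g y)"
proof -
  obtain h a K where h: "h > 0" and K: "K \<ge> 0" "\<And>f D. f \<in> gs_space \<Longrightarrow> gs_bound h a D f \<Longrightarrow> cmod (u f) \<le> K * D"
    using gs_dual_bound[OF u] by blast
  obtain C1 b1 where 1: "C1 \<ge> 0" "b1 \<ge> 0" "\<And>Y. gs_bound h a (C1 * exp (b1 * norm Y)) (tf_shift Y g)"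
    using gs_bound_tf_shift_exp[OF g h] by blast
  obtain C2 b2 where 2: "C2 \<ge> 0" "b2 \<ge> 0" "\<And>X Y. gs_bound h a (C2 * norm (X - Y) * exp (b2 * (norm X + norm Y))) (\<lambda>y. tf_shift X g y - tf_shift Y g y)"
    using gs_bound_tf_shift_diff[OF g h] by blast
  define C where "C = max C1 C2"
  define b where "b = max b1 b2"
  have le: "C1 \<le> C" "C2 \<le> C" "b1 \<le> b" "b2 \<le> b" by (simp_all add: C_def b_def)
  have C: "C \<ge> 0" using 1(1) le(1) by linarith
  have e: "exp (b1 * t) \<le> exp (b * t)" "exp (b2 * t) \<le> exp (b * t)" if "t \<ge> 0" for t
    using le that by (simp_all add: mult_right_mono)
  have A: "gs_bound h a (C * exp (b * norm Y)) (tf_shift Y g)" for Y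
    by (rule gs_bound_mono[OF 1(3) _ order_refl order_refl less_imp_le[OF h]], rule mult_mono[OF le(1) e(1)])
      (use C in simp_all)
  have B: "gs_bound h a (C * norm (X - Y) * exp (b * (norm X + norm Y))) (\<lambda>y. tf_shift X g y - tf_shift Y g y)" for X Y
    by (rule gs_bound_mono[OF 2(3) _ order_refl order_refl less_imp_le[OF h]],
        rule mult_mono[OF mult_right_mono[OF le(2)] e(2)])
      (use C in simp_all)
  have "b \<ge> 0" using 1(2) le(3) by linarith
  then show ?thesis by (rule that[OF h K(1) C]) (use K(2) in blast, (intro allI A B)+)
qed

lemma gs_dual_tf_shift_regular:
  fixes u :: "(real^'n::finite \<Rightarrow> complex) \<Rightarrow> complex"
  assumes u: "u \<in> gs_dual" and g: "g \<in> gs_space"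
  shows "continuous_on UNIV (\<lambda>Y. u (tf_shift Y g))"
    and "\<exists>D B. \<forall>Y. cmod (u (tf_shift Y g)) \<le> D * exp (B * norm Y)"
proof -
  obtain h a K C b where h: "h > 0" and K: "K \<ge> 0" and C: "C \<ge> 0" and b: "b \<ge> 0"
    and *: "\<forall>f\<in>gs_space. \<forall>D. gs_bound h a D f \<longrightarrow> cmod (u f) \<le> K * D"
      "\<forall>Y. gs_bound h a (C * exp (b * norm Y)) (tf_shift Y g)"
      "\<forall>X Y. gs_bound h a (C * norm (X - Y) * exp (b * (norm X + norm Y))) (\<lambda>y. tf_shift X g y - tf_shift Y g y)"
    by (rule gs_dual_tf_shift_bounds[OF u g])
  have uK: "cmod (u f) \<le> K * D" if "f \<in> gs_space" "gs_bound h a D f" for f D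
    using *(1) that by blast
  have B1: "gs_bound h a (C * exp (b * norm Y)) (tf_shift Y g)" for Y using *(2) by blast
  have B2: "gs_bound h a (C * norm (X - Y) * exp (b * (norm X + norm Y))) (\<lambda>y. tf_shift X g y - tf_shift Y g y)" for X Y
    using *(3) by blast
  define U where "U Y = u (tf_shift Y g)" for Y
  have gsY: "tf_shift Y g \<in> gs_space" for Y by (rule gs_space_tf_shift[OF g])
  define R where "R X Y = C * norm (X - Y) * exp (b * (norm X + norm Y))" for X Y :: "(real^'n) \<times> (real^'n)"
  have Ud: "cmod (U X - U Y) \<le> K * R X Y" for X Y
    using uK[OF gs_dual_diff(1)[OF u gsY gsY] B2, of X Y] gs_dual_diff(2)[OF u gsY gsY, of X Y]
    by (simp add: U_def R_def)
  have Uc: "continuous_on UNIV U"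
    unfolding continuous_on_def
  proof (intro ballI)
    fix X
    have "((\<lambda>Y. K * R Y X) \<longlongrightarrow> K * (C * norm (X - X) * exp (b * (norm X + norm X)))) (at X)"
      unfolding R_def by (intro tendsto_intros)
    then have "((\<lambda>Y. U Y - U X) \<longlongrightarrow> 0) (at X)"
      by (intro Lim_null_comparison[OF always_eventually[OF allI[OF Ud]]]) simp
    then show "(U \<longlongrightarrow> U X) (at X within UNIV)" by (simp add: Lim_null[symmetric])
  qed
  then show "continuous_on UNIV (\<lambda>Y. u (tf_shift Y g))" by (simp add: U_def[abs_def])
  have "cmod (U Y) \<le> (K * C) * exp (b * norm Y)" for Y
    using uK[OF gsY B1, of Y] by (simp add: U_def mult.assoc)
  then show "\<exists>D B. \<forall>Y. cmod (u (tf_shift Y g)) \<le> D * exp (B * norm Y)"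
    unfolding U_def by blast
qed

text \<open>The integral is approximated by finite sums \<open>S n\<close> of shifts, through which
  u passes by linearity. The error in f, measured by \<open>gs_bound\<close>, and the error in the
  scalar integral are both controlled by \<open>e n\<close>, which tends to 0 by dominated
  convergence.\<close>

lemma gs_dual_integral:
  fixes u :: "(real^'n::finite \<Rightarrow> complex) \<Rightarrow> complex"
  assumes u: "u \<in> gs_dual" and g: "g \<in> gs_space" and f: "f \<in> gs_space"
    and k[measurable]: "k \<in> borel_measurable borel"
    and kd: "\<And>A. \<exists>C. \<forall>Y. cmod (k Y) \<le> C * exp (- (A * norm Y))"
    and rep: "\<And>y. f y = (\<integral>Y. k Y * tf_shift Y g y \<partial>lborel)"
  shows "integrable lborel (\<lambda>Y. k Y * u (tf_shift Y g))" and "u f = (\<integral>Y. k Y * u (tf_shift Y g) \<partial>lborel)"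
proof -
  obtain h a K C b where h: "h > 0" and K: "K \<ge> 0" and C: "C \<ge> 0" and b: "b \<ge> 0"
    and *: "\<forall>f\<in>gs_space. \<forall>D. gs_bound h a D f \<longrightarrow> cmod (u f) \<le> K * D"
      "\<forall>Y. gs_bound h a (C * exp (b * norm Y)) (tf_shift Y g)"
      "\<forall>X Y. gs_bound h a (C * norm (X - Y) * exp (b * (norm X + norm Y))) (\<lambda>y. tf_shift X g y - tf_shift Y g y)"
    by (rule gs_dual_tf_shift_bounds[OF u g])
  have uK: "cmod (u f) \<le> K * D" if "f \<in> gs_space" "gs_bound h a D f" for f D
    using *(1) that by blast
  have B1: "gs_bound h a (C * exp (b * norm Y)) (tf_shift Y g)" for Y using *(2) by blast
  have B2: "gs_bound h a (C * norm (X - Y) * exp (b * (norm X + norm Y))) (\<lambda>y. tf_shift X g y - tf_shift Y g y)" for X Y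
    using *(3) by blast
  define U where "U Y = u (tf_shift Y g)" for Y
  have gsY: "tf_shift Y g \<in> gs_space" for Y by (rule gs_space_tf_shift[OF g])
  note sm = smooth_tf_shift[OF gs_space_smooth[OF g]]
  \<comment> \<open>A common modulus of continuity in the shift parameter, for the test functions
    and for their images under u.\<close>
  define R where "R X Y = C * norm (X - Y) * exp (b * (norm X + norm Y))" for X Y :: "(real^'n) \<times> (real^'n)"
  have Ud: "cmod (U X - U Y) \<le> K * R X Y" for X Y
    using uK[OF gs_dual_diff(1)[OF u gsY gsY] B2, of X Y] gs_dual_diff(2)[OF u gsY gsY, of X Y]
    by (simp add: U_def R_def)
  have "continuous_on UNIV U" unfolding U_def by (rule gs_dual_tf_shift_regular(1)[OF u g])
  then have [measurable]: "U \<in> borel_measurable borel" by (rule borel_measurable_continuous_onI)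
  obtain D B where Ub: "\<And>Y. cmod (U Y) \<le> D * exp (B * norm Y)"
    unfolding U_def using gs_dual_tf_shift_regular(2)[OF u g] by blast
  have kU: "integrable lborel (\<lambda>Y. k Y * U Y)"
  proof -
    obtain E where E: "\<And>Y. cmod (k Y) * (D * exp (B * norm Y)) \<le> E * exp (- (1 * norm Y))"
      using exp_decay_mult[OF kd] by meson
    have "cmod (k Y * U Y) \<le> E * exp (- (1 * norm Y))" for Y
      unfolding norm_mult by (rule order_trans[OF mult_left_mono[OF Ub] E]) simp
    then show ?thesis by (intro exp_decay_integrable) measurable
  qed
  then show "integrable lborel (\<lambda>Y. k Y * u (tf_shift Y g))" by (simp add: U_def)
  obtain E0 where E0: "\<And>Y. cmod (k Y) \<le> E0 * exp (- (1 * norm Y))" using kd[of 1] by auto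
  have ki: "integrable lborel k" by (rule exp_decay_integrable[OF k E0])
  \<comment> \<open>If norm Z \<le> 2 norm Y, then both norm (Y - Z) and norm Y + norm Z are at most
    3 norm Y, which explains the two factors 3; the summand 1 pays for replacing the linear factor
    norm Y by an exponential.\<close>
  obtain E1 where E1: "E1 \<ge> 0" "\<And>Y. cmod (k Y) * ((3 * C) * exp ((3 * b + 1) * norm Y)) \<le> E1 * exp (- (1 * norm Y))"
    using exp_decay_mult[OF kd] by meson
  have RW: "cmod (k Y) * R Y Z \<le> E1 * exp (- (1 * norm Y))" if Z: "norm Z \<le> 2 * norm Y" for Y Z
  proof -
    have "norm (Y - Z) \<le> 3 * norm Y" using norm_triangle_ineq4[of Y Z] Z by linarith
    also have "\<dots> \<le> 3 * exp (norm Y)" using exp_ge_add_one_self[of "norm Y"] by linarith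
    finally have 1: "norm (Y - Z) \<le> 3 * exp (norm Y)" .
    have "b * (norm Y + norm Z) \<le> b * (3 * norm Y)" using Z b by (intro mult_left_mono) auto
    then have 2: "exp (b * (norm Y + norm Z)) \<le> exp (b * (3 * norm Y))" by simp
    have "R Y Z \<le> C * (3 * exp (norm Y)) * exp (b * (3 * norm Y))"
      unfolding R_def using C by (intro mult_mono 2 mult_left_mono 1) auto
    also have "\<dots> = (3 * C) * (exp (norm Y) * exp (b * (3 * norm Y)))" by simp
    also have "exp (norm Y) * exp (b * (3 * norm Y)) = exp ((3 * b + 1) * norm Y)"
      by (simp add: exp_add[symmetric] algebra_simps)
    finally show ?thesis using E1(2)[of Y] by (meson mult_left_mono norm_ge_zero order_trans)
  qed
  \<comment> \<open>The identity map is approximated by simple functions; their growth bound makes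
    the dominating function independent of n.\<close>
  have "(\<lambda>x :: (real^'n) \<times> (real^'n). x) \<in> borel_measurable lborel" by simp
  from borel_measurable_implies_sequence_metric[OF this, of 0]
  obtain s :: "nat \<Rightarrow> (real^'n) \<times> (real^'n) \<Rightarrow> (real^'n) \<times> (real^'n)" where
    s: "\<And>n. simple_function lborel (s n)" "\<And>Y. (\<lambda>n. s n Y) \<longlonglongrightarrow> Y"
    "\<And>n Y. norm (s n Y) \<le> 2 * norm Y"
    unfolding dist_norm diff_zero by (metis UNIV_I space_borel space_lborel)
  have [measurable]: "s n \<in> borel_measurable borel" for n
    using borel_measurable_simple_function[OF s(1)[of n]] by simp
  define e where "e n = (\<integral>Y. cmod (k Y) * R Y (s n Y) \<partial>lborel)" for n
  have Rm[measurable]: "(\<lambda>Y. R Y (s n Y)) \<in> borel_measurable borel" for n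
    unfolding R_def by measurable
  have ei: "integrable lborel (\<lambda>Y. cmod (k Y) * R Y (s n Y))" for n
  proof (rule Bochner_Integration.integrable_bound[OF integrable_mult_right[OF integrable_exp_norm[of 1], of E1]])
    show "AE Y in lborel. norm (cmod (k Y) * R Y (s n Y)) \<le> norm (E1 * exp (- (1 * norm Y)))"
      using RW s(3) E1(1) C by (intro AE_I2) (simp add: abs_mult R_def)
  qed auto
  have e0: "e \<longlonglongrightarrow> 0"
  proof -
    have "(\<lambda>n. \<integral>Y. cmod (k Y) * R Y (s n Y) \<partial>lborel) \<longlonglongrightarrow> (\<integral>Y. 0 \<partial>(lborel :: ((real^'n) \<times> (real^'n)) measure))"
    proof (rule integral_dominated_convergence[where w = "\<lambda>Y. E1 * exp (- (1 * norm Y))"])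
      show "integrable lborel (\<lambda>Y :: (real^'n) \<times> (real^'n). E1 * exp (- (1 * norm Y)))"
        by (intro integrable_mult_right integrable_exp_norm) simp
      show "AE Y in lborel. (\<lambda>n. cmod (k Y) * R Y (s n Y)) \<longlonglongrightarrow> 0"
      proof (rule AE_I2)
        fix Y
        have "(\<lambda>n. cmod (k Y) * R Y (s n Y)) \<longlonglongrightarrow> cmod (k Y) * (C * norm (Y - Y) * exp (b * (norm Y + norm Y)))"
          unfolding R_def by (intro tendsto_intros s(2))
        then show "(\<lambda>n. cmod (k Y) * R Y (s n Y)) \<longlonglongrightarrow> 0" by simp
      qed
      show "AE Y in lborel. norm (cmod (k Y) * R Y (s n Y)) \<le> E1 * exp (- (1 * norm Y))" for n
        using RW s(3) C by (intro AE_I2) (simp add: abs_mult R_def)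
    qed measurable
    then show ?thesis by (simp add: e_def[abs_def])
  qed
  define c where "c n z = (\<integral>Y. k Y * indicator (s n -` {z} \<inter> space lborel) Y \<partial>lborel)" for n z
  define S where "S n = (\<lambda>y. \<Sum>z\<in>s n ` space lborel. c n z * tf_shift z g y)" for n
  have fin: "finite (s n ` space lborel)" for n by (rule simple_functionD(1)[OF s(1)])
  have sum: "(\<integral>Y. k Y * \<Theta> (s n Y) \<partial>lborel) = (\<Sum>z\<in>s n ` space lborel. c n z * \<Theta> z)" for \<Theta> n
    unfolding c_def by (rule integral_simple_function_compose(1)[OF s(1) ki])
  have "S n \<in> gs_space \<and> u (S n) = (\<Sum>z\<in>s n ` space lborel. c n z * u (tf_shift z g))" for n
    unfolding S_def by (rule gs_dual_sum[OF u fin gsY])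
  then have Sgs: "S n \<in> gs_space" and uS: "u (S n) = (\<integral>Y. k Y * U (s n Y) \<partial>lborel)" for n
    unfolding sum[of U n] unfolding U_def by blast+
  \<comment> \<open>The constant is the same for all derivatives and all points, because R involves
    neither; with h and a taken from u, this is convergence in the sense in which u is
    continuous.\<close>
  have bound: "gs_bound h a (e n) (\<lambda>y. f y - S n y)" for n
    unfolding gs_bound_def
  proof (intro allI)
    fix "is" :: "'n list" and y :: "real^'n"
    let ?\<psi> = "\<lambda>Y. iter_partial is (tf_shift Y g) y" and ?L = "h ^ length is * fact (length is) * exp (- (a * norm y))"
    have L: "?L \<ge> 0" using h by simp
    have [measurable]: "?\<psi> \<in> borel_measurable borel"
      by (rule borel_measurable_continuous_onI[OF tf_shift_continuous[OF g]])
    have fs: "f = (\<lambda>y. \<integral>Y. k Y * tf_shift Y g y \<partial>lborel)" using rep by auto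
    have 1: "iter_partial is f y = (\<integral>Y. k Y * ?\<psi> Y \<partial>lborel)"
      unfolding fs iter_partial_integral_tf_shift[OF g k kd] ..
    have 2: "iter_partial is (S n) y = (\<integral>Y. k Y * ?\<psi> (s n Y) \<partial>lborel)"
      unfolding S_def sum[of ?\<psi> n]
      using iter_partial_sum[where S = "s n ` space lborel" and F = "\<lambda>z. tf_shift z g" and c = "c n", OF fin sm]
      by (metis (no_types, lifting))
    have i1: "integrable lborel (\<lambda>Y. k Y * ?\<psi> Y)"
    proof -
      obtain E where E: "\<And>Y. cmod (k Y) * ((C * ?L) * exp (b * norm Y)) \<le> E * exp (- (1 * norm Y))"
        using exp_decay_mult[OF kd] by meson
      have "cmod (?\<psi> Y) \<le> (C * ?L) * exp (b * norm Y)" for Y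
        using gs_boundD[OF B1, of "is" Y y] by (simp add: mult_ac)
      then have "cmod (k Y * ?\<psi> Y) \<le> E * exp (- (1 * norm Y))" for Y
        unfolding norm_mult by (intro order_trans[OF mult_left_mono E]) auto
      then show ?thesis by (intro exp_decay_integrable) measurable
    qed
    have i2: "integrable lborel (\<lambda>Y. k Y * ?\<psi> (s n Y))"
      by (rule integral_simple_function_compose(2)[OF s(1) ki])
    have d\<psi>: "cmod (?\<psi> X - ?\<psi> Y) \<le> R X Y * ?L" for X Y
    proof -
      have "iter_partial is (\<lambda>y. tf_shift X g y - tf_shift Y g y) y = ?\<psi> X - ?\<psi> Y"
        using iter_partial_add[OF sm[of X] smooth_cmult[OF sm[of Y], of "-1"], of "is"]
          iter_partial_cmult[OF sm[of Y], of "is" "-1"] by simp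
      then show ?thesis using gs_boundD[OF B2, of "is" X Y y] by (simp add: R_def mult.assoc)
    qed
    have "iter_partial is (\<lambda>y. f y - S n y) y = iter_partial is f y - iter_partial is (S n) y"
      using iter_partial_add[OF gs_space_smooth[OF f] smooth_cmult[OF gs_space_smooth[OF Sgs[of n]], of "-1"], of "is"]
        iter_partial_cmult[OF gs_space_smooth[OF Sgs[of n]], of "is" "-1"] by simp
    also have "\<dots> = (\<integral>Y. k Y * ?\<psi> Y - k Y * ?\<psi> (s n Y) \<partial>lborel)"
      unfolding 1 2 by (rule Bochner_Integration.integral_diff[OF i1 i2, symmetric])
    finally have "cmod (iter_partial is (\<lambda>y. f y - S n y) y) = cmod (\<integral>Y. k Y * ?\<psi> Y - k Y * ?\<psi> (s n Y) \<partial>lborel)" by simp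
    also have "\<dots> \<le> (\<integral>Y. (cmod (k Y) * R Y (s n Y)) * ?L \<partial>lborel)"
    proof (rule Bochner_Integration.integral_norm_bound_integral)
      fix Y
      have "cmod (k Y * ?\<psi> Y - k Y * ?\<psi> (s n Y)) = cmod (k Y) * cmod (?\<psi> Y - ?\<psi> (s n Y))"
        by (simp add: norm_mult[symmetric] right_diff_distrib)
      also have "\<dots> \<le> cmod (k Y) * (R Y (s n Y) * ?L)" by (intro mult_left_mono d\<psi>) simp
      finally show "cmod (k Y * ?\<psi> Y - k Y * ?\<psi> (s n Y)) \<le> (cmod (k Y) * R Y (s n Y)) * ?L"
        by (simp only: mult.assoc)
    qed (use i1 i2 ei in auto)
    also have "\<dots> = e n * ?L" by (simp add: e_def)
    finally show "cmod (iter_partial is (\<lambda>y. f y - S n y) y) \<le>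
        e n * (h ^ length is * fact (length is)) * exp (- (a * norm y))" by (simp only: mult.assoc)
  qed
  have "cmod (u f - (\<integral>Y. k Y * U Y \<partial>lborel)) \<le> 2 * K * e n" for n
  proof -
    have i2: "integrable lborel (\<lambda>Y. k Y * U (s n Y))"
      by (rule integral_simple_function_compose(2)[OF s(1) ki])
    have A: "cmod (u f - u (S n)) \<le> K * e n"
      using uK[OF gs_dual_diff(1)[OF u f Sgs] bound] gs_dual_diff(2)[OF u f Sgs] by simp
    have "cmod (\<integral>Y. k Y * U (s n Y) - k Y * U Y \<partial>lborel) \<le> (\<integral>Y. K * (cmod (k Y) * R Y (s n Y)) \<partial>lborel)"
    proof (rule Bochner_Integration.integral_norm_bound_integral)
      fix Y
      have "cmod (k Y * U (s n Y) - k Y * U Y) = cmod (k Y) * cmod (U Y - U (s n Y))"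
        by (simp add: norm_mult[symmetric] right_diff_distrib norm_minus_commute)
      also have "\<dots> \<le> cmod (k Y) * (K * R Y (s n Y))" by (intro mult_left_mono Ud) simp
      finally show "cmod (k Y * U (s n Y) - k Y * U Y) \<le> K * (cmod (k Y) * R Y (s n Y))"
        by (simp only: mult_ac)
    qed (use i2 kU ei in auto)
    then have "cmod (u (S n) - (\<integral>Y. k Y * U Y \<partial>lborel)) \<le> K * e n"
      unfolding uS Bochner_Integration.integral_diff[OF i2 kU] by (simp add: e_def)
    with A norm_triangle_ineq[of "u f - u (S n)" "u (S n) - (\<integral>Y. k Y * U Y \<partial>lborel)"]
    show ?thesis by simp
  qed
  moreover have "(\<lambda>n. 2 * K * e n) \<longlonglongrightarrow> 2 * K * 0" by (intro tendsto_intros e0)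
  ultimately have "cmod (u f - (\<integral>Y. k Y * U Y \<partial>lborel)) \<le> 2 * K * 0"
    by (intro LIMSEQ_le_const) auto
  then show "u f = (\<integral>Y. k Y * u (tf_shift Y g) \<partial>lborel)" by (simp add: U_def)
qed

section \<open>Moderate weights\<close>

text \<open>A bound on the unit ball is iterated along the segment from 0 to x. Local boundedness is
  given only almost everywhere, and submultiplicativity itself extends it to every point.\<close>

lemma submultiplicative_exp_bound:
  fixes v :: "'a::euclidean_space \<Rightarrow> real"
  assumes w: "weight v" and sub: "submultiplicative v"
  shows "\<exists>C>0. \<exists>b\<ge>0. \<forall>x. v x \<le> C * exp (b * norm x)"
proof -
  have v0: "v x > 0" for x using w by (simp add: weight_def)
  obtain c where c: "c > 0" and sm: "\<And>x y. v (x + y) \<le> c * (v x * v y)"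
    using sub by (auto simp: submultiplicative_def)
  have "Linf_loc v" using w by (simp add: weight_def)
  then obtain M where M: "AE y in lebesgue. y \<in> cball 0 2 \<longrightarrow> \<bar>v y\<bar> \<le> M"
    unfolding Linf_loc_def by (meson compact_cball)
  then obtain N where N: "N \<in> null_sets lebesgue" "{y. \<not> (y \<in> cball 0 2 \<longrightarrow> \<bar>v y\<bar> \<le> M)} \<subseteq> N"
    by (auto simp: eventually_ae_filter)
  have vM: "v y \<le> M" if "y \<notin> N" "norm y \<le> 2" for y
  proof -
    have "y \<in> cball 0 2 \<longrightarrow> \<bar>v y\<bar> \<le> M" using N(2) that(1) by blast
    then show ?thesis using that(2) by simp
  qed
  have neg: "negligible N" using N(1) by (simp add: negligible_iff_null_sets)
  \<comment> \<open>x is split into y and x - y, both of norm at most 2 and outside the exceptional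
    null set N. Such a y exists because N and its reflection x - N are null sets and cannot cover a
    ball.\<close>
  have loc: "v x \<le> c * (M * M)" if x: "norm x \<le> 1" for x
  proof -
    have "negligible ((\<lambda>y. x - y) ` N)"
      by (rule negligible_differentiable_image_negligible[OF order_refl neg])
        (intro differentiable_on_diff differentiable_on_const differentiable_on_ident)
    then have "negligible (N \<union> (\<lambda>y. x - y) ` N)" using neg by simp
    moreover have "\<not> negligible (ball (0 :: 'a) 1)" by (intro open_not_negligible) auto
    ultimately have "\<not> ball 0 1 \<subseteq> N \<union> (\<lambda>y. x - y) ` N"
      using negligible_subset by blast
    then obtain y where "y \<in> ball 0 1" and "y \<notin> N" "y \<notin> (\<lambda>y. x - y) ` N" by blast
    then have y: "norm y < 1" "y \<notin> N" "y \<notin> (\<lambda>y. x - y) ` N" by (simp, blast, blast)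
    have xy: "x - y \<notin> N"
    proof
      assume "x - y \<in> N"
      then have "x - (x - y) \<in> (\<lambda>y. x - y) ` N" by blast
      then show False using y(3) by simp
    qed
    have "norm (x - y) \<le> 2" using norm_triangle_ineq4[of x y] x y(1) by linarith
    then have "v (x - y) \<le> M" using vM xy by blast
    moreover have "v y \<le> M" using vM y by simp
    ultimately have "v y * v (x - y) \<le> M * M"
      using v0[of y] v0[of "x - y"] by (intro mult_mono) auto
    then show ?thesis using sm[of y "x - y"] c by (smt (verit) add_diff_cancel_left' add.commute diff_add_cancel mult_left_mono)
  qed
  \<comment> \<open>L bounds v on the unit ball, which starts the induction, and also
    \<open>c * v z\<close> there, the factor gained in each step; L \<ge> 1 makes its logarithm
    nonnegative.\<close>
  define L where "L = max 1 (max (c * (M * M)) (c * (c * (M * M))))"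
  have L: "L \<ge> 1" "c * (M * M) \<le> L" "c * (c * (M * M)) \<le> L" by (auto simp: L_def)
  have pow: "v (real n *\<^sub>R z) \<le> L * L ^ n" if z: "norm z \<le> 1" for n z
  proof (induction n)
    case 0
    show ?case using loc[of 0] L by simp
  next
    case (Suc n)
    have "v (real (Suc n) *\<^sub>R z) = v (real n *\<^sub>R z + z)" by (simp add: algebra_simps)
    also have "\<dots> \<le> c * (v (real n *\<^sub>R z) * v z)" by (rule sm)
    also have "\<dots> = v (real n *\<^sub>R z) * (c * v z)" by simp
    also have "\<dots> \<le> (L * L ^ n) * L"
    proof (intro mult_mono Suc.IH)
      have "c * v z \<le> c * (c * (M * M))" using c loc[OF z] by (intro mult_left_mono) auto
      then show "c * v z \<le> L" using L by linarith
    qed (use L c v0[of z] in auto)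
    finally show ?case by (simp add: mult_ac)
  qed
  have "v x \<le> (L * L) * exp (ln L * norm x)" for x
  proof (cases "x = 0")
    case True
    have "L * 1 \<le> L * L" using L by (intro mult_left_mono) auto
    then show ?thesis using pow[of 0 0] True by simp
  next
    case False
    \<comment> \<open>n steps of length at most 1, with n at most norm x + 1; this excess produces
      the second factor L.\<close>
    define n where "n = nat \<lceil>norm x\<rceil>"
    have "0 \<le> \<lceil>norm x\<rceil>" using norm_ge_zero[of x] by linarith
    then have "real n = of_int \<lceil>norm x\<rceil>" by (simp add: n_def)
    then have n: "norm x \<le> real n" "real n \<le> norm x + 1" by linarith+
    have n0: "real n > 0" using n False by (metis less_le_trans zero_less_norm_iff)
    have "v x = v (real n *\<^sub>R ((1 / real n) *\<^sub>R x))" using n0 by simp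
    also have "\<dots> \<le> L * L ^ n" by (rule pow) (use n n0 in \<open>simp add: divide_le_eq\<close>)
    also have "L ^ n = exp (ln L * real n)" using L by (simp add: exp_of_nat_mult[symmetric] mult.commute flip: ln_realpow)
    also have "\<dots> \<le> exp (ln L * (norm x + 1))" using n L by (simp add: mult_left_mono)
    also have "\<dots> = L * exp (ln L * norm x)" using L by (simp add: distrib_left exp_add)
    finally show ?thesis using L by (simp add: mult.assoc)
  qed
  moreover have "L * L > 0" "ln L \<ge> 0" using L by auto
  ultimately show ?thesis by blast
qed

text \<open>Sections of a Lebesgue measurable weight need not be measurable. Mixed quasi-norms are
  therefore estimated with an equivalent continuous weight.\<close>

lemma equivalent_continuous_weight:
  fixes \<omega> v :: "'a::euclidean_space \<Rightarrow> real"
  assumes \<omega>: "weight \<omega>" and v: "weight v" "submultiplicative v" and mod: "moderate v \<omega>"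
  shows "\<exists>w C b. C > 0 \<and> b \<ge> 0 \<and> continuous_on UNIV w \<and> (\<forall>X. 0 < w X) \<and> (\<forall>X. w X \<le> \<omega> X) \<and>
    (\<forall>X. \<omega> X \<le> C * w X) \<and> (\<forall>X Y. w X \<le> w Y * exp (b * norm (X - Y)))"
proof -
  have \<omega>0: "\<omega> X > 0" for X using \<omega> by (simp add: weight_def)
  obtain D b where D: "D > 0" and b: "b \<ge> 0" and vb: "\<And>x. v x \<le> D * exp (b * norm x)"
    using submultiplicative_exp_bound[OF v] by blast
  obtain c where c: "c > 0" and cm: "\<And>x y. \<omega> (x + y) \<le> c * (\<omega> x * v y)"
    using mod by (auto simp: moderate_def)
  define C where "C = c * D"
  have C: "C > 0" using c D by (simp add: C_def)
  have \<omega>C: "\<omega> X \<le> C * (\<omega> Y * exp (b * norm (X - Y)))" for X Y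
  proof -
    have "\<omega> X \<le> c * (\<omega> Y * v (X - Y))" using cm[of Y "X - Y"] by simp
    also have "\<dots> \<le> c * (\<omega> Y * (D * exp (b * norm (X - Y))))"
      using c \<omega>0[of Y] vb by (intro mult_left_mono) auto
    finally show ?thesis by (simp add: C_def mult_ac)
  qed
  \<comment> \<open>A multiplicative infimal convolution: the largest minorant of \<omega> that
    grows at most by the factor exp (b |X - Y|) from Y to X. Exchanging X and Y gives
    continuity.\<close>
  define w where "w X = (INF Y. \<omega> Y * exp (b * norm (X - Y)))" for X
  have lower: "\<omega> X / C \<le> \<omega> Y * exp (b * norm (X - Y))" for X Y
    using \<omega>C[of X Y] C by (simp add: divide_le_eq mult.commute)
  have bdd: "bdd_below (range (\<lambda>Y. \<omega> Y * exp (b * norm (X - Y))))" for X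
    using lower[of X] by (auto intro!: bdd_belowI[of _ "\<omega> X / C"])
  have w1: "\<omega> X \<le> C * w X" for X
  proof -
    have "\<omega> X / C \<le> w X" unfolding w_def by (rule cINF_greatest) (use lower in auto)
    then show ?thesis using C by (simp add: divide_le_eq mult.commute)
  qed
  have w2: "w X \<le> \<omega> Y * exp (b * norm (X - Y))" for X Y
    unfolding w_def by (rule cINF_lower[OF bdd]) simp
  have w3: "w X \<le> \<omega> X" for X using w2[of X X] by simp
  have w0: "w X > 0" for X
    using w1[of X] \<omega>0[of X] C by (smt (verit) mult_nonneg_nonpos)
  have w4: "w X \<le> w Y * exp (b * norm (X - Y))" for X Y
  proof -
    have "w X * exp (- (b * norm (X - Y))) \<le> w Y"
      unfolding w_def[of Y]
    proof (rule cINF_greatest)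
      fix Z
      have "norm (X - Z) \<le> norm (X - Y) + norm (Y - Z)"
        using norm_triangle_ineq[of "X - Y" "Y - Z"] by simp
      then have "b * norm (X - Z) \<le> b * norm (X - Y) + b * norm (Y - Z)"
        using b by (metis distrib_left mult_left_mono)
      then have "exp (b * norm (X - Z)) * exp (- (b * norm (X - Y))) \<le> exp (b * norm (Y - Z))"
        by (simp add: exp_add[symmetric])
      then have "\<omega> Z * (exp (b * norm (X - Z)) * exp (- (b * norm (X - Y)))) \<le> \<omega> Z * exp (b * norm (Y - Z))"
        using \<omega>0[of Z] by (intro mult_left_mono) auto
      moreover have "w X * exp (- (b * norm (X - Y))) \<le> (\<omega> Z * exp (b * norm (X - Z))) * exp (- (b * norm (X - Y)))"
        by (intro mult_right_mono w2) auto
      ultimately show "w X * exp (- (b * norm (X - Y))) \<le> \<omega> Z * exp (b * norm (Y - Z))"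
        unfolding mult.assoc by (rule order_trans[rotated])
    qed auto
    then have "w X * exp (- (b * norm (X - Y))) * exp (b * norm (X - Y)) \<le> w Y * exp (b * norm (X - Y))"
      by (intro mult_right_mono) auto
    then show ?thesis by (simp add: mult.assoc exp_add[symmetric])
  qed
  have "continuous_on UNIV w"
    unfolding continuous_on_def
  proof (intro ballI)
    fix X
    have "((\<lambda>Y. w X * exp (- (b * norm (X - Y)))) \<longlongrightarrow> w X * exp (- (b * norm (X - X)))) (at X)"
      by (intro tendsto_intros)
    moreover have "((\<lambda>Y. w X * exp (b * norm (Y - X))) \<longlongrightarrow> w X * exp (b * norm (X - X))) (at X)"
      by (intro tendsto_intros)
    moreover have "w X * exp (- (b * norm (X - Y))) \<le> w Y" for Y
    proof -
      have "w X * exp (- (b * norm (X - Y))) \<le> w Y * exp (b * norm (X - Y)) * exp (- (b * norm (X - Y)))"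
        by (intro mult_right_mono w4) simp
      then show ?thesis by (simp add: mult.assoc exp_add[symmetric])
    qed
    ultimately show "(w \<longlongrightarrow> w X) (at X within UNIV)"
      by (intro tendsto_sandwich[of "\<lambda>Y. w X * exp (- (b * norm (X - Y)))" w _ "\<lambda>Y. w X * exp (b * norm (Y - X))"])
        (use w4 in auto)
  qed
  then show ?thesis using C b w0 w1 w3 w4 by blast
qed

section \<open>Independence of the window\<close>

lemma stft_dual_eq:
  fixes \<phi> :: "real^'n::finite \<Rightarrow> complex"
  shows "stft_dual \<phi> u X = of_real ((2 * pi) powr (- (real CARD('n) / 2))) * u (tf_shift X (\<lambda>y. cnj (\<phi> y)))"
  by (simp add: stft_dual_def tf_shift_def split_beta')

lemma stft_dual_continuous:
  assumes "u \<in> gs_dual" "\<phi> \<in> gs_space"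
  shows "continuous_on UNIV (stft_dual \<phi> u)"
  unfolding stft_dual_eq[abs_def]
  by (intro continuous_intros gs_dual_tf_shift_regular(1) gs_space_cnj assms)

lemma stft_dual_growth:
  fixes \<phi> :: "real^'n::finite \<Rightarrow> complex"
  assumes "u \<in> gs_dual" "\<phi> \<in> gs_space"
  shows "\<exists>D B. \<forall>Y. cmod (stft_dual \<phi> u Y) \<le> D * exp (B * norm Y)"
proof -
  define c where "c = (2 * pi) powr (- (real CARD('n) / 2))"
  obtain D B where D: "\<And>Y. cmod (u (tf_shift Y (\<lambda>y. cnj (\<phi> y)))) \<le> D * exp (B * norm Y)"
    using gs_dual_tf_shift_regular(2)[OF assms(1) gs_space_cnj[OF assms(2)]] by blast
  have "cmod (stft_dual \<phi> u Y) \<le> c * D * exp (B * norm Y)" for Y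
    unfolding stft_dual_eq c_def[symmetric] norm_mult mult.assoc using D[of Y]
    by (intro mult_mono) (auto simp: c_def)
  then show ?thesis by blast
qed

text \<open>Time-frequency shifts compose up to phases, so shifting the expansion of one window by X
  translates the coefficient function by X and multiplies it by a factor of modulus 1. C depends on
  A and the windows only, not on u or X.\<close>

lemma stft_dual_convolution_bound:
  fixes \<phi>\<^sub>1 \<phi>\<^sub>2 :: "real^'n::finite \<Rightarrow> complex"
  assumes \<phi>\<^sub>1: "\<phi>\<^sub>1 \<in> gs_space" and \<phi>\<^sub>2: "\<phi>\<^sub>2 \<in> gs_space" "\<phi>\<^sub>2 \<noteq> (\<lambda>_. 0)"
  shows "\<exists>C :: real \<Rightarrow> real. (\<forall>A. C A \<ge> 0) \<and> (\<forall>A. \<forall>u\<in>gs_dual. \<forall>X. ennreal (cmod (stft_dual \<phi>\<^sub>1 u X)) \<le>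
     ennreal (C A) * (\<integral>\<^sup>+Y. ennreal (exp (- (A * norm (X - Y))) * cmod (stft_dual \<phi>\<^sub>2 u Y)) \<partial>lborel))"
proof -
  define g where "g y = cnj (\<phi>\<^sub>2 y)" for y
  define f where "f y = cnj (\<phi>\<^sub>1 y)" for y
  have gs: "g \<in> gs_space" "f \<in> gs_space"
    unfolding g_def[abs_def] f_def[abs_def] by (intro gs_space_cnj \<phi>\<^sub>1 \<phi>\<^sub>2(1))+
  obtain k where k[measurable]: "k \<in> borel_measurable borel"
    and kd: "\<And>A. \<exists>C. \<forall>Y. cmod (k Y) \<le> C * exp (- (A * norm Y))"
    and rep: "\<And>y. f y = (\<integral>Y. k Y * tf_shift Y g y \<partial>lborel)"
    using gs_space_reproducing[OF gs(2) \<phi>\<^sub>2] unfolding g_def[abs_def] by blast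
  obtain C where C: "\<And>A Y. cmod (k Y) \<le> C A * exp (- (A * norm Y))" using kd by metis
  have C0: "C A \<ge> 0" for A using order_trans[OF norm_ge_zero C[of 0 A]] by simp
  define c where "c = (2 * pi) powr (- (real CARD('n) / 2))"
  have c: "c > 0" by (simp add: c_def)
  have "ennreal (cmod (stft_dual \<phi>\<^sub>1 u X)) \<le>
     ennreal (C A) * (\<integral>\<^sup>+Y. ennreal (exp (- (A * norm (X - Y))) * cmod (stft_dual \<phi>\<^sub>2 u Y)) \<partial>lborel)"
    if u: "u \<in> gs_dual" for A u X
  proof -
    \<comment> \<open>The phase arises from composing the translation in X with the modulation in Y
      - X.\<close>
    define b where "b Y = k (Y - X) * cis (fst X \<bullet> snd (Y - X))" for Y
    have nb: "cmod (b Y) = cmod (k (Y - X))" for Y by (simp add: b_def norm_mult)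
    have bm[measurable]: "b \<in> borel_measurable borel"
    proof -
      have "(\<lambda>Y. cis (fst X \<bullet> snd (Y - X))) \<in> borel_measurable borel"
        by (intro borel_measurable_continuous_onI continuous_intros)
      moreover have "(\<lambda>Y. k (Y - X)) \<in> borel_measurable borel" by measurable
      ultimately show ?thesis unfolding b_def[abs_def] by measurable
    qed
    have bd: "\<exists>D. \<forall>Y. cmod (b Y) \<le> D * exp (- (a * norm Y))" for a
    proof -
      have "cmod (b Y) \<le> (C \<bar>a\<bar> * exp (\<bar>a\<bar> * norm X)) * exp (- (a * norm Y))" for Y
      proof -
        have "norm Y \<le> norm X + norm (Y - X)" using norm_triangle_sub[of Y X] by simp
        then have "\<bar>a\<bar> * norm Y \<le> \<bar>a\<bar> * norm X + \<bar>a\<bar> * norm (Y - X)"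
          by (metis abs_ge_zero distrib_left mult_left_mono)
        moreover have "a * norm Y \<le> \<bar>a\<bar> * norm Y" by (intro mult_right_mono) auto
        ultimately have "exp (- (\<bar>a\<bar> * norm (Y - X))) \<le> exp (\<bar>a\<bar> * norm X) * exp (- (a * norm Y))"
          by (simp add: exp_add[symmetric])
        then have "C \<bar>a\<bar> * exp (- (\<bar>a\<bar> * norm (Y - X))) \<le> C \<bar>a\<bar> * (exp (\<bar>a\<bar> * norm X) * exp (- (a * norm Y)))"
          by (intro mult_left_mono C0)
        then show ?thesis unfolding nb using C[of "Y - X" "\<bar>a\<bar>"] by (simp add: mult.assoc)
      qed
      then show ?thesis by blast
    qed
    have repX: "tf_shift X f y = (\<integral>Y. b Y * tf_shift Y g y \<partial>lborel)" for y
    proof -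
      have m: "(\<lambda>Y. b Y * tf_shift Y g y) \<in> borel_measurable borel"
      proof -
        have "(\<lambda>Y. tf_shift Y g y) \<in> borel_measurable borel"
          using borel_measurable_continuous_onI[OF tf_shift_continuous[OF gs(1), of "[]" y]] by simp
        then show ?thesis by measurable
      qed
      have "tf_shift X f y = (\<integral>Z. k Z * tf_shift Z g (y - fst X) \<partial>lborel) * cis (- (y \<bullet> snd X))"
        by (simp add: tf_shift_def[of X] rep)
      also have "\<dots> = (\<integral>Z. k Z * tf_shift Z g (y - fst X) * cis (- (y \<bullet> snd X)) \<partial>lborel)"
        by (rule integral_mult_left_zero[symmetric])
      also have "\<dots> = (\<integral>Z. b (X + 1 *\<^sub>R Z) * tf_shift (X + 1 *\<^sub>R Z) g y \<partial>lborel)"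
      proof (rule Bochner_Integration.integral_cong[OF refl])
        fix Z :: "(real^'n) \<times> (real^'n)"
        have c: "cis (- ((y - fst X) \<bullet> snd Z)) * cis (- (y \<bullet> snd X)) = cis (fst X \<bullet> snd Z) * cis (- (y \<bullet> (snd X + snd Z)))"
          unfolding cis_mult by (simp add: inner_diff_left inner_add_right algebra_simps)
        have b: "b (X + 1 *\<^sub>R Z) = k Z * cis (fst X \<bullet> snd Z)"
          unfolding b_def scaleR_one add_diff_cancel_left' ..
        have t: "tf_shift (X + 1 *\<^sub>R Z) g y = g (y - fst X - fst Z) * cis (- (y \<bullet> (snd X + snd Z)))"
          unfolding tf_shift_def scaleR_one fst_add snd_add diff_diff_eq ..
        have "p * (q * c1) * c2 = p * d1 * (q * d2)" if "c1 * c2 = d1 * d2" for p q c1 c2 d1 d2 :: complex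
        proof -
          have "p * (q * c1) * c2 = p * q * (c1 * c2)" by (simp only: mult_ac)
          then show ?thesis unfolding that by (simp only: mult_ac)
        qed
        from this[OF c] show "k Z * tf_shift Z g (y - fst X) * cis (- (y \<bullet> snd X)) = b (X + 1 *\<^sub>R Z) * tf_shift (X + 1 *\<^sub>R Z) g y"
          unfolding b t tf_shift_def[of Z] by blast
      qed
      also have "\<dots> = (\<integral>Y. b Y * tf_shift Y g y \<partial>lborel)"
        using lborel_affine_euclidean_integral(1)[OF m, of 1 X] by simp
      finally show ?thesis .
    qed
    note I = gs_dual_integral[OF u gs(1) gs_space_tf_shift[OF gs(2)] bm bd repX]
    have U: "stft_dual \<phi>\<^sub>2 u Y = of_real c * u (tf_shift Y g)" for Y
      by (simp add: stft_dual_eq c_def g_def[abs_def])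
    have "stft_dual \<phi>\<^sub>1 u X = of_real c * (\<integral>Y. b Y * u (tf_shift Y g) \<partial>lborel)"
      by (simp add: stft_dual_eq c_def I(2)[symmetric] f_def[abs_def])
    also have "\<dots> = (\<integral>Y. b Y * stft_dual \<phi>\<^sub>2 u Y \<partial>lborel)"
      by (simp add: U mult.left_commute)
    finally have e: "stft_dual \<phi>\<^sub>1 u X = (\<integral>Y. b Y * stft_dual \<phi>\<^sub>2 u Y \<partial>lborel)" .
    have int: "integrable lborel (\<lambda>Y. b Y * stft_dual \<phi>\<^sub>2 u Y)"
      using integrable_mult_right[OF I(1), of "of_real c"] by (simp add: U mult.left_commute)
    have [measurable]: "stft_dual \<phi>\<^sub>2 u \<in> borel_measurable borel"
      by (rule borel_measurable_continuous_onI[OF stft_dual_continuous[OF u \<phi>\<^sub>2(1)]])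
    have "ennreal (cmod (stft_dual \<phi>\<^sub>1 u X)) \<le> (\<integral>\<^sup>+Y. ennreal (cmod (b Y * stft_dual \<phi>\<^sub>2 u Y)) \<partial>lborel)"
      unfolding e by (rule integral_norm_bound_ennreal[OF int])
    also have "\<dots> \<le> (\<integral>\<^sup>+Y. ennreal (C A) * ennreal (exp (- (A * norm (X - Y))) * cmod (stft_dual \<phi>\<^sub>2 u Y)) \<partial>lborel)"
    proof (rule nn_integral_mono)
      fix Y
      have "cmod (b Y) \<le> C A * exp (- (A * norm (X - Y)))"
        unfolding nb using C[of "Y - X" A] by (simp add: norm_minus_commute)
      then have "cmod (b Y * stft_dual \<phi>\<^sub>2 u Y) \<le> C A * exp (- (A * norm (X - Y))) * cmod (stft_dual \<phi>\<^sub>2 u Y)"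
        unfolding norm_mult by (rule mult_right_mono) simp
      then show "ennreal (cmod (b Y * stft_dual \<phi>\<^sub>2 u Y)) \<le> ennreal (C A) * ennreal (exp (- (A * norm (X - Y))) * cmod (stft_dual \<phi>\<^sub>2 u Y))"
        using C0[of A] by (simp add: ennreal_mult[symmetric] mult.assoc ennreal_leI)
    qed
    also have "\<dots> = ennreal (C A) * (\<integral>\<^sup>+Y. ennreal (exp (- (A * norm (X - Y))) * cmod (stft_dual \<phi>\<^sub>2 u Y)) \<partial>lborel)"
      by (rule nn_integral_cmult) measurable
    finally show ?thesis .
  qed
  then show ?thesis using C0 by (intro exI[of _ C]) auto
qed

text \<open>Jensen's inequality asks for a kernel of mass 1; J is the mass divided out.\<close>

lemma exp_norm_kernel:
  "\<exists>(k :: 'a::euclidean_space \<Rightarrow> ennreal) J. J > 0 \<and> k \<in> borel_measurable borel \<and> (\<forall>x. k (- x) = k x) \<and>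
    (\<integral>\<^sup>+x. k x \<partial>lborel) = 1 \<and> (\<forall>x. ennreal (exp (- norm x)) = ennreal J * k x)"
proof -
  define J where "J = (\<integral>x. exp (- (1 * norm (x :: 'a))) \<partial>lborel)"
  have i: "integrable lborel (\<lambda>x :: 'a. exp (- (1 * norm x)))" by (rule integrable_exp_norm) simp
  have nn: "(\<integral>\<^sup>+x. ennreal (exp (- (1 * norm (x :: 'a)))) \<partial>lborel) = ennreal J"
    unfolding J_def by (rule nn_integral_eq_integral[OF i]) simp
  have "J \<noteq> 0"
  proof
    assume "J = 0"
    then have "(\<integral>\<^sup>+x. ennreal (exp (- (1 * norm (x :: 'a)))) \<partial>lborel) = 0" using nn by simp
    then have "AE x in lborel. ennreal (exp (- (1 * norm (x :: 'a)))) = 0"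
      by (subst (asm) nn_integral_0_iff_AE) auto
    then have "AE x in (lborel :: 'a measure). False" by simp
    then have "emeasure (lborel :: 'a measure) UNIV = 0" by (simp add: eventually_False ae_filter_eq_bot_iff)
    then show False by simp
  qed
  then have J: "J > 0" unfolding J_def by (simp add: less_le)
  define k :: "'a \<Rightarrow> ennreal" where "k x = ennreal (1 / J) * ennreal (exp (- (1 * norm x)))" for x
  have km: "k \<in> borel_measurable borel" unfolding k_def[abs_def] by measurable
  have "(\<integral>\<^sup>+x. k x \<partial>lborel) = ennreal (1 / J) * ennreal J"
    unfolding k_def by (subst nn_integral_cmult) (auto simp: nn[simplified])
  also have "\<dots> = 1" using J by (simp add: ennreal_mult[symmetric])
  finally have k1: "(\<integral>\<^sup>+x. k x \<partial>lborel) = 1" .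
  have "ennreal (exp (- norm x)) = ennreal J * k x" for x :: 'a
    using J by (simp add: k_def mult.assoc[symmetric] ennreal_mult[symmetric])
  moreover have "k (- x) = k x" for x by (simp add: k_def)
  ultimately show ?thesis using J km k1 by blast
qed

text \<open>The r-th power of the convolution estimate is multiplied by the power of the weight,
  which is moved from X to Y inside the integral; the remaining kernel is bounded by a product of
  kernels in x and \<xi>, as the mixed quasi-norm requires.\<close>

lemma modulation_norm_window_change:
  fixes \<omega> v :: "(real^'n::finite) \<times> (real^'n) \<Rightarrow> real" and \<phi>\<^sub>1 \<phi>\<^sub>2 :: "real^'n \<Rightarrow> complex"
  assumes Y: "quasi_young r \<Phi>\<^sub>1" "quasi_young r \<Phi>\<^sub>2"
    and \<omega>: "weight \<omega>" and v: "weight v" "submultiplicative v" and mod: "moderate v \<omega>"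
    and \<phi>\<^sub>1: "\<phi>\<^sub>1 \<in> gs_space" and \<phi>\<^sub>2: "\<phi>\<^sub>2 \<in> gs_space" "\<phi>\<^sub>2 \<noteq> (\<lambda>_. 0)"
  shows "\<exists>c>0. \<forall>u\<in>gs_dual. mixed_orlicz_norm \<Phi>\<^sub>1 \<Phi>\<^sub>2 \<omega> (stft_dual \<phi>\<^sub>1 u) \<le>
    ennreal c * mixed_orlicz_norm \<Phi>\<^sub>1 \<Phi>\<^sub>2 \<omega> (stft_dual \<phi>\<^sub>2 u)"
proof -
  have r: "0 < r" "r \<le> 1" using Y(1) by (auto simp: quasi_young_def)
  obtain w W b where W: "W > 0" and b: "b \<ge> 0" and wc: "continuous_on UNIV w" and w0: "\<And>X. 0 < w X"
    and w\<omega>: "\<And>X. w X \<le> \<omega> X" and \<omega>w: "\<And>X. \<omega> X \<le> W * w X" and ww: "\<And>X Y. w X \<le> w Y * exp (b * norm (X - Y))"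
    using equivalent_continuous_weight[OF \<omega> v mod] by metis
  have [measurable]: "w \<in> borel_measurable borel" by (rule borel_measurable_continuous_onI[OF wc])
  have \<omega>0: "\<omega> X > 0" for X using w0[of X] w\<omega>[of X] by linarith
  obtain C1 :: "real \<Rightarrow> real" where C1: "\<And>A. C1 A \<ge> 0" "\<And>A u X. u \<in> gs_dual \<Longrightarrow> ennreal (cmod (stft_dual \<phi>\<^sub>1 u X)) \<le>
     ennreal (C1 A) * (\<integral>\<^sup>+Y. ennreal (exp (- (A * norm (X - Y))) * cmod (stft_dual \<phi>\<^sub>2 u Y)) \<partial>lborel)"
    using stft_dual_convolution_bound[OF \<phi>\<^sub>1 \<phi>\<^sub>2] by blast
  \<comment> \<open>The estimate of \<open>\<phi>\<^sub>2\<close> by itself allows the power r to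
    enter the integral.\<close>
  obtain C2 :: "real \<Rightarrow> real" where C2: "\<And>A. C2 A \<ge> 0" "\<And>A u X. u \<in> gs_dual \<Longrightarrow> ennreal (cmod (stft_dual \<phi>\<^sub>2 u X)) \<le>
     ennreal (C2 A) * (\<integral>\<^sup>+Y. ennreal (exp (- (A * norm (X - Y))) * cmod (stft_dual \<phi>\<^sub>2 u Y)) \<partial>lborel)"
    using stft_dual_convolution_bound[OF \<phi>\<^sub>2(1) \<phi>\<^sub>2] by blast
  \<comment> \<open>One constant for both estimates, made positive by the added 1.\<close>
  define C where "C A = max (C1 A) (C2 A) + 1" for A
  have C: "C A > 0" "C1 A \<le> C A" "C2 A \<le> C A" for A using C1(1)[of A] by (auto simp: C_def)
  obtain k :: "real^'n \<Rightarrow> ennreal" and J :: real where J: "J > 0" and k: "k \<in> borel_measurable borel" "\<And>x. k (- x) = k x"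
    "(\<integral>\<^sup>+x. k x \<partial>lborel) = 1" and kJ: "\<And>x. ennreal (exp (- norm x)) = ennreal J * k x"
    using exp_norm_kernel[where 'a = "real^'n"] by metis
  \<comment> \<open>Then r A = r b + 2: the part r b pays for moving the r-th power of the weight,
    and exp (- 2 |X - Y|) is at most the product of the exponentials of rate 1 in the two
    components.\<close>
  define A where "A = b + 2 / r"
  have A: "A > 0" using b r by (simp add: A_def add_nonneg_pos)
  define K where "K = W powr r * C A * (J * J)"
  have K: "K > 0" using W C(1)[of A] J by (simp add: K_def)
  have "mixed_orlicz_norm \<Phi>\<^sub>1 \<Phi>\<^sub>2 \<omega> (stft_dual \<phi>\<^sub>1 u) \<le>
    ennreal ((4 * K) powr (1 / r)) * mixed_orlicz_norm \<Phi>\<^sub>1 \<Phi>\<^sub>2 \<omega> (stft_dual \<phi>\<^sub>2 u)" if u: "u \<in> gs_dual" for u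
  proof -
    define F where "F Y = cmod (stft_dual \<phi>\<^sub>2 u Y)" for Y
    define G where "G Y = cmod (stft_dual \<phi>\<^sub>1 u Y)" for Y
    have Fm[measurable]: "F \<in> borel_measurable borel"
      unfolding F_def[abs_def]
      using borel_measurable_continuous_onI[OF stft_dual_continuous[OF u \<phi>\<^sub>2(1)]] by measurable
    have F0: "F Y \<ge> 0" and G0: "G Y \<ge> 0" for Y by (simp_all add: F_def G_def)
    obtain D B where DB: "\<And>Y. F Y \<le> D * exp (B * norm Y)"
      unfolding F_def using stft_dual_growth[OF u \<phi>\<^sub>2(1)] by blast
    have FC: "ennreal (F X) \<le> ennreal (C a) * (\<integral>\<^sup>+Y. ennreal (exp (- (a * norm (X - Y))) * F Y) \<partial>lborel)" for a X
      unfolding F_def by (rule order_trans[OF C2(2)[OF u] mult_right_mono[OF ennreal_leI[OF C(3)]]]) simp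
    have GC: "ennreal (G X) \<le> ennreal (C a) * (\<integral>\<^sup>+Y. ennreal (exp (- (a * norm (X - Y))) * F Y) \<partial>lborel)" for a X
      unfolding F_def G_def by (rule order_trans[OF C1(2)[OF u] mult_right_mono[OF ennreal_leI[OF C(2)]]]) simp
    have Gr: "ennreal (G X powr r) \<le> ennreal (C A) * (\<integral>\<^sup>+Y. ennreal (exp (- (r * A * norm (X - Y))) * F Y powr r) \<partial>lborel)" for X
      by (rule powr_kernel_bound[OF F0 Fm r A less_imp_le[OF C(1)] FC G0 GC DB])
    \<comment> \<open>The continuous weight w makes H Borel measurable, and w \<le> \<omega> makes
      it a minorant.\<close>
    define H where "H Y = F Y * w Y" for Y
    have Hm[measurable]: "H \<in> borel_measurable borel" unfolding H_def[abs_def] by measurable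
    show ?thesis
    proof (rule mixed_orlicz_norm_le[OF Y k K Hm])
      show "0 \<le> H p" for p using F0 w0[of p] by (simp add: H_def)
      show "H p \<le> cmod (stft_dual \<phi>\<^sub>2 u p * of_real (\<omega> p))" for p
        using w\<omega>[of p] \<omega>0[of p] by (simp add: H_def F_def norm_mult mult_left_mono)
      fix x \<xi> :: "real^'n"
      let ?X = "(x, \<xi>)"
      have "ennreal (cmod (stft_dual \<phi>\<^sub>1 u ?X * of_real (\<omega> ?X)) powr r) = ennreal (\<omega> ?X powr r) * ennreal (G ?X powr r)"
        using \<omega>0[of ?X] by (simp add: G_def norm_mult powr_mult ennreal_mult mult.commute)
      also have "\<dots> \<le> ennreal ((W * w ?X) powr r) * (ennreal (C A) * (\<integral>\<^sup>+Y. ennreal (exp (- (r * A * norm (?X - Y))) * F Y powr r) \<partial>lborel))"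
        using \<omega>w[of ?X] \<omega>0[of ?X] r by (intro mult_mono Gr ennreal_leI powr_mono2) auto
      also have "\<dots> = ennreal (W powr r * C A) * (ennreal (w ?X powr r) * (\<integral>\<^sup>+Y. ennreal (exp (- (r * A * norm (?X - Y))) * F Y powr r) \<partial>lborel))"
        using W w0[of ?X] C(1)[of A] by (simp add: powr_mult ennreal_mult mult_ac)
      also have "ennreal (w ?X powr r) * (\<integral>\<^sup>+Y. ennreal (exp (- (r * A * norm (?X - Y))) * F Y powr r) \<partial>lborel) =
          (\<integral>\<^sup>+Y. ennreal (w ?X powr r) * ennreal (exp (- (r * A * norm (?X - Y))) * F Y powr r) \<partial>lborel)"
        by (rule nn_integral_cmult[symmetric]) measurable
      also have "\<dots> \<le> (\<integral>\<^sup>+Y. ennreal (J * J) * (k (\<xi> - snd Y) * (k (x - fst Y) * ennreal (H Y powr r))) \<partial>lborel)"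
      proof (rule nn_integral_mono)
        fix Y :: "(real^'n) \<times> (real^'n)"
        have "w ?X powr r \<le> (w Y * exp (b * norm (?X - Y))) powr r"
          using w0[of ?X] r by (intro powr_mono2 ww) auto
        also have "\<dots> = w Y powr r * exp (r * (b * norm (?X - Y)))"
          using w0[of Y] by (simp add: powr_mult powr_def[of "exp _"])
        finally have 1: "w ?X powr r \<le> w Y powr r * exp (r * (b * norm (?X - Y)))" .
        have "norm (\<xi> - snd Y) + norm (x - fst Y) \<le> 2 * norm (?X - Y)"
          using norm_fst_le[of "x - fst Y" "\<xi> - snd Y"] norm_snd_le[of "\<xi> - snd Y" "x - fst Y"]
          by (cases Y) simp
        moreover have "r * (b * norm (?X - Y)) + - (r * A * norm (?X - Y)) = - (2 * norm (?X - Y))"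
          using r by (simp add: A_def field_simps)
        ultimately have 2: "exp (r * (b * norm (?X - Y))) * exp (- (r * A * norm (?X - Y))) \<le>
            exp (- norm (\<xi> - snd Y)) * exp (- norm (x - fst Y))"
          unfolding exp_add[symmetric] by simp
        have "w ?X powr r * (exp (- (r * A * norm (?X - Y))) * F Y powr r) \<le>
            (w Y powr r * exp (r * (b * norm (?X - Y)))) * (exp (- (r * A * norm (?X - Y))) * F Y powr r)"
          by (rule mult_right_mono[OF 1]) simp
        also have "\<dots> = (exp (r * (b * norm (?X - Y))) * exp (- (r * A * norm (?X - Y)))) * H Y powr r"
          using F0[of Y] w0[of Y] by (simp add: H_def powr_mult)
        also have "\<dots> \<le> (exp (- norm (\<xi> - snd Y)) * exp (- norm (x - fst Y))) * H Y powr r"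
          by (rule mult_right_mono[OF 2]) simp
        finally have "ennreal (w ?X powr r * (exp (- (r * A * norm (?X - Y))) * F Y powr r)) \<le>
            ennreal (exp (- norm (\<xi> - snd Y)) * exp (- norm (x - fst Y)) * H Y powr r)" by (rule ennreal_leI)
        also have "\<dots> = (ennreal J * k (\<xi> - snd Y)) * (ennreal J * k (x - fst Y)) * ennreal (H Y powr r)"
          unfolding kJ[symmetric] by (simp add: ennreal_mult)
        also have "\<dots> = ennreal (J * J) * (k (\<xi> - snd Y) * (k (x - fst Y) * ennreal (H Y powr r)))"
          using J by (simp add: ennreal_mult mult_ac)
        finally show "ennreal (w ?X powr r) * ennreal (exp (- (r * A * norm (?X - Y))) * F Y powr r) \<le>
            ennreal (J * J) * (k (\<xi> - snd Y) * (k (x - fst Y) * ennreal (H Y powr r)))"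
          by (simp add: ennreal_mult)
      qed
      also have "\<dots> = ennreal (J * J) * (\<integral>\<^sup>+Y. k (\<xi> - snd Y) * (k (x - fst Y) * ennreal (H Y powr r)) \<partial>lborel)"
      proof (rule nn_integral_cmult)
        have [measurable]: "H \<in> borel_measurable (borel \<Otimes>\<^sub>M borel)" "k \<in> borel_measurable borel"
          using Hm k(1) by (simp_all add: borel_prod)
        have "(\<lambda>Y. k (\<xi> - snd Y) * (k (x - fst Y) * ennreal (H Y powr r))) \<in> borel_measurable (borel \<Otimes>\<^sub>M borel)"
          by measurable
        then show "(\<lambda>Y. k (\<xi> - snd Y) * (k (x - fst Y) * ennreal (H Y powr r))) \<in> borel_measurable lborel"
          by (simp add: borel_prod)
      qed
      also have "(\<integral>\<^sup>+Y. k (\<xi> - snd Y) * (k (x - fst Y) * ennreal (H Y powr r)) \<partial>lborel) =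
          (\<integral>\<^sup>+\<zeta>. \<integral>\<^sup>+z. k (\<xi> - \<zeta>) * (k (x - z) * ennreal (H (z, \<zeta>) powr r)) \<partial>lborel \<partial>lborel)"
      proof (subst nn_integral_lborel_pair)
        have [measurable]: "H \<in> borel_measurable (borel \<Otimes>\<^sub>M borel)" "k \<in> borel_measurable borel"
          using Hm k(1) by (simp_all add: borel_prod)
        have "(\<lambda>Y. k (\<xi> - snd Y) * (k (x - fst Y) * ennreal (H Y powr r))) \<in> borel_measurable (borel \<Otimes>\<^sub>M borel)"
          by measurable
        then show "(\<lambda>Y. k (\<xi> - snd Y) * (k (x - fst Y) * ennreal (H Y powr r))) \<in> borel_measurable borel"
          by (simp add: borel_prod)
      qed simp
      finally show "ennreal (cmod (stft_dual \<phi>\<^sub>1 u ?X * of_real (\<omega> ?X)) powr r) \<le>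
          ennreal K * (\<integral>\<^sup>+\<zeta>. \<integral>\<^sup>+z. k (\<xi> - \<zeta>) * (k (x - z) * ennreal (H (z, \<zeta>) powr r)) \<partial>lborel \<partial>lborel)"
        using W C(1)[of A] J by (simp add: K_def ennreal_mult mult_left_mono mult.assoc)
    qed
  qed
  then show ?thesis using K by (intro exI[of _ "(4 * K) powr (1 / r)"]) auto
qed

section \<open>Nonvanishing of the transform of the dual window\<close>

text \<open>With the exponential E, the pairing converges by 2 |\<psi>| E \<le> |\<psi>|^2 + E^2,
  and \<open>gs_bound_seminorm\<close> bounds a test function by a multiple of E that is linear in a
  single seminorm. The results on functionals then apply to the dual window.\<close>

lemma L2_gs_dual:
  fixes \<psi> :: "real^'n::finite \<Rightarrow> complex"
  assumes \<psi>: "\<psi> \<in> L2"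
  shows "(\<lambda>g. LINT y|lebesgue. \<psi> y * g y) \<in> gs_dual"
proof -
  have m[measurable]: "\<psi> \<in> borel_measurable lebesgue" and i2: "integrable lebesgue (\<lambda>x. (cmod (\<psi> x))\<^sup>2)"
    using \<psi> by (auto simp: L2_def)
  define E where "E y = exp (- (1 * norm y))" for y :: "real^'n"
  have Em[measurable]: "E \<in> borel_measurable lebesgue"
    unfolding E_def[abs_def] by (intro measurable_completion) measurable
  have E2: "integrable lebesgue (\<lambda>y. (E y)\<^sup>2)"
  proof -
    have "(\<lambda>y. (E y)\<^sup>2) = (\<lambda>y. exp (- (2 * norm y)))"
      by (auto simp: E_def power2_eq_square exp_add[symmetric])
    moreover have "integrable lborel (\<lambda>y :: real^'n. exp (- (2 * norm y)))" by (rule integrable_exp_norm) simp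
    moreover have "(\<lambda>y :: real^'n. exp (- (2 * norm y))) \<in> borel_measurable lborel" by measurable
    ultimately show ?thesis by (simp add: integrable_completion)
  qed
  have iE: "integrable lebesgue (\<lambda>y. cmod (\<psi> y) * E y)"
  proof (rule Bochner_Integration.integrable_bound[OF Bochner_Integration.integrable_add[OF i2 E2]])
    show "AE y in lebesgue. norm (cmod (\<psi> y) * E y) \<le> norm ((cmod (\<psi> y))\<^sup>2 + (E y)\<^sup>2)"
    proof (rule AE_I2)
      fix y
      have "0 \<le> (cmod (\<psi> y) - E y)\<^sup>2" by simp
      then have "2 * (cmod (\<psi> y) * E y) \<le> (cmod (\<psi> y))\<^sup>2 + (E y)\<^sup>2"
        by (simp add: power2_diff)
      moreover have "0 \<le> cmod (\<psi> y) * E y" by (simp add: E_def)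
      ultimately show "norm (cmod (\<psi> y) * E y) \<le> norm ((cmod (\<psi> y))\<^sup>2 + (E y)\<^sup>2)" by simp
    qed
  qed measurable
  obtain k D where k: "k > 0" and D: "D \<ge> 0"
    and b: "\<And>g :: real^'n \<Rightarrow> complex. g \<in> gs_space \<Longrightarrow> gs_bound 1 1 (D * enn2real (gs_seminorm k g)) g"
    using gs_bound_seminorm[where 'n = 'n, of 1 1] by auto
  let ?s = "\<lambda>g. D * enn2real (gs_seminorm k g)"
  have gm: "g \<in> borel_measurable lebesgue" if "g \<in> gs_space" for g :: "real^'n \<Rightarrow> complex"
    using smooth_borel_measurable[OF gs_space_smooth[OF that]] by (intro measurable_completion) simp
  have le: "cmod (\<psi> y * g y) \<le> ?s g * (cmod (\<psi> y) * E y)" if g: "g \<in> gs_space" for g y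
  proof -
    have "cmod (g y) \<le> ?s g * E y" using gs_boundD[OF b[OF g], of "[]" y] by (simp add: E_def)
    then have "cmod (\<psi> y) * cmod (g y) \<le> cmod (\<psi> y) * (?s g * E y)" by (rule mult_left_mono) simp
    then show ?thesis by (simp add: norm_mult mult_ac)
  qed
  have int: "integrable lebesgue (\<lambda>y. \<psi> y * g y)" if g: "g \<in> gs_space" for g
  proof (rule Bochner_Integration.integrable_bound[OF integrable_mult_right[OF iE, of "?s g"]])
    show "(\<lambda>y. \<psi> y * g y) \<in> borel_measurable lebesgue" using m gm[OF g] by measurable
    show "AE y in lebesgue. cmod (\<psi> y * g y) \<le> norm (?s g * (cmod (\<psi> y) * E y))"
      by (intro AE_I2 order_trans[OF le[OF g]]) simp
  qed
  define M where "M = (LINT y|lebesgue. cmod (\<psi> y) * E y)"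
  have M: "M \<ge> 0" unfolding M_def by (intro integral_nonneg_AE AE_I2) (simp add: E_def)
  have bound: "ennreal (cmod (LINT y|lebesgue. \<psi> y * g y)) \<le> ennreal (D * M) * gs_seminorm k g"
    if g: "g \<in> gs_space" for g
  proof -
    have "cmod (LINT y|lebesgue. \<psi> y * g y) \<le> (LINT y|lebesgue. ?s g * (cmod (\<psi> y) * E y))"
      by (rule Bochner_Integration.integral_norm_bound_integral[OF int[OF g] integrable_mult_right[OF iE] le[OF g]])
    also have "\<dots> = D * M * enn2real (gs_seminorm k g)" by (simp add: M_def)
    finally have "ennreal (cmod (LINT y|lebesgue. \<psi> y * g y)) \<le> ennreal (D * M * enn2real (gs_seminorm k g))"
      by (rule ennreal_leI)
    also have "\<dots> = ennreal (D * M) * gs_seminorm k g"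
    proof -
      have "gs_seminorm k g < top" using g k by (simp add: gs_space_def)
      then show ?thesis using D M by (simp add: ennreal_mult)
    qed
    finally show ?thesis .
  qed
  have add: "(LINT y|lebesgue. \<psi> y * (f y + g y)) = (LINT y|lebesgue. \<psi> y * f y) + (LINT y|lebesgue. \<psi> y * g y)"
    if "f \<in> gs_space" "g \<in> gs_space" for f g
    using int[OF that(1)] int[OF that(2)] by (simp add: distrib_left)
  have cmult: "(LINT y|lebesgue. \<psi> y * (c * f y)) = c * (LINT y|lebesgue. \<psi> y * f y)" for c f
    by (simp only: mult.left_commute[of _ c] integral_mult_right_zero)
  show ?thesis
    unfolding gs_dual_def using add cmult bound k by blast
qed

lemma weighted_norm_stft_nonzero:
  fixes \<phi>\<^sub>1 \<phi>\<^sub>2 \<psi> :: "real^'n::finite \<Rightarrow> complex"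
  assumes r: "r > 0" and v: "weight v"
    and \<phi>\<^sub>1: "\<phi>\<^sub>1 \<in> gs_space" "\<phi>\<^sub>1 \<noteq> (\<lambda>_. 0)" and \<phi>\<^sub>2: "\<phi>\<^sub>2 \<in> gs_space" "\<phi>\<^sub>2 \<noteq> (\<lambda>_. 0)"
    and S: "gabor_operator \<epsilon> \<phi>\<^sub>2 \<psi> \<phi>\<^sub>2"
  shows "weighted_Lr_norm r v (stft \<phi>\<^sub>1 \<psi>) \<noteq> 0"
proof
  assume zero: "weighted_Lr_norm r v (stft \<phi>\<^sub>1 \<psi>) = 0"
  define u where "u g = (LINT y|lebesgue. \<psi> y * g y)" for g :: "real^'n \<Rightarrow> complex"
  have u: "u \<in> gs_dual"
    unfolding u_def[abs_def] using S by (intro L2_gs_dual) (simp add: gabor_operator_def)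
  have V: "stft \<phi> \<psi> = stft_dual \<phi> u" for \<phi>
    unfolding u_def[abs_def] by (rule stft_dual_of_function[symmetric])
  have v0: "v X > 0" for X using v unfolding weight_def by blast
  have vm: "v \<in> borel_measurable lebesgue" using v by (simp add: weight_def Linf_loc_def)
  have Vc: "continuous_on UNIV (stft_dual \<phi>\<^sub>1 u)" by (rule stft_dual_continuous[OF u \<phi>\<^sub>1(1)])
  have Vm: "stft_dual \<phi>\<^sub>1 u \<in> borel_measurable lebesgue"
    using borel_measurable_continuous_onI[OF Vc] by (intro measurable_completion) simp
  let ?I = "\<integral>\<^sup>+X. ennreal (cmod (stft_dual \<phi>\<^sub>1 u X * of_real (v X)) powr r) \<partial>lebesgue"
  have "?I = 0"
    using zero unfolding weighted_Lr_norm_def V by (cases ?I) (auto simp: Let_def split: if_splits)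
  then have "AE X in lebesgue. ennreal (cmod (stft_dual \<phi>\<^sub>1 u X * of_real (v X)) powr r) = 0"
    using Vm vm by (subst (asm) nn_integral_0_iff_AE) auto
  then have "AE X in lebesgue. stft_dual \<phi>\<^sub>1 u X = 0"
  proof eventually_elim
    case (elim X)
    then have "cmod (stft_dual \<phi>\<^sub>1 u X * of_real (v X)) powr r = 0"
      by (metis ennreal_eq_0_iff order_antisym powr_ge_zero)
    then show ?case using v0[of X] by simp
  qed
  then have z1: "stft_dual \<phi>\<^sub>1 u = (\<lambda>_. 0)" by (rule continuous_AE_zero[OF Vc])
  \<comment> \<open>The convolution bound with the windows exchanged passes the vanishing to the
    window of the Gabor system, at every point and in particular on the lattice.\<close>
  have z2: "stft_dual \<phi>\<^sub>2 u X = 0" for X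
  proof -
    obtain C where "ennreal (cmod (stft_dual \<phi>\<^sub>2 u X)) \<le>
        ennreal C * (\<integral>\<^sup>+Y. ennreal (exp (- (1 * norm (X - Y))) * cmod (stft_dual \<phi>\<^sub>1 u Y)) \<partial>lborel)"
      using stft_dual_convolution_bound[OF \<phi>\<^sub>2(1) \<phi>\<^sub>1] u by blast
    then show ?thesis by (simp add: z1)
  qed
  let ?I = "lattice_points \<epsilon> \<times> lattice_points \<epsilon> :: ((real^'n) \<times> (real^'n)) set"
  have "L2_has_sum (\<lambda>p y. stft \<phi>\<^sub>2 \<psi> p * gabor_atom \<phi>\<^sub>2 p y) ?I \<phi>\<^sub>2"
    using S by (simp add: gabor_operator_def)
  \<comment> \<open>All coefficients vanish, so every finite partial sum is 0 and its distance to
    \<open>\<phi>\<^sub>2\<close> is constant along the net.\<close>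
  then have L2: "\<phi>\<^sub>2 \<in> L2" and "((\<lambda>F. L2_norm (\<lambda>x. - \<phi>\<^sub>2 x)) \<longlongrightarrow> 0) (finite_subsets_at_top ?I)"
    unfolding L2_has_sum_def V by (simp_all add: z2)
  then have "L2_norm (\<lambda>x. - \<phi>\<^sub>2 x) = 0"
    by (simp add: tendsto_const_iff)
  then have "(LINT x|lebesgue. (cmod (\<phi>\<^sub>2 x))\<^sup>2) = 0" by (simp add: L2_norm_def)
  then have "AE x in lebesgue. (cmod (\<phi>\<^sub>2 x))\<^sup>2 = 0"
    using L2 by (subst (asm) integral_nonneg_eq_0_iff_AE) (auto simp: L2_def)
  then have "AE x in lebesgue. \<phi>\<^sub>2 x = 0" by simp
  then have "\<phi>\<^sub>2 = (\<lambda>_. 0)"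
    by (rule continuous_AE_zero[OF smooth_continuous[OF gs_space_smooth[OF \<phi>\<^sub>2(1)]]])
  with \<phi>\<^sub>2(2) show False by simp
qed

text \<open>A positive finite norm w of the transform of \<psi> is absorbed into the constant, as c
  / w; only an infinite norm needs a separate argument.\<close>

lemma modulation_norm_dual_window:
  fixes \<omega> v :: "(real^'n::finite) \<times> (real^'n) \<Rightarrow> real" and \<phi>\<^sub>1 \<phi>\<^sub>2 \<psi> :: "real^'n \<Rightarrow> complex"
  assumes Y: "quasi_young r \<Phi>\<^sub>1" "quasi_young r \<Phi>\<^sub>2"
    and \<omega>: "weight \<omega>" and v: "weight v" "submultiplicative v" and mod: "moderate v \<omega>"
    and \<phi>\<^sub>1: "\<phi>\<^sub>1 \<in> gs_space" "\<phi>\<^sub>1 \<noteq> (\<lambda>_. 0)" and \<phi>\<^sub>2: "\<phi>\<^sub>2 \<in> gs_space" "\<phi>\<^sub>2 \<noteq> (\<lambda>_. 0)"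
    and S: "gabor_operator \<epsilon> \<phi>\<^sub>2 \<psi> \<phi>\<^sub>2"
  shows "\<exists>c>0. \<forall>f\<in>gs_dual. mixed_orlicz_norm \<Phi>\<^sub>1 \<Phi>\<^sub>2 \<omega> (stft_dual \<phi>\<^sub>1 f) \<le>
    ennreal c * weighted_Lr_norm r v (stft \<phi>\<^sub>1 \<psi>) * mixed_orlicz_norm \<Phi>\<^sub>1 \<Phi>\<^sub>2 \<omega> (stft_dual \<phi>\<^sub>2 f)"
proof -
  let ?W = "weighted_Lr_norm r v (stft \<phi>\<^sub>1 \<psi>)" and ?M = "\<lambda>\<phi> f. mixed_orlicz_norm \<Phi>\<^sub>1 \<Phi>\<^sub>2 \<omega> (stft_dual \<phi> f)"
  have "r > 0" using Y(1) by (simp add: quasi_young_def)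
  then have W: "?W \<noteq> 0" by (rule weighted_norm_stft_nonzero[OF _ v(1) \<phi>\<^sub>1 \<phi>\<^sub>2 S])
  obtain c where c: "c > 0" and le: "\<And>f. f \<in> gs_dual \<Longrightarrow> ?M \<phi>\<^sub>1 f \<le> ennreal c * ?M \<phi>\<^sub>2 f"
    using modulation_norm_window_change[OF Y \<omega> v mod \<phi>\<^sub>1(1) \<phi>\<^sub>2] by blast
  show ?thesis
  proof (cases ?W)
    case (real w)
    then have w: "w > 0" using W by (auto simp: less_le)
    have "ennreal (c / w) * ?W = ennreal c" using real w c by (simp add: ennreal_mult[symmetric])
    then show ?thesis using le c w by (intro exI[of _ "c / w"]) auto
  next
    \<comment> \<open>The right side is infinite unless the quasi-norm with
      \<open>\<phi>\<^sub>2\<close> is 0; in that case it is 0, and the comparison of windows gives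
      0 on the left as well.\<close>
    case top
    have "?M \<phi>\<^sub>1 f \<le> ennreal 1 * ?W * ?M \<phi>\<^sub>2 f" if "f \<in> gs_dual" for f
      using le[OF that] top by (cases "?M \<phi>\<^sub>2 f = 0") (auto simp: ennreal_top_mult)
    then show ?thesis by (intro exI[of _ 1]) auto
  qed
qed

theorem theorem4p1:
  fixes \<Phi>\<^sub>1 \<Phi>\<^sub>2 :: "real \<Rightarrow> ennreal"
    and r\<^sub>0 \<epsilon> :: real
    and \<omega> v :: "(real^'n::finite) \<times> (real^'n) \<Rightarrow> real"
    and \<phi> \<psi> \<psi>\<^sub>0 :: "real^'n \<Rightarrow> complex"
  assumes "0 < r\<^sub>0" and "r\<^sub>0 \<le> 1"
    and "quasi_young r\<^sub>0 \<Phi>\<^sub>1" and "quasi_young r\<^sub>0 \<Phi>\<^sub>2"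
    and "\<omega> \<in> P_E" and "v \<in> P_E"
    and "submultiplicative v" and "moderate v \<omega>"
    and "\<phi> \<in> gs_space" and "\<phi> \<noteq> (\<lambda>_. 0)"
    and "\<epsilon> > 0"
    and "canonical_dual_window \<epsilon> \<phi> \<psi>"
    and "canonical_dual_window \<epsilon> gaussian \<psi>\<^sub>0"
  shows "(\<exists>c>0. \<forall>f\<in>gs_dual.
            mixed_orlicz_norm \<Phi>\<^sub>1 \<Phi>\<^sub>2 \<omega> (stft_dual gaussian f)
              \<le> ennreal c * weighted_Lr_norm r\<^sub>0 v (stft gaussian \<psi>)
                  * mixed_orlicz_norm \<Phi>\<^sub>1 \<Phi>\<^sub>2 \<omega> (stft_dual \<phi> f))
       \<and> (\<exists>c>0. \<forall>f\<in>gs_dual.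
            mixed_orlicz_norm \<Phi>\<^sub>1 \<Phi>\<^sub>2 \<omega> (stft_dual \<phi> f)
              \<le> ennreal c * weighted_Lr_norm r\<^sub>0 v (stft \<phi> \<psi>\<^sub>0)
                  * mixed_orlicz_norm \<Phi>\<^sub>1 \<Phi>\<^sub>2 \<omega> (stft_dual gaussian f))"
proof -
  have r: "quasi_young r\<^sub>0 \<Phi>\<^sub>1" "quasi_young r\<^sub>0 \<Phi>\<^sub>2" by fact+
  have w: "weight \<omega>" "weight v" using \<open>\<omega> \<in> P_E\<close> \<open>v \<in> P_E\<close> by (auto simp: P_E_def)
  have S: "gabor_operator \<epsilon> \<phi> \<psi> \<phi>" "gabor_operator \<epsilon> gaussian \<psi>\<^sub>0 gaussian"
    using \<open>canonical_dual_window \<epsilon> \<phi> \<psi>\<close> \<open>canonical_dual_window \<epsilon> gaussian \<psi>\<^sub>0\<close>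
    by (simp_all add: canonical_dual_window_def)
  \<comment> \<open>The two inequalities differ by exchanging \<phi> and the Gaussian; in each of
    them the dual window belongs to the window on the right side.\<close>
  note bound = modulation_norm_dual_window[OF r w(1,2) \<open>submultiplicative v\<close> \<open>moderate v \<omega>\<close>]
  show ?thesis
    using bound[OF gaussian_gs_space gaussian_nonzero \<open>\<phi> \<in> gs_space\<close> \<open>\<phi> \<noteq> (\<lambda>_. 0)\<close> S(1)]
      bound[OF \<open>\<phi> \<in> gs_space\<close> \<open>\<phi> \<noteq> (\<lambda>_. 0)\<close> gaussian_gs_space gaussian_nonzero S(2)]
    by blast
qed

end
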